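(* Consider rotational $(-\alpha)$-homogeneous solutions $(u,p,\rho)$ of the stationary inviscid Boussinesq equations having the $x_2$-symmetry and satisfying $\Pi:=p+\frac{|u|^2}{2}+x_2\rho\equiv\mathrm{const}$. Then: (i) For $-1/2\le\alpha\le1$, no such solutions $(u,p,\rho)\in C^1(\mathbb{R}^2\setminus\{0\})$ exist. (ii) For $-2<\alpha<-1/2$, no such solutions $(u,p,\rho)\in C^2(\mathbb{R}^2\setminus\{0\})$ exist. For $\alpha=-2$, no such solutions $(u,p,\rho)\in C^2(\mathbb{R}^2\setminus\{0\})$ exist for which $(\nabla^\perp\cdot u)/x_2$ vanishes on $x_2=0$. (iii) For every $\alpha>1$, such solutions $(u,p,\rho)\in C^2(\mathbb{R}^2\setminus\{0\})$ exist. (iv) For every $\alpha<-2$, such solutions $(u,p,\rho)\in C^1(\mathbb{R}^2)$ exist.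
   Context: The stationary two-dimensional inviscid Boussinesq equations for $u=(u^1,u^2)$, $p$, $\rho$ are $$u\cdot\nabla u+\nabla p=-\rho e_2,\qquad \nabla\cdot u=0,\qquad u\cdot\nabla\rho=0,\qquad e_2=(0,1).$$ For functions in $C^k(\mathbb{R}^2\setminus\{0\})$ the equations are required in $\mathbb{R}^2\setminus\{0\}$; for functions in $C^1(\mathbb{R}^2)$ they are required in $\mathbb{R}^2$. For $\alpha\in\mathbb{R}$, $(u,p,\rho)$ is $(-\alpha)$-homogeneous if $u(x)=|x|^{-\alpha}u(x/|x|)$, $p(x)=|x|^{-2\alpha}p(x/|x|)$, $\rho(x)=|x|^{-2\alpha-1}\rho(x/|x|)$ for $x\ne0$. $x_2$-symmetry: $u^1(x_1,x_2)=u^1(x_1,-x_2)$, $u^2(x_1,x_2)=-u^2(x_1,-x_2)$, $p(x_1,x_2)=p(x_1,-x_2)$, $\rho(x_1,x_2)=-\rho(x_1,-x_2)$. The vorticity is $\omega=\nabla^\perp\cdot u=\partial_1u^2-\partial_2u^1$, with $\nabla^\perp=(-\partial_2,\partial_1)$; a solution is rotational if $\omega\not\equiv0$. By the symmetry $\omega$ is odd in $x_2$, so for $u\in C^2(\mathbb{R}^2\setminus\{0\})$ the function $\omega/x_2$ extends continuously to $\{x_2=0\}\setminus\{0\}$. *)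

theory Defs
  imports "HOL-Analysis.Analysis"
begin

definition partial_deriv :: "2 \<Rightarrow> (real^2 \<Rightarrow> 'b::real_normed_vector) \<Rightarrow> real^2 \<Rightarrow> 'b" where
  "partial_deriv i f x = frechet_derivative f (at x) (axis i 1)"

text \<open>\<open>Ck_on k D f\<close> is meant for open \<open>D\<close> only: the derivatives are two-sided.\<close>

primrec Ck_on :: "nat \<Rightarrow> (real^2) set \<Rightarrow> (real^2 \<Rightarrow> 'b::real_normed_vector) \<Rightarrow> bool" where
  "Ck_on 0 D f \<longleftrightarrow> continuous_on D f"
| "Ck_on (Suc k) D f \<longleftrightarrow>
     (\<forall>x\<in>D. f differentiable (at x)) \<and> (\<forall>i. Ck_on k D (partial_deriv i f))"

definition vorticity :: "(real^2 \<Rightarrow> real^2) \<Rightarrow> real^2 \<Rightarrow> real" where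
  "vorticity u x = partial_deriv 1 (\<lambda>y. u y $ 2) x - partial_deriv 2 (\<lambda>y. u y $ 1) x"

definition boussinesq_on ::
    "(real^2) set \<Rightarrow> (real^2 \<Rightarrow> real^2) \<Rightarrow> (real^2 \<Rightarrow> real) \<Rightarrow> (real^2 \<Rightarrow> real) \<Rightarrow> bool" where
  "boussinesq_on D u p \<rho> \<longleftrightarrow> (\<forall>x\<in>D.
     (\<Sum>i\<in>UNIV. u x $ i *\<^sub>R partial_deriv i u x) + (\<chi> i. partial_deriv i p x)
       = - (\<rho> x *\<^sub>R axis 2 1) \<and>
     (\<Sum>i\<in>UNIV. partial_deriv i (\<lambda>y. u y $ i) x) = 0 \<and>
     (\<Sum>i\<in>UNIV. u x $ i * partial_deriv i \<rho> x) = 0)"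

text \<open>\<open>homogeneous_sol \<alpha>\<close> is \<open>(-\<alpha>)\<close>-homogeneity; the values at the origin are unconstrained.\<close>

definition homogeneous_sol ::
    "real \<Rightarrow> (real^2 \<Rightarrow> real^2) \<Rightarrow> (real^2 \<Rightarrow> real) \<Rightarrow> (real^2 \<Rightarrow> real) \<Rightarrow> bool" where
  "homogeneous_sol \<alpha> u p \<rho> \<longleftrightarrow> (\<forall>x. x \<noteq> 0 \<longrightarrow>
     u x = norm x powr (- \<alpha>) *\<^sub>R u (x /\<^sub>R norm x) \<and>
     p x = norm x powr (- 2 * \<alpha>) * p (x /\<^sub>R norm x) \<and>
     \<rho> x = norm x powr (- 2 * \<alpha> - 1) * \<rho> (x /\<^sub>R norm x))"

definition reflect2 :: "real^2 \<Rightarrow> real^2" where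
  "reflect2 x = vector [x $ 1, - (x $ 2)]"

definition x2_symmetric_on ::
    "(real^2) set \<Rightarrow> (real^2 \<Rightarrow> real^2) \<Rightarrow> (real^2 \<Rightarrow> real) \<Rightarrow> (real^2 \<Rightarrow> real) \<Rightarrow> bool" where
  "x2_symmetric_on D u p \<rho> \<longleftrightarrow> (\<forall>x\<in>D.
     u x $ 1 = u (reflect2 x) $ 1 \<and>
     u x $ 2 = - (u (reflect2 x) $ 2) \<and>
     p x = p (reflect2 x) \<and>
     \<rho> x = - \<rho> (reflect2 x))"

definition rotational_on :: "(real^2) set \<Rightarrow> (real^2 \<Rightarrow> real^2) \<Rightarrow> bool" where
  "rotational_on D u \<longleftrightarrow> (\<exists>x\<in>D. vorticity u x \<noteq> 0)"

definition bernoulli ::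
    "(real^2 \<Rightarrow> real^2) \<Rightarrow> (real^2 \<Rightarrow> real) \<Rightarrow> (real^2 \<Rightarrow> real) \<Rightarrow> real^2 \<Rightarrow> real" where
  "bernoulli u p \<rho> x = p x + (norm (u x))\<^sup>2 / 2 + x $ 2 * \<rho> x"

definition homogeneous_boussinesq ::
    "nat \<Rightarrow> (real^2) set \<Rightarrow> real \<Rightarrow>
     (real^2 \<Rightarrow> real^2) \<Rightarrow> (real^2 \<Rightarrow> real) \<Rightarrow> (real^2 \<Rightarrow> real) \<Rightarrow> bool" where
  "homogeneous_boussinesq k D \<alpha> u p \<rho> \<longleftrightarrow>
     Ck_on k D u \<and> Ck_on k D p \<and> Ck_on k D \<rho> \<and>
     boussinesq_on D u p \<rho> \<and>
     homogeneous_sol \<alpha> u p \<rho> \<and>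
     x2_symmetric_on D u p \<rho> \<and>
     rotational_on D u \<and>
     (\<exists>c. \<forall>x\<in>D. bernoulli u p \<rho> x = c)"

text \<open>The quotient \<open>\<omega> / x\<^sub>2\<close> is undefined on the axis \<open>x\<^sub>2 = 0\<close>; its value there
  is that of its (unique) continuous extension \<open>g\<close> to the punctured plane.\<close>

definition vorticity_quotient_vanishes :: "(real^2 \<Rightarrow> real^2) \<Rightarrow> bool" where
  "vorticity_quotient_vanishes u \<longleftrightarrow> (\<exists>g :: real^2 \<Rightarrow> real.
     continuous_on (- {0}) g \<and>
     (\<forall>x. x $ 2 \<noteq> 0 \<longrightarrow> g x = vorticity u x / x $ 2) \<and>
     (\<forall>x. x \<noteq> 0 \<longrightarrow> x $ 2 = 0 \<longrightarrow> g x = 0))"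

end

theory Submission
  imports Defs "HOL-Complex_Analysis.Great_Picard"
begin

text \<open>
  In polar coordinates write \<open>U\<close>, \<open>V\<close>, \<open>R\<close>, \<open>W\<close> for radial velocity, angular velocity, density and
  vorticity on the unit circle. If the Bernoulli function is constant, the equations become
  \<open>V' = (\<alpha> - 1) U\<close>, \<open>U' = (1 - \<alpha>) V - W\<close>, \<open>W V = (2 \<alpha> + 1) R sin\<close>, \<open>W U = R' sin\<close>, and the
  symmetry gives \<open>V 0 = 0\<close>.

  Nonexistence: on intervals where \<open>V \<noteq> 0\<close> the quantities \<open>R \<bar>V\<bar>\<^bsup>(2 \<alpha> + 1) / (1 - \<alpha>)\<^esup>\<close> and, for \<open>C\<^sup>2\<close>
  solutions, \<open>(W / sin) \<bar>V\<bar>\<^bsup>(\<alpha> + 2) / (1 - \<alpha>)\<^esup>\<close> are constant. Following them to the previous zero of \<open>V\<close>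
  shows that they vanish as soon as the exponent is positive, so \<open>W V = 0\<close> and then \<open>W = 0\<close>. For
  \<open>\<alpha> = - 2\<close> the function \<open>W / sin\<close> is constant, and its limit at \<open>0\<close> is \<open>0\<close> by hypothesis.

  Existence: for a stream function \<open>r\<^bsup>1 - \<alpha>\<^esup> f(\<theta>)\<close> one needs \<open>f'' + (1 - \<alpha>)\<^sup>2 f = - E sin\<close> where \<open>E\<close> is a
  locally constant multiple of \<open>\<bar>f\<bar>\<^sup>q\<close>, \<open>q = (\<alpha> + 2) / (\<alpha> - 1) > 0\<close>; the multiple may change at the
  zeros of \<open>f\<close>. A nonlinear eigenfunction on a short interval \<open>[0, l]\<close> is continued by a sine wave up to
  \<open>\<pi> - l\<close> and then by reflection in \<open>\<pi> / 2\<close>; the length \<open>l\<close> is chosen such that the phases match.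
\<close>

subsection \<open>The nonlinear Dirichlet eigenvalue problem\<close>

text \<open>One exponent decides both halves. For differentiable \<open>W\<close>, eliminating the
  density shows that between zeros of \<open>V\<close> the quotient \<open>W / sin\<close> is a
  constant multiple of |V|^q, where q = (\<alpha> + 2) / (\<alpha> - 1) = 1 + 3 / (\<alpha> - 1).
  For -2 < \<alpha> < 1 this exponent is negative, and a nonzero multiple would blow up at a zero of
  \<open>V\<close>; for \<alpha> > 1 and for \<alpha> < -2 it is positive and zeros do no harm. In
  the constructed flows f'' contains a term as rough as |f|^q; q > 1 for \<alpha> > 1 and 0 < q < 1
  for \<alpha> < -2, whence C^2 in one case and C^1 in the other. The obstacle to existence is the
  size of b = |1 - \<alpha>|: for b > 1 the form given by the integral of v'^2 - b^2 v^2 is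
  indefinite for Dirichlet data on the whole of [0, pi]. It is positive on intervals of length at
  most pi / (2 b). Since the multiple in front of |f|^q may jump at zeros of f, and may be 0, the
  nonlinear problem can be confined to such a short interval and the rest of the half circle filled
  with a free oscillation. For the same reason the unknown eigenvalue constant \<open>C\<close> does
  not have to be normalised.\<close>

definition sgnpow :: "real \<Rightarrow> real \<Rightarrow> real" where
  "sgnpow q s = sgn s * \<bar>s\<bar> powr q"

lemma sgnpow_mult_self: "q > 0 \<Longrightarrow> sgnpow q s * s = \<bar>s\<bar> powr (q + 1)"
  by (cases "s = 0") (auto simp: sgnpow_def powr_add sgn_real_def abs_if)

lemma abs_sgnpow: "\<bar>sgnpow q s\<bar> = \<bar>s\<bar> powr q"
  by (simp add: sgnpow_def abs_mult sgn_real_def)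

lemma sgnpow_scale: "c > 0 \<Longrightarrow> sgnpow q (c * s) = c powr q * sgnpow q s"
  by (simp add: sgnpow_def abs_mult sgn_mult powr_mult)

lemma isCont_sgnpow: "q > 0 \<Longrightarrow> isCont (sgnpow q) s"
proof (cases "s = 0")
  case True
  assume q: "q > 0"
  have "((\<lambda>s::real. \<bar>s\<bar> powr q) \<longlongrightarrow> \<bar>0\<bar> powr q) (at 0)"
    by (rule tendsto_powr') (use q in \<open>auto intro!: tendsto_eq_intros\<close>)
  then have "((\<lambda>s. sgnpow q s) \<longlongrightarrow> 0) (at 0)"
    by (intro tendsto_rabs_zero_cancel[of "sgnpow q"]) (simp add: abs_sgnpow)
  then show ?thesis
    using True by (simp add: isCont_def sgnpow_def[abs_def])
next
  case False
  assume q: "q > 0"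
  have "isCont (\<lambda>s. sgn s * \<bar>s\<bar> powr q) s"
    by (intro continuous_intros) (use False in auto)
  then show ?thesis
    unfolding sgnpow_def[abs_def] .
qed

lemma continuous_on_sgnpow [continuous_intros]:
  "continuous_on S f \<Longrightarrow> q > 0 \<Longrightarrow> continuous_on S (\<lambda>x. sgnpow q (f x))"
  by (rule continuous_on_compose2[of UNIV]) (auto intro: continuous_at_imp_continuous_on isCont_sgnpow)

text \<open>This is the tangent line inequality for the convex function |b|^(q + 1), obtained from
  Young's inequality with the conjugate exponents (q + 1) / q and q + 1, uniformly in q > 0.\<close>

lemma powr_convexity:
  assumes "q > 0"
  shows "\<bar>b\<bar> powr (q + 1) \<ge> \<bar>c\<bar> powr (q + 1) + (q + 1) * (sgnpow q c * b - sgnpow q c * c)"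
proof -
  have "sgnpow q c * b \<le> \<bar>c\<bar> powr q * \<bar>b\<bar>"
    using abs_ge_self[of "sgnpow q c * b"] by (simp add: abs_mult abs_sgnpow)
  also have "\<dots> \<le> (\<bar>c\<bar> powr q) powr ((q + 1) / q) / ((q + 1) / q) + \<bar>b\<bar> powr (q + 1) / (q + 1)"
    by (rule Youngs_inequality) (use assms in \<open>auto simp: field_simps\<close>)
  also have "(\<bar>c\<bar> powr q) powr ((q + 1) / q) = \<bar>c\<bar> powr (q + 1)"
    using assms by (simp add: powr_powr)
  also have "\<bar>c\<bar> powr (q + 1) / ((q + 1) / q) + \<bar>b\<bar> powr (q + 1) / (q + 1) =
      (q * \<bar>c\<bar> powr (q + 1) + \<bar>b\<bar> powr (q + 1)) / (q + 1)"
    using assms by (subst add_divide_distrib) (simp add: divide_simps)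
  finally have "(q + 1) * (sgnpow q c * b) \<le> q * \<bar>c\<bar> powr (q + 1) + \<bar>b\<bar> powr (q + 1)"
    using assms by (simp add: pos_le_divide_eq mult.commute)
  then show ?thesis
    using sgnpow_mult_self[OF assms, of c] by (simp add: algebra_simps)
qed

lemma uniform_limit_compose_continuous:
  fixes f :: "nat \<Rightarrow> 'a \<Rightarrow> real" and \<phi> :: "real \<Rightarrow> real"
  assumes lim: "uniform_limit S f g sequentially" and cont: "continuous_on UNIV \<phi>"
    and bd: "\<And>n x. x \<in> S \<Longrightarrow> \<bar>f n x\<bar> \<le> B"
  shows "uniform_limit S (\<lambda>n x. \<phi> (f n x)) (\<lambda>x. \<phi> (g x)) sequentially"
proof (rule uniform_limit_compose_uniformly_continuous_on[OF lim, of "{-B..B}"])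
  show "uniformly_continuous_on {-B..B} \<phi>"
    by (rule compact_uniformly_continuous) (auto intro: continuous_on_subset[OF cont])
  show "\<forall>\<^sub>F n in sequentially. \<forall>x\<in>S. f n x \<in> {-B..B}"
  proof (intro always_eventually allI ballI)
    show "f n x \<in> {-B..B}" if "x \<in> S" for n x
      using bd[OF that, of n] by auto
  qed
qed auto

text \<open>\<open>A\<close> and \<open>B\<close> are antiderivatives of the source against cosine
  and sine; \<open>k\<close> is the free initial slope when both vanish at 0. The formula serves
  twice: for the Dirichlet problem on [0, l] and for the profile on the whole line.\<close>

lemma variation_of_constants:
  fixes A B g :: "real \<Rightarrow> real" and a k :: real
  defines "v \<equiv> \<lambda>x. (k * sin (a * x) - (sin (a * x) * A x - cos (a * x) * B x)) / a"
    and "v' \<equiv> \<lambda>x. k * cos (a * x) - (cos (a * x) * A x + sin (a * x) * B x)"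
  assumes "a \<noteq> 0"
    and A: "(A has_real_derivative cos (a * x) * g x) (at x within S)"
    and B: "(B has_real_derivative sin (a * x) * g x) (at x within S)"
  shows "(v has_real_derivative v' x) (at x within S)"
    and "(v' has_real_derivative (- a\<^sup>2 * v x - g x)) (at x within S)"
proof -
  show "(v has_real_derivative v' x) (at x within S)"
    unfolding v_def v'_def using \<open>a \<noteq> 0\<close>
    by (auto intro!: derivative_eq_intros A B simp: field_simps)
  have "(v' has_real_derivative (- k * a * sin (a * x) - (- a * sin (a * x) * A x + a * cos (a * x) * B x
      + (g x * (cos (a * x) * cos (a * x)) + g x * (sin (a * x) * sin (a * x)))))) (at x within S)"
    unfolding v'_def by (auto intro!: derivative_eq_intros A B simp: algebra_simps)
  also have "g x * (cos (a * x) * cos (a * x)) + g x * (sin (a * x) * sin (a * x)) = g x"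
    by (simp only: distrib_left[symmetric] sin_cos_squared_add3 mult_1_right)
  also have "- k * a * sin (a * x) - (- a * sin (a * x) * A x + a * cos (a * x) * B x + g x) = - a\<^sup>2 * v x - g x"
    using \<open>a \<noteq> 0\<close> by (simp add: v_def power2_eq_square field_simps)
  finally show "(v' has_real_derivative (- a\<^sup>2 * v x - g x)) (at x within S)" .
qed

section \<open>The linear Dirichlet problem -v'' - a^2 v = g and its energy\<close>

locale dirichlet =
  fixes l a :: real
  assumes l: "l > 0" and a: "a > 0" and al: "a * l \<le> pi / 2"
begin

definition J :: "(real \<Rightarrow> real) \<Rightarrow> real" where "J f = integral {0..l} f"

text \<open>Both derivatives are one-sided at the ends. Integration by parts turns the integral of
  \<open>g * v\<close> into the energy, the integral of v'^2 - a^2 v^2; all norms below are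
  expressed through this product of source and solution.\<close>

definition sol :: "(real \<Rightarrow> real) \<Rightarrow> (real \<Rightarrow> real) \<Rightarrow> bool" where
  "sol v g \<longleftrightarrow> continuous_on {0..l} g \<and> v 0 = 0 \<and> v l = 0 \<and>
    (\<exists>v'. \<forall>x\<in>{0..l}. (v has_real_derivative v' x) (at x within {0..l}) \<and>
       (v' has_real_derivative (- a\<^sup>2 * v x - g x)) (at x within {0..l}))"

lemma sol_cont: "sol v g \<Longrightarrow> continuous_on {0..l} v" "sol v g \<Longrightarrow> continuous_on {0..l} g"
  unfolding sol_def using DERIV_continuous_on by blast+

lemma J_int: "continuous_on {0..l} f \<Longrightarrow> (f :: real \<Rightarrow> real) integrable_on {0..l}"
  by (rule integrable_continuous_real)

lemma J_add: "continuous_on {0..l} f \<Longrightarrow> continuous_on {0..l} g \<Longrightarrow> J (\<lambda>x. f x + g x) = J f + J g"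
  and J_diff: "continuous_on {0..l} f \<Longrightarrow> continuous_on {0..l} g \<Longrightarrow> J (\<lambda>x. f x - g x) = J f - J g"
  and J_cmult: "J (\<lambda>x. c * f x) = c * J f"
  by (auto simp: J_def J_int integral_add integral_diff)

lemma J_mono: "continuous_on {0..l} f \<Longrightarrow> continuous_on {0..l} g \<Longrightarrow> (\<And>x. x \<in> {0..l} \<Longrightarrow> f x \<le> g x) \<Longrightarrow> J f \<le> J g"
  unfolding J_def by (rule integral_le) (auto simp: J_int)

lemma J_cong: "(\<And>x. x \<in> {0..l} \<Longrightarrow> f x = g x) \<Longrightarrow> J f = J g"
  unfolding J_def by (rule integral_cong)

lemma J_FTC:
  assumes "\<And>x. x \<in> {0..l} \<Longrightarrow> (F has_real_derivative f x) (at x within {0..l})"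
  shows "J f = F l - F 0"
  unfolding J_def using l
  by (intro integral_unique fundamental_theorem_of_calculus)
     (auto simp: assms has_real_derivative_iff_has_vector_derivative[symmetric])

lemma J_tendsto:
  assumes "uniform_limit {0..l} f g sequentially" "\<And>n. continuous_on {0..l} (f n)"
  shows "(\<lambda>n. J (f n)) \<longlonglongrightarrow> J g"
proof -
  obtain I K where *: "\<And>n. (f n has_integral I n) {0..l}" "(g has_integral K) {0..l}" "(I \<longlongrightarrow> K) sequentially"
    using uniform_limit_integral[OF assms] by auto
  then have "I = (\<lambda>n. J (f n))" "K = J g"
    unfolding J_def by (metis integral_unique)+
  with * show ?thesis by simp
qed

lemma sol_lin:
  assumes "sol v g" "sol w h"
  shows "sol (\<lambda>x. v x + c * w x) (\<lambda>x. g x + c * h x)"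
proof -
  obtain v' where v': "\<And>x. x\<in>{0..l} \<Longrightarrow> (v has_real_derivative v' x) (at x within {0..l})"
       "\<And>x. x\<in>{0..l} \<Longrightarrow> (v' has_real_derivative (- a\<^sup>2 * v x - g x)) (at x within {0..l})"
    using assms(1) unfolding sol_def by blast
  obtain w' where w': "\<And>x. x\<in>{0..l} \<Longrightarrow> (w has_real_derivative w' x) (at x within {0..l})"
       "\<And>x. x\<in>{0..l} \<Longrightarrow> (w' has_real_derivative (- a\<^sup>2 * w x - h x)) (at x within {0..l})"
    using assms(2) unfolding sol_def by blast
  have "\<forall>x\<in>{0..l}. ((\<lambda>x. v x + c * w x) has_real_derivative (v' x + c * w' x)) (at x within {0..l}) \<and>
     ((\<lambda>x. v' x + c * w' x) has_real_derivative - a\<^sup>2 * (v x + c * w x) - (g x + c * h x)) (at x within {0..l})"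
    by (auto intro!: derivative_eq_intros v' w' simp: algebra_simps)
  moreover have "continuous_on {0..l} (\<lambda>x. g x + c * h x)"
    by (intro continuous_intros sol_cont(2)[OF assms(1)] sol_cont(2)[OF assms(2)])
  ultimately show ?thesis
    using assms unfolding sol_def by (auto intro!: exI[of _ "\<lambda>x. v' x + c * w' x"])
qed

lemma sol_scale: "sol v g \<Longrightarrow> sol (\<lambda>x. c * v x) (\<lambda>x. c * g x)"
  using sol_lin[of v g v g "c - 1"] by (simp add: algebra_simps)

lemma sol_exists:
  assumes g: "continuous_on {0..l} g"
  shows "\<exists>v. sol v g"
proof -
  define A where "A x = integral {0..x} (\<lambda>y. cos (a * y) * g y)" for x
  define B where "B x = integral {0..x} (\<lambda>y. sin (a * y) * g y)" for x
  have dA: "(A has_real_derivative cos (a * x) * g x) (at x within {0..l})" if "x \<in> {0..l}" for x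
    unfolding A_def using that by (intro integral_has_real_derivative continuous_intros g) auto
  have dB: "(B has_real_derivative sin (a * x) * g x) (at x within {0..l})" if "x \<in> {0..l}" for x
    unfolding B_def using that by (intro integral_has_real_derivative continuous_intros g) auto
  have s: "sin (a * l) > 0"
    using l a al by (intro sin_gt_zero) (auto intro: order.strict_trans1[OF al])
  \<comment> \<open>The initial slope that enforces \<open>v l = 0\<close>; it exists because
    \<open>sin (a * l)\<close> is positive.\<close>
  define k where "k = (sin (a * l) * A l - cos (a * l) * B l) / sin (a * l)"
  define v where "v x = (k * sin (a * x) - (sin (a * x) * A x - cos (a * x) * B x)) / a" for x
  define v' where "v' x = k * cos (a * x) - (cos (a * x) * A x + sin (a * x) * B x)" for x
  have "(v has_real_derivative v' x) (at x within {0..l})"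
    "(v' has_real_derivative (- a\<^sup>2 * v x - g x)) (at x within {0..l})" if "x \<in> {0..l}" for x
    using variation_of_constants[where k = k and g = g and a = a, OF _ dA[OF that] dB[OF that]] a
    by (simp_all add: v_def[abs_def] v'_def[abs_def])
  moreover have "v 0 = 0" "v l = 0"
    using s by (auto simp: v_def k_def A_def B_def)
  ultimately have "sol v g" unfolding sol_def using g by blast
  then show ?thesis by blast
qed

text \<open>Green's identity: the Wronskian \<open>v * w' - v' * w\<close> has derivative
  \<open>g * w - h * v\<close> and vanishes at both ends.\<close>

lemma sol_symmetric:
  assumes "sol v g" "sol w h"
  shows "J (\<lambda>x. g x * w x) = J (\<lambda>x. h x * v x)"
proof -
  obtain v' where v': "\<And>x. x\<in>{0..l} \<Longrightarrow> (v has_real_derivative v' x) (at x within {0..l})"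
       "\<And>x. x\<in>{0..l} \<Longrightarrow> (v' has_real_derivative (- a\<^sup>2 * v x - g x)) (at x within {0..l})"
    using assms(1) unfolding sol_def by blast
  obtain w' where w': "\<And>x. x\<in>{0..l} \<Longrightarrow> (w has_real_derivative w' x) (at x within {0..l})"
       "\<And>x. x\<in>{0..l} \<Longrightarrow> (w' has_real_derivative (- a\<^sup>2 * w x - h x)) (at x within {0..l})"
    using assms(2) unfolding sol_def by blast
  note c = sol_cont[OF assms(1)] sol_cont[OF assms(2)]
  have "J (\<lambda>x. g x * w x - h x * v x) = (v l * w' l - v' l * w l) - (v 0 * w' 0 - v' 0 * w 0)"
    by (rule J_FTC) (auto intro!: derivative_eq_intros v' w' simp: algebra_simps)
  also have "\<dots> = 0" using assms by (simp add: sol_def)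
  finally show ?thesis
    by (subst (asm) J_diff) (auto intro!: continuous_intros c)
qed

text \<open>Since \<open>a l \<le> \<pi> / 2\<close>, the form \<open>\<integral> v'\<^sup>2 - a\<^sup>2 v\<^sup>2\<close> is coercive: completing the square with
  \<open>k tan (k (x - l / 2))\<close>, \<open>k = 3 a / 2\<close>, gives \<open>\<integral> v'\<^sup>2 \<ge> k\<^sup>2 \<integral> v\<^sup>2\<close>.\<close>

lemma sol_energy:
  assumes "sol v g" and xy: "x \<in> {0..l}" "y \<in> {0..l}"
  shows "(v x - v y)\<^sup>2 \<le> 2 * \<bar>x - y\<bar> * J (\<lambda>x. g x * v x)"
proof -
  obtain v' where v': "\<And>x. x\<in>{0..l} \<Longrightarrow> (v has_real_derivative v' x) (at x within {0..l})"
       "\<And>x. x\<in>{0..l} \<Longrightarrow> (v' has_real_derivative (- a\<^sup>2 * v x - g x)) (at x within {0..l})"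
    using assms(1) unfolding sol_def by blast
  have v0: "v 0 = 0" "v l = 0" using assms by (auto simp: sol_def)
  note c [continuous_intros] = sol_cont[OF assms(1)]
  have c' [continuous_intros]: "continuous_on {0..l} v'"
    by (rule DERIV_continuous_on) (rule v'(2))
  \<comment> \<open>A factor above 1 yields coercivity, and a factor below 2 keeps the tangent
    finite on [0, l], since |T| is at most k l / 2 and a l is at most pi / 2.\<close>
  define k where "k = 3 / 2 * a"
  define T where "T x = k * (x - l / 2)" for x
  have cT: "cos (T x) > 0" if "x \<in> {0..l}" for x
  proof -
    have "\<bar>x - l / 2\<bar> \<le> l / 2" using that unfolding atLeastAtMost_iff by linarith
    then have "\<bar>T x\<bar> \<le> k * (l / 2)"
      using a by (simp add: T_def k_def abs_mult)
    also have "\<dots> = 3 / 4 * (a * l)" by (simp add: k_def)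
    also have "\<dots> < pi / 2" using al pi_gt_zero by linarith
    finally show ?thesis by (intro cos_gt_zero_pi) auto
  qed
  have cT' [continuous_intros]: "continuous_on {0..l} (\<lambda>x. tan (T x))"
  proof (rule Transcendental.continuous_on_tan)
    show "continuous_on {0..l} T" unfolding T_def[abs_def] by (intro continuous_intros)
    show "\<forall>x\<in>{0..l}. cos (T x) \<noteq> 0" using cT by (metis less_irrefl)
  qed
  have 1: "J (\<lambda>x. (v' x)\<^sup>2 - a\<^sup>2 * (v x)\<^sup>2 - g x * v x) = v' l * v l - v' 0 * v 0"
    by (rule J_FTC) (auto intro!: derivative_eq_intros v' simp: algebra_simps power2_eq_square)
  have 2: "J (\<lambda>x. (v' x + k * tan (T x) * v x)\<^sup>2 - ((v' x)\<^sup>2 - k\<^sup>2 * (v x)\<^sup>2)) = k * tan (T l) * (v l)\<^sup>2 - k * tan (T 0) * (v 0)\<^sup>2"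
  proof (rule J_FTC)
    fix x assume x: "x \<in> {0..l}"
    have t: "((\<lambda>x. tan (T x)) has_real_derivative k * (1 + (tan (T x))\<^sup>2)) (at x within {0..l})"
      unfolding T_def
      by (auto intro!: derivative_eq_intros simp: inverse_eq_divide)
         (use cT[OF x] in \<open>auto simp: T_def tan_def field_simps sin_squared_eq\<close>)
    define \<tau> where "\<tau> x = tan (T x)" for x
    note t = t[folded \<tau>_def]
    show "((\<lambda>x. k * tan (T x) * (v x)\<^sup>2) has_real_derivative (v' x + k * tan (T x) * v x)\<^sup>2 - ((v' x)\<^sup>2 - k\<^sup>2 * (v x)\<^sup>2)) (at x within {0..l})"
      unfolding \<tau>_def[symmetric]
      by (auto intro!: derivative_eq_intros t v'(1)[OF x] simp: algebra_simps power2_eq_square)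
  qed
  have "J (\<lambda>x. 0) \<le> J (\<lambda>x. (v' x + k * tan (T x) * v x)\<^sup>2)"
    by (intro J_mono continuous_intros) auto
  moreover have "J (\<lambda>x. (v' x + k * tan (T x) * v x)\<^sup>2) = J (\<lambda>x. (v' x)\<^sup>2 - k\<^sup>2 * (v x)\<^sup>2)"
    using 2 v0 by (subst (asm) J_diff) (auto intro!: continuous_intros)
  ultimately have 3: "k\<^sup>2 * J (\<lambda>x. (v x)\<^sup>2) \<le> J (\<lambda>x. (v' x)\<^sup>2)"
    by (simp add: J_diff J_cmult continuous_intros) (simp add: J_def)
  have 4: "J (\<lambda>x. (v' x)\<^sup>2) - a\<^sup>2 * J (\<lambda>x. (v x)\<^sup>2) = J (\<lambda>x. g x * v x)"
    using 1 v0 by (subst (asm) J_diff, (auto intro!: continuous_intros)[2], subst (asm) J_diff)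
       (auto intro!: continuous_intros simp: J_cmult)
  \<comment> \<open>As k^2 = 9/4 a^2, fact 3 bounds a^2 times the integral of v^2 by 4/9 of the
    integral of v'^2, so at least 5/9 of the latter survives in the energy. The factor 9/5 is later
    rounded up to 2.\<close>
  have 5: "J (\<lambda>x. (v' x)\<^sup>2) \<le> 9 / 5 * J (\<lambda>x. g x * v x)"
    using 3 4 by (simp add: k_def power_mult_distrib power2_eq_square algebra_simps)
  have D0: "J (\<lambda>x. (v' x)\<^sup>2) \<ge> 0"
    using J_mono[of "\<lambda>_. 0" "\<lambda>x. (v' x)\<^sup>2"] by (auto intro!: continuous_intros simp: J_def)
  \<comment> \<open>Cauchy-Schwarz for the integral of v' over [r, s], obtained by integrating the
    square of v' minus its mean \<open>m\<close>.\<close>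
  have 6: "(v s - v r)\<^sup>2 \<le> (s - r) * J (\<lambda>x. (v' x)\<^sup>2)" if rs: "r < s" "r \<in> {0..l}" "s \<in> {0..l}" for r s
  proof -
    have sub: "{r..s} \<subseteq> {0..l}" using rs by auto
    define m where "m = (v s - v r) / (s - r)"
    have i1: "(v' has_integral (v s - v r)) {r..s}"
      using rs sub
      by (intro fundamental_theorem_of_calculus)
         (auto simp: has_real_derivative_iff_has_vector_derivative[symmetric] intro: DERIV_subset[OF v'(1) sub])
    have i2: "(\<lambda>x. (v' x)\<^sup>2) integrable_on {r..s}"
      by (intro integrable_continuous_real continuous_intros continuous_on_subset[OF c' sub])
    have "((\<lambda>x. (v' x)\<^sup>2 - 2 * m * v' x + m\<^sup>2) has_integral
        (integral {r..s} (\<lambda>x. (v' x)\<^sup>2) - 2 * m * (v s - v r) + m\<^sup>2 * (s - r))) {r..s}"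
      using has_integral_add[OF has_integral_diff[OF integrable_integral[OF i2] has_integral_mult_right[OF i1, of "2 * m"]] has_integral_const_real[of "m\<^sup>2" r s]] rs
      by (simp add: mult_ac)
    moreover have "0 \<le> (v' x)\<^sup>2 - 2 * m * v' x + m\<^sup>2" for x
      using zero_le_power2[of "v' x - m"] by (simp add: power2_eq_square algebra_simps)
    ultimately have "0 \<le> integral {r..s} (\<lambda>x. (v' x)\<^sup>2) - 2 * m * (v s - v r) + m\<^sup>2 * (s - r)"
      by (rule has_integral_nonneg)
    moreover have "m * (s - r) = v s - v r" using rs by (simp add: m_def)
    then have "m\<^sup>2 * (s - r) = m * (v s - v r)" by (simp add: power2_eq_square mult.assoc)
    ultimately have "m * (v s - v r) \<le> integral {r..s} (\<lambda>x. (v' x)\<^sup>2)" by simp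
    also have "\<dots> \<le> J (\<lambda>x. (v' x)\<^sup>2)"
      unfolding J_def by (rule integral_subset_le) (use sub i2 in \<open>auto intro!: J_int continuous_intros\<close>)
    finally have "(s - r) * (m * (v s - v r)) \<le> (s - r) * J (\<lambda>x. (v' x)\<^sup>2)"
      using rs by (intro mult_left_mono) auto
    then have "(m * (s - r)) * (v s - v r) \<le> (s - r) * J (\<lambda>x. (v' x)\<^sup>2)" by (simp add: mult_ac)
    then show ?thesis unfolding \<open>m * (s - r) = v s - v r\<close> by (simp add: power2_eq_square)
  qed
  have "(v x - v y)\<^sup>2 \<le> \<bar>x - y\<bar> * J (\<lambda>x. (v' x)\<^sup>2)"
    using 6[of x y] 6[of y x] xy by (cases x y rule: linorder_cases) (auto simp: power2_commute)
  also have "\<dots> \<le> \<bar>x - y\<bar> * (2 * J (\<lambda>x. g x * v x))"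
    using 5 D0 by (intro mult_left_mono) auto
  finally show ?thesis by (simp add: mult_ac)
qed

lemma sol_sup:
  assumes "sol v g" "x \<in> {0..l}"
  shows "(v x)\<^sup>2 \<le> 2 * l * J (\<lambda>x. g x * v x)"
proof -
  have nn: "0 \<le> J (\<lambda>x. g x * v x)"
    using sol_energy[OF assms(1), of 0 l] l assms(1) by (simp add: sol_def zero_le_mult_iff)
  have "(v x)\<^sup>2 \<le> 2 * \<bar>x\<bar> * J (\<lambda>x. g x * v x)"
    using sol_energy[OF assms, of 0] l assms(1) by (simp add: sol_def)
  also have "\<dots> \<le> 2 * l * J (\<lambda>x. g x * v x)"
    using assms nn by (intro mult_right_mono) auto
  finally show ?thesis .
qed

lemma sol_cong:
  assumes "sol v g" "\<And>x. x \<in> {0..l} \<Longrightarrow> g x = h x"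
  shows "sol v h"
proof -
  have "continuous_on {0..l} h"
    using assms continuous_on_cong[of "{0..l}" "{0..l}" g h] by (simp add: sol_def)
  with assms show ?thesis unfolding sol_def by auto
qed

lemma sol_nonneg: "sol v g \<Longrightarrow> 0 \<le> J (\<lambda>x. g x * v x)"
  using sol_energy[of v g 0 l] l by (simp add: sol_def zero_le_mult_iff)

text \<open>Normalised power iteration for the map taking \<open>f\<close> to the solution of the linear problem with
  right-hand side \<open>w \<bar>f\<bar>\<^sup>q sgn f\<close>. By convexity of \<open>\<integral> w \<bar>f\<bar>\<^bsup>q + 1\<^esup>\<close> this functional increases by at
  least \<open>q + 1\<close> times the defect in the Cauchy--Schwarz inequality, so the defect tends to \<open>0\<close> and the
  limit of a convergent subsequence is an eigenfunction.\<close>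

lemma nonlinear_eigenfunction:
  assumes q: "q > 0" and w: "continuous_on {0..l} w" "\<And>x. x \<in> {0..l} \<Longrightarrow> w x \<ge> 0"
    and wpos: "\<And>x. x \<in> {0<..<l} \<Longrightarrow> w x > 0"
  shows "\<exists>C v. C > 0 \<and> sol v (\<lambda>x. C * (w x * sgnpow q (v x))) \<and> (\<exists>x\<in>{0<..<l}. v x \<noteq> 0)"
proof -
  define G where "G f x = w x * sgnpow q (f x)" for f x
  define m where "m f = J (\<lambda>x. w x * \<bar>f x\<bar> powr (q + 1))" for f
  define P where "P f \<longleftrightarrow> (\<exists>\<gamma>. sol f \<gamma> \<and> J (\<lambda>x. \<gamma> x * f x) = 1) \<and> m f > 0" for f
  \<comment> \<open>One step of the iteration: \<open>s\<close> is the energy norm of the solution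
    with source \<open>G f\<close>, and \<open>f'\<close> is this solution divided by
    \<open>s\<close>. The difference \<open>s - m f\<close> is the Cauchy-Schwarz defect; the last
    two clauses say that it bounds the gain in \<open>m\<close> from below and the distance between
    consecutive iterates from above.\<close>
  define R where "R f f' \<longleftrightarrow> (\<exists>s. s \<ge> m f \<and> sol (\<lambda>x. s * f' x) (G f) \<and>
      m f' \<ge> m f + (q + 1) * (s - m f) \<and>
      (\<forall>x\<in>{0..l}. (s * f' x - s * f x)\<^sup>2 \<le> 4 * l * s * (s - m f)))" for f f'
  have Gc: "continuous_on {0..l} (G f)" if "continuous_on {0..l} f" for f
    unfolding G_def[abs_def] by (intro continuous_intros w that q)
  have mc: "continuous_on {0..l} (\<lambda>x. w x * \<bar>f x\<bar> powr (q + 1))" if "continuous_on {0..l} f" for f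
    by (intro continuous_intros w that continuous_on_powr') (use q in auto)
  have Gm: "G f x * f x = w x * \<bar>f x\<bar> powr (q + 1)" for f x
    using q by (simp add: G_def sgnpow_mult_self mult.assoc)
  have init: "\<exists>f. P f"
  proof -
    define k where "k = pi / l"
    have "sol (\<lambda>x. sin (k * x)) (\<lambda>x. (k\<^sup>2 - a\<^sup>2) * sin (k * x))"
      unfolding sol_def using l
      by (auto intro!: exI[of _ "\<lambda>x. k * cos (k * x)"] derivative_eq_intros continuous_intros
               simp: k_def power2_eq_square algebra_simps)
    note s = this
    define j where "j = J (\<lambda>x. (k\<^sup>2 - a\<^sup>2) * sin (k * x) * sin (k * x))"
    \<comment> \<open>The sine equals 1 at the midpoint, so the sup bound already makes its energy
      positive.\<close>
    have "1 \<le> 2 * l * j"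
      using sol_sup[OF s, of "l / 2"] l by (simp add: j_def k_def)
    then have j: "j > 0" using l by (smt (verit) mult_nonneg_nonpos)
    define f where "f x = (1 / sqrt j) * sin (k * x)" for x
    have sf: "sol f (\<lambda>x. (1 / sqrt j) * ((k\<^sup>2 - a\<^sup>2) * sin (k * x)))"
      unfolding f_def[abs_def] by (rule sol_scale[OF s])
    have "J (\<lambda>x. (1 / sqrt j) * ((k\<^sup>2 - a\<^sup>2) * sin (k * x)) * f x) = J (\<lambda>x. (1 / j) * ((k\<^sup>2 - a\<^sup>2) * sin (k * x) * sin (k * x)))"
      by (rule J_cong) (use j in \<open>simp add: f_def field_simps\<close>)
    also have "\<dots> = 1" using j by (simp only: J_cmult j_def[symmetric]) simp
    finally have 1: "J (\<lambda>x. (1 / sqrt j) * ((k\<^sup>2 - a\<^sup>2) * sin (k * x)) * f x) = 1" .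
    have "m f \<noteq> 0"
    proof
      assume "m f = 0"
      then have "\<forall>x\<in>{0..l}. w x * \<bar>f x\<bar> powr (q + 1) = 0"
        unfolding m_def J_def using l w(2) sol_cont(1)[OF sf]
        by (subst (asm) integral_eq_0_iff) (auto intro!: mc)
      moreover have "l / 2 \<in> {0..l}" "w (l / 2) > 0" using l wpos[of "l / 2"] by auto
      moreover have "f (l / 2) \<noteq> 0" using j l by (simp add: f_def k_def)
      ultimately show False by force
    qed
    moreover have "m f \<ge> 0"
      using J_mono[of "\<lambda>_. 0", OF _ mc[OF sol_cont(1)[OF sf]]] w by (simp add: m_def J_def)
    ultimately show ?thesis unfolding P_def using sf 1 by force
  qed
  have step: "\<exists>f'. P f' \<and> R f f'" if "P f" for f
  proof -
    from that obtain \<gamma> where \<gamma>: "sol f \<gamma>" "J (\<lambda>x. \<gamma> x * f x) = 1" and m: "m f > 0"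
      unfolding P_def by blast
    note [continuous_intros] = sol_cont[OF \<gamma>(1)] Gc[OF sol_cont(1)[OF \<gamma>(1)]]
    obtain h where h: "sol h (G f)" using sol_exists[of "G f"] by (auto intro!: continuous_intros)
    note [continuous_intros] = sol_cont(1)[OF h]
    define s where "s = sqrt (J (\<lambda>x. G f x * h x))"
    have s2: "s\<^sup>2 = J (\<lambda>x. G f x * h x)" and s0: "s \<ge> 0" using sol_nonneg[OF h] by (auto simp: s_def)
    have mG: "J (\<lambda>x. G f x * f x) = m f" by (simp add: m_def Gm)
    \<comment> \<open>The energy of \<open>h - t * f\<close>, expanded as a quadratic polynomial in
      \<open>t\<close>. The value t = \<open>m f\<close> yields the Cauchy-Schwarz inequality, and t
      = \<open>s\<close> controls the distance of the two iterates.\<close>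
    have en: "J (\<lambda>x. (G f x + (- t) * \<gamma> x) * (h x + (- t) * f x)) = s\<^sup>2 - 2 * t * m f + t\<^sup>2" for t
    proof -
      have "J (\<lambda>x. (G f x + (- t) * \<gamma> x) * (h x + (- t) * f x)) =
            J (\<lambda>x. (G f x * h x - t * (G f x * f x)) - (t * (\<gamma> x * h x) - t\<^sup>2 * (\<gamma> x * f x)))"
        by (rule J_cong) (simp add: algebra_simps power2_eq_square)
      also have "\<dots> = (s\<^sup>2 - t * m f) - (t * J (\<lambda>x. \<gamma> x * h x) - t\<^sup>2)"
        by (simp add: J_diff J_cmult \<gamma> mG s2 continuous_intros)
      also have "J (\<lambda>x. \<gamma> x * h x) = m f"
        using sol_symmetric[OF \<gamma>(1) h] by (simp add: mG)
      finally show ?thesis by simp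
    qed
    have sl: "sol (\<lambda>x. h x + (- t) * f x) (\<lambda>x. G f x + (- t) * \<gamma> x)" for t
      by (rule sol_lin[OF h \<gamma>(1)])
    have "(m f)\<^sup>2 \<le> s\<^sup>2"
      using sol_nonneg[OF sl[of "m f"]] unfolding en by (simp add: power2_eq_square)
    then have sm: "s \<ge> m f" using s0 by (rule power2_le_imp_le)
    then have s: "s > 0" using m by simp
    define f' where "f' x = (1 / s) * h x" for x
    have f': "sol f' (\<lambda>x. (1 / s) * G f x)"
      unfolding f'_def[abs_def] by (rule sol_scale[OF h])
    note [continuous_intros] = sol_cont(1)[OF f']
    have hs: "h = (\<lambda>x. s * f' x)" using s by (simp add: f'_def fun_eq_iff)
    have "J (\<lambda>x. (1 / s) * G f x * f' x) = J (\<lambda>x. (1 / s\<^sup>2) * (G f x * h x))"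
      by (rule J_cong) (use s in \<open>simp add: f'_def power2_eq_square field_simps\<close>)
    also have "\<dots> = 1" using s by (simp only: J_cmult s2[symmetric]) simp
    finally have n1: "J (\<lambda>x. (1 / s) * G f x * f' x) = 1" .
    have Gf': "J (\<lambda>x. G f x * f' x) = s"
      using n1 s J_cmult[of "1 / s" "\<lambda>x. G f x * f' x"] by (simp add: mult.assoc)
    \<comment> \<open>The tangent inequality at \<open>f x\<close>, evaluated at
      \<open>f' x\<close>, weighted by \<open>w\<close> and integrated; the linear term integrates
      to \<open>s - m f\<close>.\<close>
    have "m f + (q + 1) * (s - m f) = J (\<lambda>x. w x * \<bar>f x\<bar> powr (q + 1) + (q + 1) * (G f x * f' x - G f x * f x))"
      by (simp add: J_add J_diff J_cmult mG Gf' m_def continuous_intros mc)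
    also have "\<dots> \<le> m f'" unfolding m_def
    proof (rule J_mono)
      fix x assume "x \<in> {0..l}"
      then have "w x * (\<bar>f x\<bar> powr (q + 1) + (q + 1) * (sgnpow q (f x) * f' x - sgnpow q (f x) * f x)) \<le> w x * \<bar>f' x\<bar> powr (q + 1)"
        by (intro mult_left_mono powr_convexity q w)
      then show "w x * \<bar>f x\<bar> powr (q + 1) + (q + 1) * (G f x * f' x - G f x * f x) \<le> w x * \<bar>f' x\<bar> powr (q + 1)"
        by (simp add: G_def algebra_simps)
    qed (intro continuous_intros mc)+
    finally have inc: "m f + (q + 1) * (s - m f) \<le> m f'" .
    have "(s * f' x - s * f x)\<^sup>2 \<le> 4 * l * s * (s - m f)" if "x \<in> {0..l}" for x
    proof -
      have "(h x + (- s) * f x)\<^sup>2 \<le> 2 * l * (s\<^sup>2 - 2 * s * m f + s\<^sup>2)"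
        using sol_sup[OF sl[of s] that] unfolding en .
      also have "h x = s * f' x" by (simp add: hs)
      finally show ?thesis by (simp add: algebra_simps power2_eq_square)
    qed
    moreover have "m f' > 0"
      using inc m sm q by (smt (verit) mult_nonneg_nonneg)
    ultimately show ?thesis
      unfolding P_def R_def using f' n1 sm inc h unfolding hs by blast
  qed
  obtain f where f: "\<And>n. P (f n)" "\<And>n. R (f n) (f (Suc n))"
    using dependent_nat_choice[of "\<lambda>_. P" "\<lambda>_. R"] init step by blast
  define \<mu> where "\<mu> n = m (f n)" for n
  obtain s where s: "\<And>n. s n \<ge> \<mu> n" "\<And>n. sol (\<lambda>x. s n * f (Suc n) x) (G (f n))"
    "\<And>n. \<mu> (Suc n) \<ge> \<mu> n + (q + 1) * (s n - \<mu> n)"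
    "\<And>n x. x\<in>{0..l} \<Longrightarrow> (s n * f (Suc n) x - s n * f n x)\<^sup>2 \<le> 4 * l * s n * (s n - \<mu> n)"
    using f(2) unfolding R_def \<mu>_def by metis
  have fe: "(f n x - f n y)\<^sup>2 \<le> 2 * \<bar>x - y\<bar>" and fB: "(f n x)\<^sup>2 \<le> 2 * l"
    and fc: "continuous_on {0..l} (f n)" if "x \<in> {0..l}" "y \<in> {0..l}" for n x y
    using f(1)[of n] sol_energy[of "f n" _ x y] sol_sup[of "f n" _ x] sol_cont that unfolding P_def by force+
  define B where "B = sqrt (2 * l)"
  have B: "\<bar>f n x\<bar> \<le> B" if "x \<in> {0..l}" for n x
    using fB[OF that that, of n] unfolding B_def by (simp add: real_le_rsqrt)
  have fc: "continuous_on {0..l} (f n)" for n using fc[of 0 0 n] l by auto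
  have \<mu>pos: "\<mu> n > 0" for n using f(1)[of n] by (simp add: P_def \<mu>_def)
  have \<mu>step: "\<mu> n \<le> \<mu> (Suc n)" for n
    using s(1,3)[of n] q by (smt (verit) mult_nonneg_nonneg)
  have \<mu>bd: "\<mu> n \<le> J (\<lambda>x. w x * B powr (q + 1))" for n
    unfolding \<mu>_def m_def using B w q
    by (intro J_mono mc fc continuous_intros) (auto intro!: mult_left_mono powr_mono2)
  obtain M where M: "\<mu> \<longlonglongrightarrow> M" "\<And>n. \<mu> n \<le> M"
    using incseq_convergent[of \<mu>] \<mu>step \<mu>bd by (metis incseq_SucI)
  have Mpos: "M > 0" using \<mu>pos[of 0] M(2)[of 0] by simp
  have gap: "(\<lambda>n. s n - \<mu> n) \<longlonglongrightarrow> 0"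
  proof (rule tendsto_sandwich[of "\<lambda>_. 0" _ _ "\<lambda>n. (\<mu> (Suc n) - \<mu> n) / (q + 1)"])
    show "\<forall>\<^sub>F n in sequentially. s n - \<mu> n \<le> (\<mu> (Suc n) - \<mu> n) / (q + 1)"
      using s(3) q by (intro always_eventually allI) (simp add: field_simps)
    have "(\<lambda>n. (\<mu> (Suc n) - \<mu> n) / (q + 1)) \<longlonglongrightarrow> (M - M) / (q + 1)"
      by (intro tendsto_intros M(1) LIMSEQ_Suc) (use q in auto)
    then show "(\<lambda>n. (\<mu> (Suc n) - \<mu> n) / (q + 1)) \<longlonglongrightarrow> 0" by simp
  qed (use s(1) in auto)
  have sM: "s \<longlonglongrightarrow> M" using tendsto_add[OF gap M(1)] by simp
  \<comment> \<open>All iterates have energy 1, so \<open>fe\<close> makes them uniformly Hoelder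
    continuous with exponent 1/2, which is the equicontinuity for Arzela-Ascoli.\<close>
  obtain F k where Fk: "continuous_on {0..l} F" "strict_mono (k :: nat \<Rightarrow> nat)"
    and unif: "\<And>e. 0 < e \<Longrightarrow> \<exists>N. \<forall>n x. n \<ge> N \<and> x \<in> {0..l} \<longrightarrow> norm (f (k n) x - F x) < e"
  proof (rule Arzela_Ascoli[of "{0..l}" f B])
    fix x e :: real assume xe: "x \<in> {0..l}" "0 < e"
    show "\<exists>d>0. \<forall>n y. y \<in> {0..l} \<and> norm (x - y) < d \<longrightarrow> norm (f n x - f n y) < e"
    proof (intro exI[of _ "e\<^sup>2 / 2"] conjI allI impI)
      fix n y assume y: "y \<in> {0..l} \<and> norm (x - y) < e\<^sup>2 / 2"
      then have "\<bar>f n x - f n y\<bar>\<^sup>2 < e\<^sup>2" using fe[of x y n] xe by auto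
      then show "norm (f n x - f n y) < e" using xe by (simp add: power2_less_imp_less)
    qed (use xe in auto)
  qed (use B in auto)
  have ul: "uniform_limit {0..l} (\<lambda>n. f (k n)) F sequentially"
    unfolding uniform_limit_sequentially_iff using unif by (force simp: dist_norm)
  have kinf: "filterlim k at_top sequentially" using Fk(2) by (rule filterlim_subseq)
  note w [continuous_intros]
  have wb: "bounded (w ` {0..l})"
    by (intro compact_imp_bounded compact_continuous_image w) auto
  have ulG: "uniform_limit {0..l} (\<lambda>n. G (f (k n))) (G F) sequentially"
    unfolding G_def[abs_def]
    by (intro uniform_lim_mult uniform_limit_const uniform_limit_compose_continuous[OF ul _ B] wb
         compact_imp_bounded compact_continuous_image continuous_intros Fk) (use q in auto)
  have ulm: "uniform_limit {0..l} (\<lambda>n x. w x * \<bar>f (k n) x\<bar> powr (q + 1)) (\<lambda>x. w x * \<bar>F x\<bar> powr (q + 1)) sequentially"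
    by (intro uniform_lim_mult uniform_limit_const uniform_limit_compose_continuous[OF ul _ B, where \<phi> = "\<lambda>y. \<bar>y\<bar> powr (q + 1)"] wb
         compact_imp_bounded compact_continuous_image continuous_on_powr' continuous_intros Fk) (use q in auto)
  have "(\<lambda>n. \<mu> (k n)) \<longlonglongrightarrow> m F"
    unfolding \<mu>_def m_def by (rule J_tendsto[OF ulm]) (rule mc[OF fc])
  then have mF: "m F = M"
    using LIMSEQ_unique filterlim_compose[OF M(1) kinf] by blast
  obtain h where h: "sol h (G F)" using sol_exists[OF Gc[OF Fk(1)]] by blast
  \<comment> \<open>\<open>H n\<close> solves the linear problem with source
    \<open>G (f (k n))\<close>, and these sources converge uniformly to \<open>G F\<close>. The
    energy of \<open>H n - h\<close> is the integral of a source difference tending to 0 times a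
    bounded difference of solutions, so it tends to 0 and the sup bound gives pointwise convergence
    to \<open>h\<close>.\<close>
  define H where "H n x = s (k n) * f (Suc (k n)) x" for n x
  have H: "sol (\<lambda>x. H n x + (-1) * h x) (\<lambda>x. G (f (k n)) x + (-1) * G F x)" for n
    unfolding H_def by (rule sol_lin[OF s(2) h])
  obtain S where S: "\<And>n. \<bar>s n\<bar> \<le> S"
    using convergent_imp_Bseq[OF convergentI[OF sM]] unfolding Bseq_def by auto
  obtain Bh where Bh: "\<And>x. x \<in> {0..l} \<Longrightarrow> \<bar>h x\<bar> \<le> Bh"
    using compact_imp_bounded[OF compact_continuous_image[OF sol_cont(1)[OF h]]]
    unfolding bounded_iff by fastforce
  have Hb: "\<bar>H n x - h x\<bar> \<le> S * B + Bh" if "x \<in> {0..l}" for n x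
  proof -
    have "\<bar>H n x\<bar> \<le> S * B"
      unfolding H_def abs_mult by (intro mult_mono S B that) (use S[of 0] in auto)
    then show ?thesis using Bh[OF that] by linarith
  qed
  have T: "S * B + Bh \<ge> 0" using Hb[of 0 0] l by auto
  have "uniform_limit {0..l} (\<lambda>n x. (G (f (k n)) x + (-1) * G F x) * (H n x + (-1) * h x)) (\<lambda>_. 0) sequentially"
  proof (rule uniform_limitI)
    fix e :: real assume "e > 0"
    define e' where "e' = e / (S * B + Bh + 1)"
    have e': "e' > 0" using T \<open>e > 0\<close> by (simp add: e'_def)
    show "\<forall>\<^sub>F n in sequentially. \<forall>x\<in>{0..l}. dist ((G (f (k n)) x + (-1) * G F x) * (H n x + (-1) * h x)) 0 < e"
      using uniform_limitD[OF ulG e']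
    proof eventually_elim
      case (elim n)
      show ?case
      proof
        fix x assume x: "x \<in> {0..l}"
        have "\<bar>G (f (k n)) x - G F x\<bar> * \<bar>H n x - h x\<bar> \<le> e' * (S * B + Bh)"
          using elim x Hb[OF x, of n] T e' by (intro mult_mono) (auto simp: dist_norm intro: less_imp_le)
        also have "\<dots> < e" using T \<open>e > 0\<close> by (simp add: e'_def field_simps)
        finally show "dist ((G (f (k n)) x + (-1) * G F x) * (H n x + (-1) * h x)) 0 < e"
          by (simp add: abs_mult)
      qed
    qed
  qed
  then have "(\<lambda>n. J (\<lambda>x. (G (f (k n)) x + (-1) * G F x) * (H n x + (-1) * h x))) \<longlonglongrightarrow> J (\<lambda>_. 0)"
    by (rule J_tendsto) (intro continuous_intros sol_cont[OF H])
  then have J0: "(\<lambda>n. 2 * l * J (\<lambda>x. (G (f (k n)) x + (-1) * G F x) * (H n x + (-1) * h x))) \<longlonglongrightarrow> 0"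
    by (intro tendsto_mult_right_zero) (simp add: J_def)
  \<comment> \<open>Two computations of the limit of \<open>H n x\<close>: it is \<open>h x\<close>
    by stability of the linear problem, and \<open>M * F x\<close> because consecutive iterates
    merge and \<open>s\<close> tends to \<open>M\<close>.\<close>
  have hF: "h x = M * F x" if x: "x \<in> {0..l}" for x
  proof -
    have "(\<lambda>n. (H n x + (-1) * h x)\<^sup>2) \<longlonglongrightarrow> 0"
      by (rule tendsto_sandwich[OF _ _ tendsto_const J0]) (intro always_eventually allI zero_le_power2 sol_sup[OF H x])+
    then have "(\<lambda>n. H n x - h x) \<longlonglongrightarrow> 0" by (simp add: power_tendsto_0_iff)
    then have 1: "(\<lambda>n. H n x) \<longlonglongrightarrow> h x" by (simp add: LIM_zero_iff)
    have "(\<lambda>n. 4 * l * s n * (s n - \<mu> n)) \<longlonglongrightarrow> 4 * l * M * 0"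
      by (intro tendsto_intros sM gap)
    then have gap': "(\<lambda>n. 4 * l * s n * (s n - \<mu> n)) \<longlonglongrightarrow> 0" by simp
    have "(\<lambda>n. (s n * f (Suc n) x - s n * f n x)\<^sup>2) \<longlonglongrightarrow> 0"
      by (rule tendsto_sandwich[OF _ _ tendsto_const gap']) (intro always_eventually allI zero_le_power2 s(4)[OF x])+
    then have "(\<lambda>n. s n * f (Suc n) x - s n * f n x) \<longlonglongrightarrow> 0" by (simp add: power_tendsto_0_iff)
    then have 2: "(\<lambda>n. s (k n) * f (Suc (k n)) x - s (k n) * f (k n) x) \<longlonglongrightarrow> 0"
      by (rule filterlim_compose[OF _ kinf])
    have 3: "(\<lambda>n. s (k n) * f (k n) x) \<longlonglongrightarrow> M * F x"
      by (intro tendsto_mult filterlim_compose[OF sM kinf] tendsto_uniform_limitI[OF ul x])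
    have "(\<lambda>n. H n x) \<longlonglongrightarrow> M * F x"
      using tendsto_add[OF 2 3] by (simp add: H_def)
    with 1 show ?thesis using LIMSEQ_unique by blast
  qed
  \<comment> \<open>Replacing F by h / M in the source \<open>G F\<close> pulls out the constant
    M^(-q), which becomes \<open>C\<close>.\<close>
  have "sol h (\<lambda>x. (1 / M) powr q * (w x * sgnpow q (h x)))"
  proof (rule sol_cong[OF h])
    fix x assume x: "x \<in> {0..l}"
    have "F x = (1 / M) * h x" using hF[OF x] Mpos by simp
    then show "G F x = (1 / M) powr q * (w x * sgnpow q (h x))"
      using Mpos by (simp add: G_def sgnpow_scale del: times_divide_eq_left)
  qed
  moreover have "\<exists>x\<in>{0<..<l}. h x \<noteq> 0"
  proof (rule ccontr)
    assume "\<not> ?thesis"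
    then have "h x = 0" if "x \<in> {0..l}" for x
      using that h by (cases "x = 0 \<or> x = l") (auto simp: sol_def)
    then have "F x = 0" if "x \<in> {0..l}" for x
      using hF that Mpos by force
    then have "m F = J (\<lambda>_. 0)" unfolding m_def by (intro J_cong) auto
    then show False using mF Mpos by (simp add: J_def)
  qed
  ultimately show ?thesis using Mpos by (intro exI[of _ "(1 / M) powr q"] exI[of _ h]) auto
qed

end

subsection \<open>The angular profile\<close>

text \<open>The energy \<open>z'^2 + b^2 * z^2\<close> is conserved. This is the uniqueness
  principle behind the gluing and all symmetries of the profile: the difference of two solutions
  with the same forcing solves the free equation.\<close>

lemma harmonic_oscillator_zero:
  fixes z z' :: "real \<Rightarrow> real"
  assumes "convex S" "c \<in> S" "b \<noteq> 0"
    and z: "\<And>x. x \<in> S \<Longrightarrow> (z has_real_derivative z' x) (at x within S)"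
    and z': "\<And>x. x \<in> S \<Longrightarrow> (z' has_real_derivative (- b\<^sup>2 * z x)) (at x within S)"
    and "z c = 0" "z' c = 0" and x: "x \<in> S"
  shows "z x = 0" "z' x = 0"
proof -
  have "((\<lambda>x. (z' x)\<^sup>2 + b\<^sup>2 * (z x)\<^sup>2) has_real_derivative 0) (at x within S)" if "x \<in> S" for x
    by (auto intro!: derivative_eq_intros z[OF that] z'[OF that])
  then obtain k where "\<And>x. x \<in> S \<Longrightarrow> (z' x)\<^sup>2 + b\<^sup>2 * (z x)\<^sup>2 = k"
    using has_field_derivative_zero_constant[OF \<open>convex S\<close>, of "\<lambda>x. (z' x)\<^sup>2 + b\<^sup>2 * (z x)\<^sup>2"] by auto
  then have "(z' x)\<^sup>2 + (b * z x)\<^sup>2 = 0"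
    using x assms(2,6,7) by (force simp: power_mult_distrib)
  then show "z x = 0" "z' x = 0" using \<open>b \<noteq> 0\<close> by (auto simp: sum_power2_eq_zero_iff)
qed

lemma real_antiderivative:
  fixes h :: "real \<Rightarrow> real"
  assumes "continuous_on UNIV h"
  obtains H where "H 0 = 0" "\<And>x. (H has_real_derivative h x) (at x)"
proof -
  obtain F where F: "\<And>x. (F has_vector_derivative h x) (at x)"
    using einterval_antiderivative[of "-\<infinity>" "\<infinity>" h] assms by (auto simp: continuous_on_eq_continuous_at)
  show thesis
    by (rule that[of "\<lambda>x. F x - F 0"])
       (auto intro!: derivative_eq_intros F simp: has_real_derivative_iff_has_vector_derivative)
qed

text \<open>The last three conclusions encode that \<open>E\<close> is locally a multiple of |f|^q
  and that the flow is rotational: the global bound handles the zeros of \<open>f\<close>, where the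
  multiple may jump, and the eventual identity handles all other points. Parity and periodicity
  provide the reflection symmetry and a function on the circle.\<close>

lemma angular_profile:
  fixes b q :: real
  assumes b: "b > 0" and q: "q > 0"
  obtains f f' E :: "real \<Rightarrow> real" and C :: real where
    "\<And>x. (f has_real_derivative f' x) (at x)"
    "\<And>x. (f' has_real_derivative (- b\<^sup>2 * f x - sin x * E x)) (at x)"
    "continuous_on UNIV E"
    "\<And>x. f (- x) = - f x" "\<And>x. E (- x) = E x"
    "\<And>x. f (x + 2 * pi) = f x" "\<And>x. E (x + 2 * pi) = E x"
    "\<And>x. \<bar>E x\<bar> \<le> C * \<bar>f x\<bar> powr q"
    "\<And>x. f x \<noteq> 0 \<Longrightarrow> \<exists>\<kappa>. \<forall>\<^sub>F y in nhds x. E y = \<kappa> * \<bar>f y\<bar> powr q"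
    "\<exists>x. sin x * E x \<noteq> 0"
proof -
  \<comment> \<open>\<open>k\<close> is the largest integer strictly below b. The choice of
    \<open>l\<close> makes b (pi - 2 l) = k pi, so that the middle sine wave runs through exactly k
    half waves, while b l = (b - k) pi / 2 lies in (0, pi / 2] as the locale demands.\<close>
  define k where "k = nat (\<lceil>b\<rceil> - 1)"
  have "\<lceil>b\<rceil> \<ge> 1" using b by linarith
  then have k: "real k < b" "b \<le> real k + 1" unfolding k_def by linarith+
  define l where "l = (pi - k * pi / b) / 2"
  have l: "l > 0" using k b by (simp add: l_def field_simps)
  have bl: "b * l = (b * pi - k * pi) / 2" using b by (simp add: l_def field_simps)
  have "b * pi \<le> (real k + 1) * pi" using k(2) by (intro mult_right_mono) auto
  then have al: "b * l \<le> pi / 2" unfolding bl by (simp add: algebra_simps)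
  have lpi: "l \<le> pi / 2" using b by (simp add: l_def)
  interpret dirichlet l b by unfold_locales (use l b al in auto)
  obtain C g where C: "C > 0" and g: "sol g (\<lambda>x. C * (sin x * sgnpow q (g x)))" and gn: "\<exists>x\<in>{0<..<l}. g x \<noteq> 0"
    using nonlinear_eigenfunction[OF q, of sin] lpi
    by (force intro!: continuous_intros sin_ge_zero sin_gt_zero)
  obtain g' where g': "\<And>x. x\<in>{0..l} \<Longrightarrow> (g has_real_derivative g' x) (at x within {0..l})"
     "\<And>x. x\<in>{0..l} \<Longrightarrow> (g' has_real_derivative (- b\<^sup>2 * g x - C * (sin x * sgnpow q (g x)))) (at x within {0..l})"
    and g0: "g 0 = 0" "g l = 0"
    using g unfolding sol_def by blast
  \<comment> \<open>The parity of the middle wave: b (pi - x - l) = k pi - b (x - l), so reflection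
    in pi / 2 multiplies sin (b (x - l)) by -1 for even k and by 1 for odd k.\<close>
  define \<sigma> :: real where "\<sigma> = (if even k then -1 else 1)"
  have \<sigma>2: "\<sigma> * \<sigma> = 1" by (simp add: \<sigma>_def)
  \<comment> \<open>Since \<open>g l = 0\<close>, clamping the argument at \<open>l\<close> extends
    the coefficient continuously by 0.\<close>
  define e where "e y = C * sgnpow q (g (min y l))" for y
  define E0 where "E0 y = e y + \<sigma> * e (pi - y)" for y
  \<comment> \<open>Folding the line onto [0, pi] makes \<open>E\<close> even and 2 pi-periodic by
    construction.\<close>
  define F where "F x = arccos (cos x)" for x :: real
  define E where "E x = E0 (F x)" for x
  have F: "F x \<in> {0..pi}" for x by (simp add: F_def arccos_lbound arccos_ubound)
  have Fc: "continuous_on UNIV F"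
    unfolding F_def[abs_def] by (intro continuous_intros) auto
  have F_minus: "F (- x) = F x" and F_per: "F (x + 2 * pi) = F x" and F_pi: "F (pi - x) = pi - F x" for x
    by (simp_all add: F_def arccos_minus)
  have F_id: "F x = x" if "x \<in> {0..pi}" for x using that by (simp add: F_def arccos_cos)
  have ec: "continuous_on {0..pi} e"
    unfolding e_def[abs_def]
    by (intro continuous_intros continuous_on_compose2[OF sol_cont(1)[OF g]] q) (use l in auto)
  have E0c: "continuous_on {0..pi} E0"
    unfolding E0_def[abs_def] by (intro continuous_intros ec continuous_on_compose2[OF ec]) auto
  have Ec: "continuous_on UNIV E"
    unfolding E_def[abs_def] by (rule continuous_on_compose2[OF E0c Fc]) (use F in auto)
  have E_minus: "E (- x) = E x" and E_per: "E (x + 2 * pi) = E x" for x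
    by (simp_all only: E_def F_minus F_per)
  have E_pi: "E (pi - x) = \<sigma> * E x" for x
    using \<sigma>2 by (simp add: E_def F_pi E0_def algebra_simps)
  have e0: "e y = 0" if "y \<ge> l" for y using that g0 by (simp add: e_def min_def sgnpow_def)
  obtain A where A: "A 0 = 0" "\<And>x. (A has_real_derivative cos (b * x) * (sin x * E x)) (at x)"
    by (rule real_antiderivative[of "\<lambda>x. cos (b * x) * (sin x * E x)"]) (auto intro!: continuous_intros Ec)
  obtain B where B: "B 0 = 0" "\<And>x. (B has_real_derivative sin (b * x) * (sin x * E x)) (at x)"
    by (rule real_antiderivative[of "\<lambda>x. sin (b * x) * (sin x * E x)"]) (auto intro!: continuous_intros Ec)
  \<comment> \<open>With \<open>E\<close> fixed first, \<open>f\<close> is the solution of a linear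
    initial value problem on the whole line with slope \<open>g' 0\<close>. No pieces have to be
    glued, so both derivatives exist across the junctions, and agreement with \<open>g\<close> on
    [0, l] follows from uniqueness.\<close>
  define f where "f = (\<lambda>x. (g' 0 * sin (b * x) - (sin (b * x) * A x - cos (b * x) * B x)) / b)"
  define f' where "f' = (\<lambda>x. g' 0 * cos (b * x) - (cos (b * x) * A x + sin (b * x) * B x))"
  have f: "(f has_real_derivative f' x) (at x)"
    and f': "(f' has_real_derivative (- b\<^sup>2 * f x - sin x * E x)) (at x)" for x
    unfolding f_def f'_def
    using variation_of_constants[where k = "g' 0" and g = "\<lambda>x. sin x * E x" and a = b and x = x, OF _ A(2) B(2)] b by simp_all
  have fS: "(f has_real_derivative f' x) (at x within S)"
    and f'S: "(f' has_real_derivative (- b\<^sup>2 * f x - sin x * E x)) (at x within S)" for x S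
    using f f' by (auto intro: has_field_derivative_at_within)
  have f0: "f 0 = 0" "f' 0 = g' 0" by (auto simp: f_def f'_def A B)
  have E_left: "E x = C * sgnpow q (g x)" if "x \<in> {0..l}" for x
    using that lpi e0[of "pi - x"] pi_gt_zero by (simp add: E_def F_id E0_def) (simp add: e_def min_def)
  have fg: "f x = g x" if x: "x \<in> {0..l}" for x
  proof -
    have "f x - g x = 0"
    proof (rule harmonic_oscillator_zero(1)[of "{0..l}" 0 b "\<lambda>x. f x - g x" "\<lambda>x. f' x - g' x"])
      fix x assume x: "x \<in> {0..l}"
      show "((\<lambda>x. f x - g x) has_real_derivative f' x - g' x) (at x within {0..l})"
        by (intro DERIV_diff fS g' x)
      show "((\<lambda>x. f' x - g' x) has_real_derivative - b\<^sup>2 * (f x - g x)) (at x within {0..l})"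
        using DERIV_diff[OF f'S g'(2)[OF x]] E_left[OF x] by (simp add: algebra_simps)
    qed (use x l b f0 g0 in auto)
    then show ?thesis by simp
  qed
  have fl: "f l = 0" using fg[of l] g0 l by simp
  have E_mid: "E x = 0" if "x \<in> {l..pi - l}" for x
    using that l e0 by (simp add: E_def F_id E0_def)
  define \<beta> where "\<beta> = f' l"
  \<comment> \<open>The forcing vanishes on [l, pi - l], so \<open>f\<close> is there the free wave
    leaving \<open>l\<close> with slope \<open>\<beta>\<close>. Its data at pi / 2, where the phase
    is k pi / 2, are what the reflection argument needs.\<close>
  have mid: "f (pi / 2) = \<beta> * sin (k * pi / 2) / b" "f' (pi / 2) = \<beta> * cos (k * pi / 2)"
  proof -
    let ?z = "\<lambda>x. f x - \<beta> * sin (b * (x - l)) / b" and ?z' = "\<lambda>x. f' x - \<beta> * cos (b * (x - l))"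
    have 1: "(?z has_real_derivative ?z' x) (at x within {l..pi - l})" for x
      using b by (auto intro!: derivative_eq_intros fS)
    have 2: "(?z' has_real_derivative - b\<^sup>2 * ?z x) (at x within {l..pi - l})" if "x \<in> {l..pi - l}" for x
      using b E_mid[OF that] by (auto intro!: derivative_eq_intros f'S simp: field_simps power2_eq_square)
    have "pi / 2 \<in> {l..pi - l}" "l \<in> {l..pi - l}" using lpi by auto
    note z = harmonic_oscillator_zero[of "{l..pi - l}" l b ?z ?z', OF _ this(2) _ 1 2 _ _ this(1)]
    have "b * (pi / 2 - l) = k * pi / 2" using bl by (simp add: algebra_simps)
    then have "sin (b * (pi / 2 - l)) = sin (k * pi / 2)" "cos (b * (pi / 2 - l)) = cos (k * pi / 2)"
      by (simp_all only:)
    then show "f (pi / 2) = \<beta> * sin (k * pi / 2) / b" "f' (pi / 2) = \<beta> * cos (k * pi / 2)"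
      using z b fl by (auto simp: \<beta>_def)
  qed
  have "(1 - \<sigma>) * f (pi / 2) = 0 \<and> (1 + \<sigma>) * f' (pi / 2) = 0"
  proof (cases "even k")
    case True
    then obtain j where "k = 2 * j" by blast
    then show ?thesis using mid by (simp add: \<sigma>_def)
  next
    case False
    then obtain j where j: "k = 2 * j + 1" using oddE by blast
    have "cos (real k * pi / 2) = cos (real j * pi + pi / 2)" by (simp add: j field_simps)
    also have "\<dots> = 0" by (simp add: cos_add)
    finally show ?thesis using mid False by (simp add: \<sigma>_def)
  qed
  then have sym0: "f (pi - pi / 2) - \<sigma> * f (pi / 2) = 0" "- f' (pi - pi / 2) - \<sigma> * f' (pi / 2) = 0"
    by (auto simp: algebra_simps)
  have f_pi: "f (pi - x) = \<sigma> * f x" for x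
  proof -
    have "f (pi - x) - \<sigma> * f x = 0"
    proof (rule harmonic_oscillator_zero(1)[of UNIV "pi / 2" b "\<lambda>x. f (pi - x) - \<sigma> * f x" "\<lambda>x. - f' (pi - x) - \<sigma> * f' x"])
      fix x
      show "((\<lambda>x. f (pi - x) - \<sigma> * f x) has_real_derivative - f' (pi - x) - \<sigma> * f' x) (at x)"
        by (auto intro!: derivative_eq_intros DERIV_chain2[OF f] f)
      show "((\<lambda>x. - f' (pi - x) - \<sigma> * f' x) has_real_derivative - b\<^sup>2 * (f (pi - x) - \<sigma> * f x)) (at x)"
        by (auto intro!: derivative_eq_intros DERIV_chain2[OF f'] f' simp: E_pi algebra_simps)
    qed (use b sym0 in auto)
    then show ?thesis by simp
  qed
  have f_odd: "f (- x) + f x = 0" "- f' (- x) + f' x = 0" for x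
  proof -
    have 1: "((\<lambda>x. f (- x) + f x) has_real_derivative - f' (- x) + f' x) (at x)" for x
      by (auto intro!: derivative_eq_intros DERIV_chain2[OF f] f)
    have 2: "((\<lambda>x. - f' (- x) + f' x) has_real_derivative - b\<^sup>2 * (f (- x) + f x)) (at x)" for x
      by (auto intro!: derivative_eq_intros DERIV_chain2[OF f'] f' simp: E_minus algebra_simps)
    show "f (- x) + f x = 0" "- f' (- x) + f' x = 0"
      using harmonic_oscillator_zero[of UNIV 0 b "\<lambda>x. f (- x) + f x" "\<lambda>x. - f' (- x) + f' x", OF _ _ _ 1 2] b f0 by auto
  qed
  have fpi: "f pi = 0" using f_pi[of 0] f0 by simp
  have f_per: "f (x + 2 * pi) = f x" for x
  proof -
    \<comment> \<open>Uniqueness is applied at -pi: f vanishes at pi and -pi, and the oddness of f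
      makes the slopes there equal.\<close>
    have "f (x + 2 * pi) - f x = 0"
    proof (rule harmonic_oscillator_zero(1)[of UNIV "- pi" b "\<lambda>x. f (x + 2 * pi) - f x" "\<lambda>x. f' (x + 2 * pi) - f' x"])
      fix x
      show "((\<lambda>x. f (x + 2 * pi) - f x) has_real_derivative f' (x + 2 * pi) - f' x) (at x)"
        by (auto intro!: derivative_eq_intros DERIV_chain2[OF f] f)
      show "((\<lambda>x. f' (x + 2 * pi) - f' x) has_real_derivative - b\<^sup>2 * (f (x + 2 * pi) - f x)) (at x)"
        using sin_periodic[of x] E_per[of x]
        by (auto intro!: derivative_eq_intros DERIV_chain2[OF f'] f' simp: right_diff_distrib)
      show "f (- pi + 2 * pi) - f (- pi) = 0" "f' (- pi + 2 * pi) - f' (- pi) = 0"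
        using f_odd[of pi] fpi by auto
    qed (use b in auto)
    then show ?thesis by simp
  qed
  interpret P: periodic_fun_simple f "2 * pi" by unfold_locales (rule f_per)
  have fF: "\<bar>f (F x)\<bar> = \<bar>f x\<bar>" for x
  proof -
    have "cos (F x) = cos x" by (simp add: F_def)
    then obtain n where n: "F x = x + n * (2 * pi) \<or> F x = - x + n * (2 * pi)" "n \<in> \<int>"
      by (subst (asm) cos_eq) (auto simp: mult_ac)
    then obtain m where "n = of_int m" by (auto elim: Ints_cases)
    with n P.plus_of_int[of x m] P.plus_of_int[of "- x" m] f_odd(1)[of x]
    show ?thesis by auto
  qed
  define c where "c y = (if y < l \<or> y > pi - l then C else 0)" for y
  have E_eq: "E x = c (F x) * sgn (f (F x)) * \<bar>f x\<bar> powr q" for x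
  proof -
    have "E0 y = c y * sgnpow q (f y)" if y: "y \<in> {0..pi}" for y
    proof -
      consider "y < l" | "y \<in> {l..pi - l}" | "y > pi - l" by fastforce
      then show ?thesis
      proof cases
        case 1
        then show ?thesis using E_left[of y] fg[of y] y by (simp add: E_def F_id c_def)
      next
        case 2
        then show ?thesis using E_mid[of y] y l by (auto simp: E_def F_id c_def)
      next
        case 3
        then have "E y = \<sigma> * E (pi - y)" using E_pi[of y] \<sigma>2 by simp
        also have "\<dots> = C * (\<sigma> * sgnpow q (f (pi - y)))"
          using E_left[of "pi - y"] fg[of "pi - y"] y 3 by simp
        also have "\<sigma> * sgnpow q (f (pi - y)) = sgnpow q (f y)"
          by (simp add: f_pi \<sigma>_def sgnpow_def)
        finally show ?thesis using y 3 by (simp add: E_def F_id c_def)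
      qed
    qed
    then show ?thesis
      using F[of x] by (simp add: E_def sgnpow_def fF mult.assoc)
  qed
  have bd: "\<bar>E x\<bar> \<le> C * \<bar>f x\<bar> powr q" for x
    unfolding E_eq abs_mult using C by (auto simp: c_def sgn_real_def)
  have loc: "\<exists>\<kappa>. \<forall>\<^sub>F y in nhds x. E y = \<kappa> * \<bar>f y\<bar> powr q" if "f x \<noteq> 0" for x
  proof -
    define Z where "Z = c (F x) * sgn (f (F x))"
    have fn: "f (F x) \<noteq> 0" using that fF[of x] by auto
    \<comment> \<open>The coefficient \<open>c\<close> jumps only at \<open>l\<close> and
      \<open>pi - l\<close>, and f vanishes at both, so it is locally constant wherever f is
      nonzero.\<close>
    then have ne: "F x \<noteq> l" "F x \<noteq> pi - l" using fl f_pi[of l] by auto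
    have cF: "(F \<longlongrightarrow> F x) (nhds x)"
      using Fc by (simp add: continuous_on_eq_continuous_at tendsto_nhds_iff isCont_def)
    have cf: "((\<lambda>y. f (F y)) \<longlongrightarrow> f (F x)) (nhds x)"
      by (rule isCont_tendsto_compose[OF DERIV_isCont[OF f] cF])
    have "\<forall>\<^sub>F y in nhds x. c (F y) = c (F x)"
    proof -
      consider "F x < l" | "F x > pi - l" | "F x > l" "F x < pi - l" using ne by linarith
      then show ?thesis
      proof cases
        case 1
        show ?thesis using order_tendstoD(2)[OF cF 1] by eventually_elim (use 1 in \<open>auto simp: c_def\<close>)
      next
        case 2
        show ?thesis using order_tendstoD(1)[OF cF 2] by eventually_elim (use 2 in \<open>auto simp: c_def\<close>)
      next
        case 3
        show ?thesis using order_tendstoD(1)[OF cF 3(1)] order_tendstoD(2)[OF cF 3(2)]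
          by eventually_elim (use 3 in \<open>auto simp: c_def\<close>)
      qed
    qed
    moreover have "\<forall>\<^sub>F y in nhds x. sgn (f (F y)) = sgn (f (F x))"
    proof (cases "f (F x) > 0")
      case True
      show ?thesis using order_tendstoD(1)[OF cf True] by eventually_elim (use True in auto)
    next
      case False
      then have neg: "f (F x) < 0" using fn by simp
      show ?thesis using order_tendstoD(2)[OF cf neg] by eventually_elim (use neg in auto)
    qed
    ultimately have "\<forall>\<^sub>F y in nhds x. E y = Z * \<bar>f y\<bar> powr q"
      by eventually_elim (simp add: E_eq Z_def)
    then show ?thesis by blast
  qed
  have rot: "\<exists>x. sin x * E x \<noteq> 0"
  proof -
    obtain x where x: "x \<in> {0<..<l}" "g x \<noteq> 0" using gn by blast
    then have "sin x > 0" using lpi by (intro sin_gt_zero) auto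
    then show ?thesis using x C E_left[of x] by (intro exI[of _ x]) (auto simp: sgnpow_def sgn_real_def)
  qed
  have odd: "f (- x) = - f x" for x using f_odd(1)[of x] by linarith
  show thesis
    by (rule that[OF f f' Ec odd E_minus f_per E_per bd loc rot])
qed

text \<open>Near a zero of \<open>f\<close> the bound gives g = O(|f|^p), and |f| is at most linear
  in the distance, so g is of smaller than linear order.\<close>

lemma DERIV_zero_of_powr_bound:
  fixes f g :: "real \<Rightarrow> real"
  assumes "p > 1" and bd: "\<And>y. \<bar>g y\<bar> \<le> C * \<bar>f y\<bar> powr p"
    and f: "(f has_real_derivative D) (at x)" and fx: "f x = 0"
  shows "(g has_real_derivative 0) (at x)"
proof -
  have gx: "g x = 0" using bd[of x] fx by simp
  have "(f \<longlongrightarrow> 0) (at x)" using DERIV_isCont[OF f] fx by (simp add: isCont_def)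
  then have "((\<lambda>y. \<bar>f y\<bar> powr (p - 1)) \<longlongrightarrow> \<bar>0\<bar> powr (p - 1)) (at x)"
    by (intro tendsto_powr' tendsto_intros) (use assms(1) in auto)
  moreover have "((\<lambda>y. (f y - f x) / (y - x)) \<longlongrightarrow> D) (at x)"
    using f by (simp add: has_field_derivative_iff)
  ultimately have "((\<lambda>y. C * (\<bar>(f y - f x) / (y - x)\<bar> * \<bar>f y\<bar> powr (p - 1))) \<longlongrightarrow> C * (\<bar>D\<bar> * \<bar>0\<bar> powr (p - 1))) (at x)"
    by (intro tendsto_mult tendsto_const tendsto_rabs)
  then have lim: "((\<lambda>y. C * (\<bar>(f y - f x) / (y - x)\<bar> * \<bar>f y\<bar> powr (p - 1))) \<longlongrightarrow> 0) (at x)" by simp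
  have "((\<lambda>y. (g y - g x) / (y - x)) \<longlongrightarrow> 0) (at x)"
  proof (rule Lim_null_comparison[OF _ lim], rule always_eventually, rule allI)
    fix y
    have "\<bar>f y\<bar> powr p = \<bar>f y\<bar> * \<bar>f y\<bar> powr (p - 1)"
      by (simp add: powr_mult_base)
    then have "\<bar>g y\<bar> / \<bar>y - x\<bar> \<le> C * (\<bar>f y\<bar> * \<bar>f y\<bar> powr (p - 1)) / \<bar>y - x\<bar>"
      using bd[of y] by (intro divide_right_mono) auto
    then show "norm ((g y - g x) / (y - x)) \<le> C * (\<bar>(f y - f x) / (y - x)\<bar> * \<bar>f y\<bar> powr (p - 1))"
      by (simp add: gx fx abs_divide)
  qed
  then show ?thesis by (simp add: has_field_derivative_iff)
qed

text \<open>Near \<open>x\<close> the sign of \<open>f\<close> is constant, so |f| is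
  \<open>sgn (f x) * f\<close>. Writing the derivative with |f|^p / f avoids a case distinction on
  that sign.\<close>

lemma DERIV_abs_powr:
  fixes f :: "real \<Rightarrow> real"
  assumes f: "(f has_real_derivative D) (at x)" and fx: "f x \<noteq> 0"
  shows "((\<lambda>y. \<bar>f y\<bar> powr p) has_real_derivative p * \<bar>f x\<bar> powr p / f x * D) (at x)"
proof -
  have pos: "sgn (f x) * f x = \<bar>f x\<bar>" by (simp add: sgn_real_def)
  have "((\<lambda>y. (sgn (f x) * f y) powr p) has_real_derivative (p * \<bar>f x\<bar> powr (p - 1)) * (sgn (f x) * D)) (at x)"
    using DERIV_chain2[OF has_real_derivative_powr[of "sgn (f x) * f x" p] DERIV_cmult[OF f]] fx
    unfolding pos by simp
  also have "(p * \<bar>f x\<bar> powr (p - 1)) * (sgn (f x) * D) = p * \<bar>f x\<bar> powr p / f x * D"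
    using fx by (simp add: powr_diff sgn_real_def)
  finally have "((\<lambda>y. (sgn (f x) * f y) powr p) has_real_derivative p * \<bar>f x\<bar> powr p / f x * D) (at x)" .
  moreover have "\<forall>\<^sub>F y in nhds x. (sgn (f x) * f y) powr p = \<bar>f y\<bar> powr p"
  proof -
    have "(f \<longlongrightarrow> f x) (nhds x)"
      using DERIV_isCont[OF f] by (simp add: tendsto_nhds_iff isCont_def)
    from tendsto_mult[OF tendsto_const[of "sgn (f x)"] this]
    have "\<forall>\<^sub>F y in nhds x. sgn (f x) * f y > 0"
      by (rule order_tendstoD(1)) (use fx in \<open>auto simp: sgn_real_def\<close>)
    then show ?thesis by eventually_elim (auto simp: sgn_real_def split: if_splits)
  qed
  ultimately show ?thesis
    by (subst (asm) DERIV_cong_ev[OF refl _ refl]) auto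
qed

text \<open>Off the zeros of \<open>f\<close> the identity E = \<kappa> |f|^q is differentiated
  directly. At a zero, E f = O(|f|^(q + 1)) has derivative 0 for every q > 0, whereas E = O(|f|^q)
  is covered for q > 1. The first case makes the density differentiable; the second supplies one
  more order of regularity.\<close>

lemma profile_DERIV:
  fixes f E :: "real \<Rightarrow> real"
  assumes f: "\<And>x. (f has_real_derivative f' x) (at x)" and f'c: "continuous_on UNIV f'"
    and Ec: "continuous_on UNIV E"
    and bd: "\<And>x. \<bar>E x\<bar> \<le> C * \<bar>f x\<bar> powr q"
    and loc: "\<And>x. f x \<noteq> 0 \<Longrightarrow> \<exists>\<kappa>. \<forall>\<^sub>F y in nhds x. E y = \<kappa> * \<bar>f y\<bar> powr q"
    and q: "q > 0"
  shows "((\<lambda>x. E x * f x / (q + 1)) has_real_derivative E x * f' x) (at x)"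
    and "q > 1 \<Longrightarrow> (E has_real_derivative q * E x * f' x / f x) (at x)"
    and "q > 1 \<Longrightarrow> continuous_on UNIV (\<lambda>x. q * E x * f' x / f x)"
proof -
  have dE: "(E has_real_derivative q * E x * f' x / f x) (at x)" if "f x \<noteq> 0" for x
  proof -
    obtain \<kappa> where \<kappa>: "\<forall>\<^sub>F y in nhds x. E y = \<kappa> * \<bar>f y\<bar> powr q" using loc \<open>f x \<noteq> 0\<close> by blast
    have "((\<lambda>y. \<kappa> * \<bar>f y\<bar> powr q) has_real_derivative \<kappa> * (q * \<bar>f x\<bar> powr q / f x * f' x)) (at x)"
      by (intro DERIV_cmult DERIV_abs_powr f that)
    moreover have "E x = \<kappa> * \<bar>f x\<bar> powr q" using eventually_nhds_x_imp_x[OF \<kappa>] .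
    ultimately show ?thesis
      by (subst DERIV_cong_ev[OF refl \<kappa> refl]) (simp add: mult_ac)
  qed
  have C: "0 \<le> C * \<bar>f y\<bar> powr q" for y using bd[of y] by linarith
  show "((\<lambda>x. E x * f x / (q + 1)) has_real_derivative E x * f' x) (at x)"
  proof (cases "f x = 0")
    case True
    have "\<bar>E y * f y / (q + 1)\<bar> \<le> C * \<bar>f y\<bar> powr (q + 1)" for y
    proof -
      have "\<bar>E y * f y / (q + 1)\<bar> \<le> C * \<bar>f y\<bar> powr q * \<bar>f y\<bar> / 1"
        unfolding abs_mult abs_divide using q bd[of y] C[of y]
        by (intro frac_le mult_right_mono) auto
      also have "\<dots> = C * \<bar>f y\<bar> powr (q + 1)" by (simp add: powr_add)
      finally show ?thesis .
    qed
    then have "((\<lambda>x. E x * f x / (q + 1)) has_real_derivative 0) (at x)"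
      using q by (intro DERIV_zero_of_powr_bound[OF _ _ f True]) auto
    moreover have "E x = 0" using bd[of x] True by simp
    ultimately show ?thesis by simp
  next
    case False
    have "((\<lambda>x. E x * f x / (q + 1)) has_real_derivative ((q * E x * f' x / f x) * f x + f' x * E x) / (q + 1)) (at x)"
      by (intro DERIV_cdivide DERIV_mult dE False f)
    also have "((q * E x * f' x / f x) * f x + f' x * E x) / (q + 1) = E x * f' x"
      using False q by (simp add: field_simps)
    finally show ?thesis .
  qed
  assume q1: "q > 1"
  \<comment> \<open>At a zero of \<open>f\<close> the formula divides by 0 and therefore reads 0,
    which is the correct derivative.\<close>
  show "(E has_real_derivative q * E x * f' x / f x) (at x)"
    using dE DERIV_zero_of_powr_bound[OF q1 bd f] by (cases "f x = 0") auto
  show "continuous_on UNIV (\<lambda>x. q * E x * f' x / f x)"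
    unfolding continuous_on_eq_continuous_at[OF open_UNIV]
  proof
    fix x
    note ic = Ec[unfolded continuous_on_eq_continuous_at[OF open_UNIV], rule_format]
       f'c[unfolded continuous_on_eq_continuous_at[OF open_UNIV], rule_format] DERIV_isCont[OF f]
    show "isCont (\<lambda>x. q * E x * f' x / f x) x"
    proof (cases "f x = 0")
      case False
      then show ?thesis by (intro continuous_intros ic) auto
    next
      case True
      have "((\<lambda>y. \<bar>f y\<bar> powr (q - 1)) \<longlongrightarrow> \<bar>f x\<bar> powr (q - 1)) (at x)"
        by (intro tendsto_powr' tendsto_const tendsto_rabs isContD[OF ic(3)]) (use q1 in auto)
      then have "((\<lambda>y. q * C * \<bar>f' y\<bar> * \<bar>f y\<bar> powr (q - 1)) \<longlongrightarrow> q * C * \<bar>f' x\<bar> * \<bar>f x\<bar> powr (q - 1)) (at x)"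
        by (intro tendsto_mult tendsto_const tendsto_rabs isContD[OF ic(2)] UNIV_I)
      then have lim: "((\<lambda>y. q * C * \<bar>f' y\<bar> * \<bar>f y\<bar> powr (q - 1)) \<longlongrightarrow> 0) (at x)" using True by simp
      have "((\<lambda>y. q * E y * f' y / f y) \<longlongrightarrow> 0) (at x)"
      proof (rule Lim_null_comparison[OF _ lim], rule always_eventually, rule allI)
        fix y
        have "\<bar>E y\<bar> * (\<bar>f' y\<bar> * q) / \<bar>f y\<bar> \<le> (C * \<bar>f y\<bar> powr q) * (\<bar>f' y\<bar> * q) / \<bar>f y\<bar>"
          using bd[of y] q by (intro divide_right_mono mult_right_mono) auto
        also have "\<dots> = C * (\<bar>f' y\<bar> * q) * \<bar>f y\<bar> powr (q - 1)"
          by (cases "f y = 0") (simp_all add: powr_diff)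
        finally show "norm (q * E y * f' y / f y) \<le> q * C * \<bar>f' y\<bar> * \<bar>f y\<bar> powr (q - 1)"
          using q by (simp add: abs_mult abs_divide mult_ac)
      qed
      then show ?thesis using True by (simp add: isCont_def)
    qed
  qed
qed

subsection \<open>Functions in polar coordinates\<close>

definition ang :: "real^2 \<Rightarrow> real" where
  "ang x = Arg (Complex (x $ 1) (x $ 2))"

definition polar :: "real \<Rightarrow> (real \<Rightarrow> real) \<Rightarrow> real^2 \<Rightarrow> real" where
  "polar m h x = norm x powr m * h (ang x)"

abbreviation periodic2pi :: "(real \<Rightarrow> real) \<Rightarrow> bool" where
  "periodic2pi h \<equiv> \<forall>t. h (t + 2 * pi) = h t"

lemma norm_real2: "norm (x :: real^2) = sqrt ((x $ 1)\<^sup>2 + (x $ 2)\<^sup>2)"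
  by (simp add: norm_vec_def L2_set_def sum_2)

lemma norm_cos_ang: "norm x * cos (ang x) = x $ 1"
  and norm_sin_ang: "norm x * sin (ang x) = x $ 2"
proof -
  have "rcis (cmod (Complex (x $ 1) (x $ 2))) (ang x) = Complex (x $ 1) (x $ 2)"
    unfolding ang_def by (rule rcis_cmod_Arg)
  then show "norm x * cos (ang x) = x $ 1" "norm x * sin (ang x) = x $ 2"
    by (auto simp: complex_eq_iff norm_real2 cmod_def)
qed

lemma periodic2pi_cong:
  assumes h: "periodic2pi h" and eq: "cos s = cos t" "sin s = sin t"
  shows "h s = h t"
proof -
  interpret periodic_fun_simple h "2 * pi" by unfold_locales (use h in auto)
  obtain n :: int where "s = t + 2 * pi * n" using eq sin_cos_eq_iff[of s t] by blast
  then have "s = t + of_int n * (2 * pi)" by simp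
  then show ?thesis by (simp only: plus_of_int)
qed

lemma polar_eq:
  assumes h: "periodic2pi h" and "norm x * cos t = x $ 1" "norm x * sin t = x $ 2"
  shows "polar m h x = norm x powr m * h t"
proof (cases "x = 0")
  case False
  then have "cos (ang x) = cos t" "sin (ang x) = sin t"
    using mult_left_cancel[of "norm x" "cos (ang x)" "cos t"] mult_left_cancel[of "norm x" "sin (ang x)" "sin t"]
    unfolding assms(2,3) norm_cos_ang norm_sin_ang by simp_all
  then have "h (ang x) = h t" by (rule periodic2pi_cong[OF h])
  then show ?thesis by (simp only: polar_def)
qed (simp add: polar_def)

text \<open>\<open>ang\<close> jumps across the negative axis. Rotating the given point onto the
  positive axis and taking the principal logarithm yields a differentiable branch near that point;
  elsewhere agreement modulo 2 pi suffices for periodic functions.\<close>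

lemma local_angle:
  fixes x :: "real^2"
  assumes "x \<noteq> 0"
  obtains T where "(T has_derivative (\<lambda>d. (cos (ang x) * d $ 2 - sin (ang x) * d $ 1) / norm x)) (at x)"
    "T x = ang x" "\<And>y. y \<noteq> 0 \<Longrightarrow> cos (T y) = cos (ang y)" "\<And>y. y \<noteq> 0 \<Longrightarrow> sin (T y) = sin (ang y)"
proof -
  define Z where "Z y = Complex (y $ 1) (y $ 2)" for y :: "real^2"
  define r where "r = norm x"
  have r: "r > 0" using assms by (simp add: r_def)
  have Z0: "Z y \<noteq> 0" if "y \<noteq> 0" for y
    using that by (auto simp: Z_def complex_eq_iff vec_eq_iff forall_2)
  have Zr: "Z y = rcis (norm y) (ang y)" for y
    by (simp add: Z_def complex_eq_iff norm_cos_ang norm_sin_ang)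
  define c where "c = cis (- ang x)"
  have Zx: "Z x * c = of_real r"
    by (simp add: Zr c_def rcis_def cis_mult r_def)
  define T where "T y = ang x + Im (Ln (Z y * c))" for y
  have dZ: "(Z has_derivative Z) (at x)"
    unfolding Z_def[abs_def] Complex_eq
    by (intro has_derivative_add has_derivative_of_real has_derivative_mult_right
        bounded_linear_imp_has_derivative[OF bounded_linear_vec_nth])
  have "((\<lambda>y. Ln (Z y * c)) has_derivative (\<lambda>d. inverse (of_real r) * (Z d * c))) (at x)"
    using has_derivative_compose[OF has_derivative_mult_left[OF dZ, of c], of Ln "(*) (inverse (Z x * c))"]
      has_field_derivative_Ln[of "Z x * c"] r
    unfolding Zx by (simp add: has_field_derivative_def)
  then have "(T has_derivative (\<lambda>d. Im (inverse (of_real r) * (Z d * c)))) (at x)"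
    unfolding T_def[abs_def] by (auto intro!: derivative_eq_intros)
  also have "(\<lambda>d. Im (inverse (of_real r) * (Z d * c))) = (\<lambda>d. (cos (ang x) * d $ 2 - sin (ang x) * d $ 1) / norm x)"
    by (simp add: fun_eq_iff Z_def c_def r_def field_simps flip: of_real_inverse)
  finally have 1: "(T has_derivative (\<lambda>d. (cos (ang x) * d $ 2 - sin (ang x) * d $ 1) / norm x)) (at x)" .
  have 2: "T x = ang x" using r by (simp add: T_def Zx)
  have 3: "cis (T y) = cis (ang y)" if "y \<noteq> 0" for y
  proof -
    have "Z y * c \<noteq> 0" using Z0[OF that] by (simp add: c_def)
    then have "cis (Im (Ln (Z y * c))) = sgn (Z y * c)"
      by (metis Arg_eq_Im_Ln cis_Arg)
    also have "\<dots> = sgn (of_real (norm y) * cis (ang y - ang x))"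
      by (simp add: Zr c_def rcis_def cis_mult mult.assoc)
    also have "\<dots> = cis (ang y - ang x)"
      using that by (simp add: sgn_mult sgn_of_real)
    finally have "cis (Im (Ln (Z y * c))) = cis (ang y - ang x)" .
    then show ?thesis by (simp add: T_def cis_mult flip: cis_mult[of "ang x" "Im (Ln (Z y * c))"])
  qed
  show thesis by (rule that[OF 1 2]) (use 3 in \<open>auto simp: complex_eq_iff\<close>)
qed

lemma bounded_periodic:
  assumes "periodic2pi h" "continuous_on UNIV h"
  obtains B where "\<And>x. \<bar>h (ang x)\<bar> \<le> B"
proof -
  have "bounded (h ` {-pi..pi})"
    by (intro compact_imp_bounded compact_continuous_image continuous_on_subset[OF assms(2)]) auto
  then obtain B where "\<And>t. t \<in> {-pi..pi} \<Longrightarrow> \<bar>h t\<bar> \<le> B" unfolding bounded_iff by fastforce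
  moreover have "ang x \<in> {-pi..pi}" for x
    using Arg_bounded[of "Complex (x $ 1) (x $ 2)"] by (auto simp: ang_def)
  ultimately show thesis using that by blast
qed

lemma isCont_polar:
  assumes h: "periodic2pi h" "continuous_on UNIV h" and "x \<noteq> 0 \<or> m > 0"
  shows "isCont (polar m h) x"
proof (cases "x = 0")
  case False
  obtain T where T: "(T has_derivative (\<lambda>d. (cos (ang x) * d $ 2 - sin (ang x) * d $ 1) / norm x)) (at x)"
    "\<And>y. y \<noteq> 0 \<Longrightarrow> cos (T y) = cos (ang y)" "\<And>y. y \<noteq> 0 \<Longrightarrow> sin (T y) = sin (ang y)"
    using local_angle[OF False] by blast
  have "isCont (\<lambda>y. norm y powr m * h (T y)) x"
    using False by (intro continuous_intros has_derivative_continuous[OF T(1)] isCont_o2[of x T h] continuous_on_interior[OF h(2)]) auto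
  moreover have "\<forall>\<^sub>F y in nhds x. polar m h y = norm y powr m * h (T y)"
    using t1_space_nhds[OF False]
    by eventually_elim (simp add: polar_def periodic2pi_cong[OF h(1) T(2,3)])
  ultimately show ?thesis by (simp only: isCont_cong)
next
  case True
  then have m: "m > 0" using assms(3) by simp
  obtain B where B: "\<And>x. \<bar>h (ang x)\<bar> \<le> B" using bounded_periodic[OF h] by blast
  have "((\<lambda>y. B * norm y powr m) \<longlongrightarrow> B * 0 powr m) (at 0)"
    by (intro tendsto_mult tendsto_const tendsto_powr' tendsto_norm_zero tendsto_ident_at) (use m in auto)
  then have lim: "((\<lambda>y::real^2. B * norm y powr m) \<longlongrightarrow> 0) (at 0)" using m by simp
  have "(polar m h \<longlongrightarrow> 0) (at 0)"
  proof (rule Lim_null_comparison[OF _ lim], rule always_eventually, rule allI)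
    fix y :: "real^2"
    show "norm (polar m h y) \<le> B * norm y powr m"
      using mult_right_mono[OF B[of y], of "norm y powr m"] by (simp add: polar_def abs_mult mult.commute)
  qed
  then show ?thesis using True by (simp add: isCont_def polar_def)
qed

text \<open>The polar form of the gradient, computed through the local branch of the angle. At the
  origin m > 1 forces derivative 0, and the right-hand side agrees because 0 \<open>powr\<close>
  anything is 0.\<close>

lemma polar_has_derivative:
  assumes h: "periodic2pi h" "\<And>t. (h has_real_derivative h' t) (at t)" and x: "x \<noteq> 0 \<or> m > 1"
  shows "(polar m h has_derivative (\<lambda>d.
     d $ 1 * polar (m - 1) (\<lambda>t. m * cos t * h t - sin t * h' t) x +
     d $ 2 * polar (m - 1) (\<lambda>t. m * sin t * h t + cos t * h' t) x)) (at x)"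
proof (cases "x = 0")
  case False
  obtain T where T: "(T has_derivative (\<lambda>d. (cos (ang x) * d $ 2 - sin (ang x) * d $ 1) / norm x)) (at x)"
    "T x = ang x" "\<And>y. y \<noteq> 0 \<Longrightarrow> cos (T y) = cos (ang y)" "\<And>y. y \<noteq> 0 \<Longrightarrow> sin (T y) = sin (ang y)"
    using local_angle[OF False] by blast
  define r where "r = norm x"
  have r: "r > 0" using False by (simp add: r_def)
  have hT: "((\<lambda>y. h (T y)) has_derivative (\<lambda>d. h' (ang x) * ((cos (ang x) * d $ 2 - sin (ang x) * d $ 1) / r))) (at x)"
    using has_derivative_compose[OF T(1), of h "(*) (h' (ang x))"] h(2)[of "ang x"]
    by (simp add: has_field_derivative_def T(2) r_def)
  have nd: "(norm has_derivative (\<lambda>d. cos (ang x) * d $ 1 + sin (ang x) * d $ 2)) (at x)"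
  proof -
    have "(\<lambda>d. d \<bullet> sgn x) = (\<lambda>d. cos (ang x) * d $ 1 + sin (ang x) * d $ 2)"
    proof -
      have c: "inverse (norm x) * x $ 1 = cos (ang x)" "inverse (norm x) * x $ 2 = sin (ang x)"
        using r norm_cos_ang[of x] norm_sin_ang[of x] unfolding r_def by (simp_all add: field_simps)
      show ?thesis
        by (simp add: fun_eq_iff sgn_div_norm inner_vec_def sum_2 c mult.commute)
    qed
    then show ?thesis using has_derivative_norm[OF False] by simp
  qed
  have np: "((\<lambda>y. norm y powr m) has_derivative (\<lambda>d. m * r powr (m - 1) * (cos (ang x) * d $ 1 + sin (ang x) * d $ 2))) (at x)"
    using has_derivative_compose[OF nd, of "\<lambda>r. r powr m" "(*) (m * r powr (m - 1))"] has_real_derivative_powr[OF r, of m]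
    by (simp add: has_field_derivative_def r_def)
  have "((\<lambda>y. norm y powr m * h (T y)) has_derivative (\<lambda>d.
     d $ 1 * polar (m - 1) (\<lambda>t. m * cos t * h t - sin t * h' t) x +
     d $ 2 * polar (m - 1) (\<lambda>t. m * sin t * h t + cos t * h' t) x)) (at x)"
  proof (rule has_derivative_eq_rhs[OF has_derivative_mult[OF np hT]], rule ext)
    fix d :: "real^2"
    have "r powr m = r * r powr (m - 1)" using r by (simp add: powr_mult_base)
    then have "r powr m * (h' (ang x) * ((cos (ang x) * d $ 2 - sin (ang x) * d $ 1) / r)) =
       r powr (m - 1) * (h' (ang x) * (cos (ang x) * d $ 2 - sin (ang x) * d $ 1))"
      using r by (simp add: field_simps)
    then show "norm x powr m * (h' (ang x) * ((cos (ang x) * d $ 2 - sin (ang x) * d $ 1) / r)) +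
        m * r powr (m - 1) * (cos (ang x) * d $ 1 + sin (ang x) * d $ 2) * h (T x) =
        d $ 1 * polar (m - 1) (\<lambda>t. m * cos t * h t - sin t * h' t) x +
        d $ 2 * polar (m - 1) (\<lambda>t. m * sin t * h t + cos t * h' t) x"
      by (simp add: polar_def T(2) r_def[symmetric] algebra_simps)
  qed
  then show ?thesis
  proof (rule has_derivative_transform_within_open[where s = "- {0}"])
    fix y :: "real^2" assume "y \<in> - {0}"
    then show "norm y powr m * h (T y) = polar m h y"
      using periodic2pi_cong[OF h(1) T(3,4)] by (simp add: polar_def)
  qed (use False in auto)
next
  case True
  then have m: "m > 1" using x by simp
  have "continuous_on UNIV h" using h(2) by (intro continuous_at_imp_continuous_on) (auto intro: DERIV_isCont)
  then obtain B where B: "\<And>x. \<bar>h (ang x)\<bar> \<le> B" using bounded_periodic[OF h(1)] by blast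
  have "((\<lambda>y. B * norm y powr (m - 1)) \<longlongrightarrow> B * 0 powr (m - 1)) (at 0)"
    by (intro tendsto_mult tendsto_const tendsto_powr' tendsto_norm_zero tendsto_ident_at) (use m in auto)
  then have lim: "((\<lambda>y::real^2. B * norm y powr (m - 1)) \<longlongrightarrow> 0) (at 0)" using m by simp
  have "(polar m h has_derivative (\<lambda>d. 0)) (at 0)"
    unfolding has_derivative_at
  proof (intro conjI bounded_linear_zero Lim_null_comparison[OF _ lim] always_eventually allI)
    fix y :: "real^2"
    have "\<bar>h (ang y)\<bar> * norm y powr (m - 1) \<le> B * norm y powr (m - 1)"
      using B[of y] by (intro mult_right_mono) auto
    then show "norm (norm (polar m h (0 + y) - polar m h 0 - 0) / norm y) \<le> B * norm y powr (m - 1)"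
      by (cases "y = 0") (auto simp: polar_def abs_mult powr_diff mult_ac)
  qed
  then show ?thesis using True by (simp add: polar_def)
qed

text \<open>The class is stable under multiplication by sine and cosine, the operations that the
  partial derivatives of \<open>polar\<close> perform on the angular factor.\<close>

primrec Ck_per :: "nat \<Rightarrow> (real \<Rightarrow> real) \<Rightarrow> bool" where
  "Ck_per 0 h \<longleftrightarrow> periodic2pi h \<and> continuous_on UNIV h"
| "Ck_per (Suc k) h \<longleftrightarrow> periodic2pi h \<and> (\<exists>h'. (\<forall>t. (h has_real_derivative h' t) (at t)) \<and> Ck_per k h')"

lemma Ck_per_periodic: "Ck_per k h \<Longrightarrow> periodic2pi h"
  by (cases k) auto

lemma Ck_per_SucI: "periodic2pi h \<Longrightarrow> (\<And>t. (h has_real_derivative h' t) (at t)) \<Longrightarrow> Ck_per k h' \<Longrightarrow> Ck_per (Suc k) h"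
  by auto

lemma Ck_per_mono: "Ck_per (Suc k) h \<Longrightarrow> Ck_per k h"
proof (induction k arbitrary: h)
  case 0
  then show ?case by (auto intro!: continuous_at_imp_continuous_on intro: DERIV_isCont)
next
  case (Suc k)
  then obtain h' where "\<And>t. (h has_real_derivative h' t) (at t)" "Ck_per (Suc k) h'"
    using Ck_per.simps(2)[of "Suc k" h] by blast
  with Suc show ?case using Ck_per.simps(2)[of "Suc k" h] by (intro Ck_per_SucI) blast+
qed

lemma Ck_per_const [intro]: "Ck_per k (\<lambda>_. c)"
proof (induction k arbitrary: c)
  case (Suc k)
  then show ?case by (intro Ck_per_SucI[where h' = "\<lambda>_. 0"]) auto
qed auto

lemma Ck_per_add [intro]: "Ck_per k g \<Longrightarrow> Ck_per k h \<Longrightarrow> Ck_per k (\<lambda>t. g t + h t)"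
proof (induction k arbitrary: g h)
  case (Suc k)
  from Suc.prems obtain g' h' where *: "\<And>t. (g has_real_derivative g' t) (at t)" "\<And>t. (h has_real_derivative h' t) (at t)" "Ck_per k g'" "Ck_per k h'"
    by auto
  show ?case
    by (rule Ck_per_SucI[OF _ DERIV_add[OF *(1,2)] Suc.IH[OF *(3,4)]]) (use Suc.prems in auto)
qed (auto intro!: continuous_intros)

lemma Ck_per_mult [intro]: "Ck_per k g \<Longrightarrow> Ck_per k h \<Longrightarrow> Ck_per k (\<lambda>t. g t * h t)"
proof (induction k arbitrary: g h)
  case (Suc k)
  from Suc.prems obtain g' h' where *: "\<And>t. (g has_real_derivative g' t) (at t)" "\<And>t. (h has_real_derivative h' t) (at t)" "Ck_per k g'" "Ck_per k h'"
    by auto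
  show ?case
    by (rule Ck_per_SucI[OF _ DERIV_mult[OF *(1,2)] Ck_per_add[OF Suc.IH Suc.IH]])
       (use * Suc.prems Ck_per_mono[OF Suc.prems(1)] Ck_per_mono[OF Suc.prems(2)] in auto)
qed (auto intro!: continuous_intros)

lemma Ck_per_minus [intro]: "Ck_per k g \<Longrightarrow> Ck_per k (\<lambda>t. - g t)"
  using Ck_per_mult[OF Ck_per_const[of k "- 1"], of g] by simp

lemma Ck_per_diff [intro]: "Ck_per k g \<Longrightarrow> Ck_per k h \<Longrightarrow> Ck_per k (\<lambda>t. g t - h t)"
  using Ck_per_add[OF _ Ck_per_minus, of k g h] by simp

lemma Ck_per_sin_cos: "Ck_per k sin \<and> Ck_per k cos"
proof (induction k)
  case (Suc k)
  have "Ck_per k (\<lambda>t. - sin t)" using Suc by auto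
  with Suc show ?case
    by (intro conjI Ck_per_SucI[of sin cos k] Ck_per_SucI[of cos "\<lambda>t. - sin t" k])
       (auto intro!: derivative_eq_intros)
qed (auto intro: continuous_intros)

lemmas Ck_per_sin [intro] = Ck_per_sin_cos[THEN conjunct1]
  and Ck_per_cos [intro] = Ck_per_sin_cos[THEN conjunct2]

lemma partial_deriv_eqI: "(f has_derivative f') (at x) \<Longrightarrow> partial_deriv i f x = f' (axis i 1)"
  unfolding partial_deriv_def using frechet_derivative_at[of f f' x] by simp

lemma partial_deriv_polar:
  assumes "periodic2pi h" "\<And>t. (h has_real_derivative h' t) (at t)" "x \<noteq> 0 \<or> m > 1"
  shows "partial_deriv 1 (polar m h) x = polar (m - 1) (\<lambda>t. m * cos t * h t - sin t * h' t) x"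
    and "partial_deriv 2 (polar m h) x = polar (m - 1) (\<lambda>t. m * sin t * h t + cos t * h' t) x"
  by (simp_all add: partial_deriv_eqI[OF polar_has_derivative[OF assms]] axis_def)

lemma Ck_on_cong:
  assumes "open D" "\<And>x. x \<in> D \<Longrightarrow> f x = g x" "Ck_on k D f"
  shows "Ck_on k D g"
  using assms
proof (induction k arbitrary: f g)
  case 0
  then show ?case using continuous_on_cong[of D D f g] by simp
next
  case (Suc k)
  have df: "f differentiable (at x)" if "x \<in> D" for x using Suc.prems that by simp
  have "(g has_derivative frechet_derivative f (at x)) (at x)" if "x \<in> D" for x
    by (rule has_derivative_transform_within_open[OF df[OF that, unfolded frechet_derivative_works] Suc.prems(1) that Suc.prems(2)])
  then have *: "g differentiable (at x)" "partial_deriv i g x = partial_deriv i f x" if "x \<in> D" for x i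
    using that partial_deriv_eqI[of g] by (auto simp: differentiable_def partial_deriv_def)
  have "Ck_on k D (partial_deriv i g)" for i
    by (rule Suc.IH[of "partial_deriv i f"]) (use Suc.prems * in auto)
  then show ?case using * by simp
qed

text \<open>Each partial derivative lowers both the degree and the class by one, so the origin can
  be included as long as the degree exceeds k.\<close>

lemma Ck_on_polar:
  fixes m :: real
  assumes "open D" "Ck_per k h" "0 \<in> D \<Longrightarrow> m > k"
  shows "Ck_on k D (polar m h)"
  using assms(2,3)
proof (induction k arbitrary: h m)
  case 0
  then show ?case by (auto intro!: continuous_at_imp_continuous_on isCont_polar)
next
  case (Suc k)
  from Suc.prems obtain h' where h: "periodic2pi h" "\<And>t. (h has_real_derivative h' t) (at t)" and h': "Ck_per k h'"
    by auto
  have x: "x \<noteq> 0 \<or> m > 1" if "x \<in> D" for x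
    using Suc.prems(2) that by (cases "x = 0") auto
  have hk: "Ck_per k h" by (rule Ck_per_mono[OF Suc.prems(1)])
  have "Ck_on k D (polar (m - 1) (\<lambda>t. m * cos t * h t - sin t * h' t))"
    using hk h' Suc.prems(2) by (intro Suc.IH Ck_per_diff Ck_per_mult Ck_per_const Ck_per_sin Ck_per_cos) auto
  then have 1: "Ck_on k D (partial_deriv 1 (polar m h))"
    by (rule Ck_on_cong[OF assms(1), rotated]) (rule partial_deriv_polar(1)[OF h x, symmetric])
  have "Ck_on k D (polar (m - 1) (\<lambda>t. m * sin t * h t + cos t * h' t))"
    using hk h' Suc.prems(2) by (intro Suc.IH Ck_per_add Ck_per_mult Ck_per_const Ck_per_sin Ck_per_cos) auto
  then have 2: "Ck_on k D (partial_deriv 2 (polar m h))"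
    by (rule Ck_on_cong[OF assms(1), rotated]) (rule partial_deriv_polar(2)[OF h x, symmetric])
  show ?case
    using 1 2 polar_has_derivative[OF h x] by (auto simp: forall_2 differentiable_def)
qed

lemma has_derivative_scaleR_pair:
  fixes F G :: "real^2 \<Rightarrow> real" and c d :: "'b::real_normed_vector"
  assumes "F differentiable (at x)" "G differentiable (at x)"
  shows "((\<lambda>x. F x *\<^sub>R c + G x *\<^sub>R d) has_derivative
     (\<lambda>v. frechet_derivative F (at x) v *\<^sub>R c + frechet_derivative G (at x) v *\<^sub>R d)) (at x)"
  using assms unfolding frechet_derivative_works
  by (intro has_derivative_add has_derivative_scaleR_left)

lemma partial_deriv_scaleR_pair:
  assumes "F differentiable (at x)" "G differentiable (at x)"
  shows "partial_deriv i (\<lambda>x. F x *\<^sub>R c + G x *\<^sub>R d) x = partial_deriv i F x *\<^sub>R c + partial_deriv i G x *\<^sub>R d"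
  using partial_deriv_eqI[OF has_derivative_scaleR_pair[OF assms, of c d], of i] by (simp add: partial_deriv_def)

lemma Ck_on_scaleR_pair:
  assumes "open D" "Ck_on k D F" "Ck_on k D G"
  shows "Ck_on k D (\<lambda>x. F x *\<^sub>R c + G x *\<^sub>R d)"
  using assms(2,3)
proof (induction k arbitrary: F G)
  case 0
  then show ?case by (auto intro!: continuous_intros)
next
  case (Suc k)
  have "Ck_on k D (partial_deriv i (\<lambda>x. F x *\<^sub>R c + G x *\<^sub>R d))" for i
    by (rule Ck_on_cong[OF assms(1) _ Suc.IH[of "partial_deriv i F" "partial_deriv i G"]])
       (use Suc.prems in \<open>auto simp: partial_deriv_scaleR_pair\<close>)
  moreover have "(\<lambda>x. F x *\<^sub>R c + G x *\<^sub>R d) differentiable (at x)" if "x \<in> D" for x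
    using Suc.prems that differentiableI[OF has_derivative_scaleR_pair] by simp
  ultimately show ?case by simp
qed

subsection \<open>Existence\<close>

text \<open>Pointwise algebra with c, s for cosine and sine and f, g for the stream profile and its
  slope; \<open>F2\<close> is f'' as given by the profile equation. The conclusions are the two
  momentum equations, incompressibility, transport of density, the vorticity and the Bernoulli
  identity. Each reduces to the radial velocity -g, the angular velocity (1 - \<alpha>) f, or the
  relation between R and E f.\<close>

lemma polar_flow_identities:
  fixes c s f g E R \<alpha> :: real
  defines "F2 \<equiv> - (1 - \<alpha>)\<^sup>2 * f - s * E"
  defines "h1 \<equiv> - c * g - (1 - \<alpha>) * s * f" and "h2 \<equiv> - s * g + (1 - \<alpha>) * c * f"
    and "P \<equiv> - (g\<^sup>2 + (1 - \<alpha>)\<^sup>2 * f\<^sup>2) / 2 - s * R" and "P' \<equiv> - c * R"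
  defines "h1' \<equiv> s * g - c * F2 - (1 - \<alpha>) * (c * f + s * g)"
    and "h2' \<equiv> - c * g - s * F2 + (1 - \<alpha>) * (- s * f + c * g)"
  assumes cs: "c * c + s * s = 1" and R: "(2 * \<alpha> + 1) * R = (\<alpha> - 1) * (E * f)"
  shows "h1 * (- \<alpha> * c * h1 - s * h1') + h2 * (- \<alpha> * s * h1 + c * h1') + (- 2 * \<alpha> * c * P - s * P') = 0"
    and "h1 * (- \<alpha> * c * h2 - s * h2') + h2 * (- \<alpha> * s * h2 + c * h2') + (- 2 * \<alpha> * s * P + c * P') = - R"
    and "(- \<alpha> * c * h1 - s * h1') + (- \<alpha> * s * h2 + c * h2') = 0"
    and "h1 * ((- 2 * \<alpha> - 1) * c * R - s * (E * g)) + h2 * ((- 2 * \<alpha> - 1) * s * R + c * (E * g)) = 0"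
    and "(- \<alpha> * c * h2 - s * h2') - (- \<alpha> * s * h1 + c * h1') = - s * E"
    and "P + (h1\<^sup>2 + h2\<^sup>2) / 2 + s * R = 0"
proof -
  have N: "c * h1 + s * h2 = - g"
  proof -
    have "c * h1 + s * h2 = - g * (c * c + s * s)" unfolding h1_def h2_def by (simp add: algebra_simps)
    then show ?thesis by (simp add: cs)
  qed
  have T: "- s * h1 + c * h2 = (1 - \<alpha>) * f"
  proof -
    have "- s * h1 + c * h2 = (1 - \<alpha>) * f * (c * c + s * s)" unfolding h1_def h2_def by (simp add: algebra_simps)
    then show ?thesis by (simp add: cs)
  qed
  have "(- \<alpha> * c * h1 - s * h1') + (- \<alpha> * s * h2 + c * h2') =
      - \<alpha> * (c * h1 + s * h2) - \<alpha> * g * (c * c + s * s)"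
    unfolding h1'_def h2'_def by (simp add: algebra_simps)
  then show "(- \<alpha> * c * h1 - s * h1') + (- \<alpha> * s * h2 + c * h2') = 0"
    by (simp add: cs N)
  have "(- \<alpha> * c * h2 - s * h2') - (- \<alpha> * s * h1 + c * h1') =
      - \<alpha> * (- s * h1 + c * h2) + (F2 + (1 - \<alpha>) * f) * (c * c + s * s)"
    unfolding h1'_def h2'_def by (simp add: algebra_simps)
  also have "\<dots> = - s * E"
    unfolding cs T F2_def by (simp add: algebra_simps power2_eq_square)
  finally show "(- \<alpha> * c * h2 - s * h2') - (- \<alpha> * s * h1 + c * h1') = - s * E" .
  have "h1\<^sup>2 + h2\<^sup>2 = (g\<^sup>2 + (1 - \<alpha>)\<^sup>2 * f\<^sup>2) * (c * c + s * s)"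
    unfolding h1_def h2_def by (simp add: algebra_simps power2_eq_square)
  then show "P + (h1\<^sup>2 + h2\<^sup>2) / 2 + s * R = 0"
    by (simp add: P_def cs field_simps)
  have "h1 * ((- 2 * \<alpha> - 1) * c * R - s * (E * g)) + h2 * ((- 2 * \<alpha> - 1) * s * R + c * (E * g)) =
      (- 2 * \<alpha> - 1) * R * (c * h1 + s * h2) + E * g * (- s * h1 + c * h2)"
    by (simp add: algebra_simps)
  also have "\<dots> = g * ((2 * \<alpha> + 1) * R - (\<alpha> - 1) * (E * f))"
    unfolding N T by (simp add: algebra_simps)
  finally show "h1 * ((- 2 * \<alpha> - 1) * c * R - s * (E * g)) + h2 * ((- 2 * \<alpha> - 1) * s * R + c * (E * g)) = 0"
    by (simp add: R)
  have "h1 * (- \<alpha> * c * h1 - s * h1') + h2 * (- \<alpha> * s * h1 + c * h1') + (- 2 * \<alpha> * c * P - s * P') =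
      - \<alpha> * h1 * (c * h1 + s * h2) + h1' * (- s * h1 + c * h2) + (- 2 * \<alpha> * c * P - s * P')"
    by (simp add: algebra_simps)
  also have "\<dots> = c * s * ((2 * \<alpha> + 1) * R - (\<alpha> - 1) * (E * f))"
    unfolding N T unfolding h1_def h1'_def P_def P'_def F2_def by (simp add: field_simps power2_eq_square)
  finally show "h1 * (- \<alpha> * c * h1 - s * h1') + h2 * (- \<alpha> * s * h1 + c * h1') + (- 2 * \<alpha> * c * P - s * P') = 0"
    by (simp add: R)
  have "h1 * (- \<alpha> * c * h2 - s * h2') + h2 * (- \<alpha> * s * h2 + c * h2') + (- 2 * \<alpha> * s * P + c * P') =
      - \<alpha> * h2 * (c * h1 + s * h2) + h2' * (- s * h1 + c * h2) + (- 2 * \<alpha> * s * P + c * P')"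
    by (simp add: algebra_simps)
  also have "\<dots> = s * s * ((2 * \<alpha> + 1) * R - (\<alpha> - 1) * (E * f)) - (c * c + s * s) * R"
    unfolding N T unfolding h2_def h2'_def P_def P'_def F2_def by (simp add: field_simps power2_eq_square)
  finally show "h1 * (- \<alpha> * c * h2 - s * h2') + h2 * (- \<alpha> * s * h2 + c * h2') + (- 2 * \<alpha> * s * P + c * P') = - R"
    by (simp add: R cs)
qed

lemma polar_homogeneous: "periodic2pi h \<Longrightarrow> x \<noteq> 0 \<Longrightarrow> polar m h x = norm x powr m * polar m h (x /\<^sub>R norm x)"
  using norm_cos_ang[of x] norm_sin_ang[of x]
  by (subst polar_eq[of h "x /\<^sub>R norm x" "ang x"]) (auto simp: polar_def field_simps)

lemma polar_reflect2:
  assumes "periodic2pi h" "\<And>t. h (- t) = c * h t"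
  shows "polar m h (reflect2 x) = c * polar m h x"
proof -
  have "norm (reflect2 x) = norm x" by (simp add: norm_real2 reflect2_def)
  then show ?thesis
    using norm_cos_ang[of x] norm_sin_ang[of x] assms
    by (subst polar_eq[of h "reflect2 x" "- ang x"]) (auto simp: polar_def reflect2_def)
qed

text \<open>The velocity is the perpendicular gradient of r^(1 - \<alpha>) f, so its vorticity on
  the unit circle is - sin E. The pressure is defined by making the Bernoulli function 0, and the
  profile equation then gives P' = - cos R.\<close>

lemma homogeneous_boussinesqI:
  fixes \<alpha> :: real
  assumes D: "open D" "- {0} \<subseteq> D" "k \<ge> 1" "0 \<in> D \<Longrightarrow> - \<alpha> > k"
    and f: "\<And>t. (f has_real_derivative f' t) (at t)"
    and f': "\<And>t. (f' has_real_derivative (- (1 - \<alpha>)\<^sup>2 * f t - sin t * E t)) (at t)"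
    and R: "\<And>t. (R has_real_derivative E t * f' t) (at t)"
    and RE: "\<And>t. (2 * \<alpha> + 1) * R t = (\<alpha> - 1) * (E t * f t)"
    and smooth: "Ck_per k f" "Ck_per k f'" "Ck_per k R"
    and odd: "\<And>t. f (- t) = - f t" "\<And>t. R (- t) = - R t"
    and E: "periodic2pi E" and rot: "\<exists>t. sin t * E t \<noteq> 0"
  shows "\<exists>u p \<rho>. homogeneous_boussinesq k D \<alpha> u p \<rho>"
proof -
  have f'_even: "f' (- t) = f' t" for t
  proof -
    have "((\<lambda>t. f (- t)) has_real_derivative - f' (- t)) (at t)"
      using DERIV_chain2[OF f DERIV_minus[OF DERIV_ident], of t UNIV] by simp
    moreover have "((\<lambda>t. f (- t)) has_real_derivative - f' t) (at t)"
      unfolding odd by (auto intro!: derivative_eq_intros f)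
    ultimately show ?thesis using DERIV_unique by fastforce
  qed
  define F2 where "F2 t = - (1 - \<alpha>)\<^sup>2 * f t - sin t * E t" for t
  define h1 where "h1 t = - cos t * f' t - (1 - \<alpha>) * sin t * f t" for t
  define h2 where "h2 t = - sin t * f' t + (1 - \<alpha>) * cos t * f t" for t
  define P where "P t = - ((f' t)\<^sup>2 + (1 - \<alpha>)\<^sup>2 * (f t)\<^sup>2) / 2 - sin t * R t" for t
  define h1' where "h1' t = sin t * f' t - cos t * F2 t - (1 - \<alpha>) * (cos t * f t + sin t * f' t)" for t
  define h2' where "h2' t = - cos t * f' t - sin t * F2 t + (1 - \<alpha>) * (- sin t * f t + cos t * f' t)" for t
  define P' where "P' t = - cos t * R t" for t
  have d1: "(h1 has_real_derivative h1' t) (at t)" for t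
    unfolding h1_def[abs_def] h1'_def F2_def
    by (auto intro!: derivative_eq_intros f f' simp: algebra_simps)
  have d2: "(h2 has_real_derivative h2' t) (at t)" for t
    unfolding h2_def[abs_def] h2'_def F2_def
    by (auto intro!: derivative_eq_intros f f' simp: algebra_simps)
  have dP: "(P has_real_derivative P' t) (at t)" for t
    unfolding P_def[abs_def] P'_def
    by (auto intro!: derivative_eq_intros f f' R simp: algebra_simps power2_eq_square)
  note Ck_per_intros = Ck_per_add Ck_per_diff Ck_per_mult Ck_per_minus Ck_per_const Ck_per_sin Ck_per_cos smooth
  have s1: "Ck_per k h1" and s2: "Ck_per k h2"
    unfolding h1_def[abs_def] h2_def[abs_def] by (intro Ck_per_intros)+
  have sP: "Ck_per k P"
    unfolding P_def[abs_def] power2_eq_square divide_inverse by (intro Ck_per_intros)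
  note per = Ck_per_periodic[OF s1] Ck_per_periodic[OF s2] Ck_per_periodic[OF sP] Ck_per_periodic[OF smooth(3)]
  define u :: "real^2 \<Rightarrow> real^2" where
    "u = (\<lambda>x. polar (- \<alpha>) h1 x *\<^sub>R axis 1 1 + polar (- \<alpha>) h2 x *\<^sub>R axis 2 1)"
  define p where "p = polar (- 2 * \<alpha>) P"
  define \<rho> where "\<rho> = polar (- 2 * \<alpha> - 1) R"
  have u1: "(\<lambda>x. u x $ 1) = polar (- \<alpha>) h1" and u2: "(\<lambda>x. u x $ 2) = polar (- \<alpha>) h2"
    by (simp_all add: u_def axis_def fun_eq_iff)
  note u12 = u1[THEN fun_cong] u2[THEN fun_cong]
  have k1: "real k \<ge> 1" using D(3) by simp
  \<comment> \<open>If the origin belongs to \<open>D\<close>, then -\<alpha> > 1, so the velocity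
    has the lowest degree of the three fields and its bound implies the other two.\<close>
  have m: "0 \<in> D \<Longrightarrow> - 2 * \<alpha> > k" "0 \<in> D \<Longrightarrow> - 2 * \<alpha> - 1 > k"
    using D(4) k1 by auto
  have Ck: "Ck_on k D u" "Ck_on k D p" "Ck_on k D \<rho>"
    unfolding u_def p_def \<rho>_def
    by (intro Ck_on_scaleR_pair Ck_on_polar s1 s2 sP smooth D m; assumption)+
  have bern: "bernoulli u p \<rho> x = 0" for x
  proof -
    have "(norm (u x))\<^sup>2 = (u x $ 1)\<^sup>2 + (u x $ 2)\<^sup>2"
      unfolding norm_real2 by simp
    also have "\<dots> = norm x powr (- 2 * \<alpha>) * ((h1 (ang x))\<^sup>2 + (h2 (ang x))\<^sup>2)"
      by (simp add: u12 polar_def power_mult_distrib power2_eq_square[of "norm x powr _"] distrib_left flip: powr_add)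
    finally have "(norm (u x))\<^sup>2 = norm x powr (- 2 * \<alpha>) * ((h1 (ang x))\<^sup>2 + (h2 (ang x))\<^sup>2)" .
    moreover have "x $ 2 * \<rho> x = norm x powr (- 2 * \<alpha>) * (sin (ang x) * R (ang x))"
      using powr_mult_base[of "norm x" "- 2 * \<alpha> - 1"]
      by (simp add: \<rho>_def polar_def norm_sin_ang[symmetric, of x])
    ultimately have "bernoulli u p \<rho> x = norm x powr (- 2 * \<alpha>) *
       (P (ang x) + ((h1 (ang x))\<^sup>2 + (h2 (ang x))\<^sup>2) / 2 + sin (ang x) * R (ang x))"
      by (simp add: bernoulli_def p_def polar_def algebra_simps)
    also have "P (ang x) + ((h1 (ang x))\<^sup>2 + (h2 (ang x))\<^sup>2) / 2 + sin (ang x) * R (ang x) = 0"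
      unfolding P_def h1_def h2_def
      by (rule polar_flow_identities(6)[of "cos (ang x)" "sin (ang x)", OF sin_cos_squared_add3 RE])
    finally show ?thesis by simp
  qed
  have pd: "partial_deriv 1 (polar (- \<alpha>) h1) x = polar (- \<alpha> - 1) (\<lambda>t. - \<alpha> * cos t * h1 t - sin t * h1' t) x"
    "partial_deriv 2 (polar (- \<alpha>) h1) x = polar (- \<alpha> - 1) (\<lambda>t. - \<alpha> * sin t * h1 t + cos t * h1' t) x"
    "partial_deriv 1 (polar (- \<alpha>) h2) x = polar (- \<alpha> - 1) (\<lambda>t. - \<alpha> * cos t * h2 t - sin t * h2' t) x"
    "partial_deriv 2 (polar (- \<alpha>) h2) x = polar (- \<alpha> - 1) (\<lambda>t. - \<alpha> * sin t * h2 t + cos t * h2' t) x"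
    "partial_deriv 1 p x = polar (- 2 * \<alpha> - 1) (\<lambda>t. - 2 * \<alpha> * cos t * P t - sin t * P' t) x"
    "partial_deriv 2 p x = polar (- 2 * \<alpha> - 1) (\<lambda>t. - 2 * \<alpha> * sin t * P t + cos t * P' t) x"
    "partial_deriv 1 \<rho> x = polar (- 2 * \<alpha> - 1 - 1) (\<lambda>t. (- 2 * \<alpha> - 1) * cos t * R t - sin t * (E t * f' t)) x"
    "partial_deriv 2 \<rho> x = polar (- 2 * \<alpha> - 1 - 1) (\<lambda>t. (- 2 * \<alpha> - 1) * sin t * R t + cos t * (E t * f' t)) x"
    and pu: "partial_deriv i u x = partial_deriv i (polar (- \<alpha>) h1) x *\<^sub>R axis 1 1 + partial_deriv i (polar (- \<alpha>) h2) x *\<^sub>R axis 2 1"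
    if "x \<in> D" for x i
  proof -
    have x: "x \<noteq> 0 \<or> - \<alpha> > 1" "x \<noteq> 0 \<or> - 2 * \<alpha> > 1" "x \<noteq> 0 \<or> - 2 * \<alpha> - 1 > 1"
      using that D(4) m k1 by (cases "x = 0"; force)+
    note pd1 = partial_deriv_polar[OF per(1) d1 x(1)] and pd2 = partial_deriv_polar[OF per(2) d2 x(1)]
      and pdP = partial_deriv_polar[OF per(3) dP x(2)] and pdR = partial_deriv_polar[OF per(4) R x(3)]
    show "partial_deriv 1 (polar (- \<alpha>) h1) x = polar (- \<alpha> - 1) (\<lambda>t. - \<alpha> * cos t * h1 t - sin t * h1' t) x"
      "partial_deriv 2 (polar (- \<alpha>) h1) x = polar (- \<alpha> - 1) (\<lambda>t. - \<alpha> * sin t * h1 t + cos t * h1' t) x"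
      "partial_deriv 1 (polar (- \<alpha>) h2) x = polar (- \<alpha> - 1) (\<lambda>t. - \<alpha> * cos t * h2 t - sin t * h2' t) x"
      "partial_deriv 2 (polar (- \<alpha>) h2) x = polar (- \<alpha> - 1) (\<lambda>t. - \<alpha> * sin t * h2 t + cos t * h2' t) x"
      "partial_deriv 1 p x = polar (- 2 * \<alpha> - 1) (\<lambda>t. - 2 * \<alpha> * cos t * P t - sin t * P' t) x"
      "partial_deriv 2 p x = polar (- 2 * \<alpha> - 1) (\<lambda>t. - 2 * \<alpha> * sin t * P t + cos t * P' t) x"
      "partial_deriv 1 \<rho> x = polar (- 2 * \<alpha> - 1 - 1) (\<lambda>t. (- 2 * \<alpha> - 1) * cos t * R t - sin t * (E t * f' t)) x"
      "partial_deriv 2 \<rho> x = polar (- 2 * \<alpha> - 1 - 1) (\<lambda>t. (- 2 * \<alpha> - 1) * sin t * R t + cos t * (E t * f' t)) x"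
      unfolding p_def \<rho>_def by (rule pd1 pd2 pdP pdR)+
    show "partial_deriv i u x = partial_deriv i (polar (- \<alpha>) h1) x *\<^sub>R axis 1 1 + partial_deriv i (polar (- \<alpha>) h2) x *\<^sub>R axis 2 1"
      unfolding u_def
      by (rule partial_deriv_scaleR_pair) (auto simp: differentiable_def intro!: exI polar_has_derivative per d1 d2 x)
  qed
  have eqs: "boussinesq_on D u p \<rho>"
    unfolding boussinesq_on_def
  proof (intro ballI conjI)
    fix x assume x: "x \<in> D"
    define r t where "r = norm x" and "t = ang x"
    note ids = polar_flow_identities[where c = "cos t" and s = "sin t" and f = "f t" and g = "f' t" and E = "E t", OF sin_cos_squared_add3 RE,
        folded F2_def, folded h1_def h2_def h1'_def h2'_def P_def P'_def]
    define A B C where "A = r powr (- \<alpha>)" and "B = r powr (- \<alpha> - 1)" and "C = r powr (- 2 * \<alpha> - 1 - 1)"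
    have rc: "r powr (- 2 * \<alpha> - 1) = A * B" unfolding A_def B_def by (simp flip: powr_add)
    note ev1 = u12 pd[OF x] u1 u2 and ev2 = polar_def r_def[symmetric] t_def[symmetric] rc A_def[symmetric] B_def[symmetric] C_def[symmetric]
    show "(\<Sum>i\<in>UNIV. u x $ i *\<^sub>R partial_deriv i u x) + (\<chi> i. partial_deriv i p x) = - (\<rho> x *\<^sub>R axis 2 1)"
    proof -
      have "u x $ 1 * partial_deriv 1 (polar (- \<alpha>) h1) x + u x $ 2 * partial_deriv 2 (polar (- \<alpha>) h1) x + partial_deriv 1 p x =
         r powr (- 2 * \<alpha> - 1) * (h1 t * (- \<alpha> * cos t * h1 t - sin t * h1' t) + h2 t * (- \<alpha> * sin t * h1 t + cos t * h1' t) + (- 2 * \<alpha> * cos t * P t - sin t * P' t))"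
        unfolding ev1 unfolding ev2 by (simp add: algebra_simps)
      then have 1: "u x $ 1 * partial_deriv 1 (polar (- \<alpha>) h1) x + u x $ 2 * partial_deriv 2 (polar (- \<alpha>) h1) x + partial_deriv 1 p x = 0"
        unfolding ids by simp
      have "u x $ 1 * partial_deriv 1 (polar (- \<alpha>) h2) x + u x $ 2 * partial_deriv 2 (polar (- \<alpha>) h2) x + partial_deriv 2 p x =
         r powr (- 2 * \<alpha> - 1) * (h1 t * (- \<alpha> * cos t * h2 t - sin t * h2' t) + h2 t * (- \<alpha> * sin t * h2 t + cos t * h2' t) + (- 2 * \<alpha> * sin t * P t + cos t * P' t))"
        unfolding ev1 unfolding ev2 by (simp add: algebra_simps)
      then have 2: "u x $ 1 * partial_deriv 1 (polar (- \<alpha>) h2) x + u x $ 2 * partial_deriv 2 (polar (- \<alpha>) h2) x + partial_deriv 2 p x = - \<rho> x"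
        unfolding ids by (simp add: \<rho>_def polar_def r_def t_def)
      show ?thesis
        using 1 2 by (simp add: vec_eq_iff forall_2 sum_2 pu[OF x] axis_def)
    qed
    show "(\<Sum>i\<in>UNIV. partial_deriv i (\<lambda>y. u y $ i) x) = 0"
    proof -
      have "(\<Sum>i\<in>UNIV. partial_deriv i (\<lambda>y. u y $ i) x) = B * ((- \<alpha> * cos t * h1 t - sin t * h1' t) + (- \<alpha> * sin t * h2 t + cos t * h2' t))"
        unfolding sum_2 ev1 unfolding ev2 by (simp add: algebra_simps)
      then show ?thesis unfolding ids by simp
    qed
    show "(\<Sum>i\<in>UNIV. u x $ i * partial_deriv i \<rho> x) = 0"
    proof -
      have "(\<Sum>i\<in>UNIV. u x $ i * partial_deriv i \<rho> x) = (A * C) *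
         (h1 t * ((- 2 * \<alpha> - 1) * cos t * R t - sin t * (E t * f' t)) + h2 t * ((- 2 * \<alpha> - 1) * sin t * R t + cos t * (E t * f' t)))"
        unfolding sum_2 ev1 unfolding ev2 by (simp add: algebra_simps)
      then show ?thesis unfolding ids by simp
    qed
  qed
  have hom: "homogeneous_sol \<alpha> u p \<rho>"
    unfolding homogeneous_sol_def
  proof (intro allI impI conjI)
    fix x :: "real^2" assume x: "x \<noteq> 0"
    show "u x = norm x powr - \<alpha> *\<^sub>R u (x /\<^sub>R norm x)"
      using polar_homogeneous[OF per(1) x, of "- \<alpha>"] polar_homogeneous[OF per(2) x, of "- \<alpha>"]
      by (simp add: u_def scaleR_right_distrib)
    show "p x = norm x powr (- 2 * \<alpha>) * p (x /\<^sub>R norm x)"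
      unfolding p_def by (rule polar_homogeneous[OF per(3) x])
    show "\<rho> x = norm x powr (- 2 * \<alpha> - 1) * \<rho> (x /\<^sub>R norm x)"
      unfolding \<rho>_def by (rule polar_homogeneous[OF per(4) x])
  qed
  have sym: "x2_symmetric_on D u p \<rho>"
  proof -
    have "polar (- \<alpha>) h1 (reflect2 x) = 1 * polar (- \<alpha>) h1 x" for x
      by (rule polar_reflect2[OF per(1)]) (simp add: h1_def odd f'_even)
    moreover have "polar (- \<alpha>) h2 (reflect2 x) = (- 1) * polar (- \<alpha>) h2 x" for x
      by (rule polar_reflect2[OF per(2)]) (simp add: h2_def odd f'_even)
    moreover have "p (reflect2 x) = 1 * p x" for x unfolding p_def
      by (rule polar_reflect2[OF per(3)]) (simp add: P_def odd f'_even)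
    moreover have "\<rho> (reflect2 x) = (- 1) * \<rho> x" for x unfolding \<rho>_def
      by (rule polar_reflect2[OF per(4)]) (simp add: odd)
    ultimately show ?thesis unfolding x2_symmetric_on_def u12 by simp
  qed
  have rota: "rotational_on D u"
  proof -
    obtain t where t: "sin t * E t \<noteq> 0" using rot by blast
    define x :: "real^2" where "x = vector [cos t, sin t]"
    have x1: "norm x = 1" by (simp add: x_def norm_real2)
    then have xD: "x \<in> D" using D(2) by fastforce
    have cs: "cos (ang x) = cos t" "sin (ang x) = sin t"
      using norm_cos_ang[of x] norm_sin_ang[of x] x1 by (simp_all add: x_def)
    then have Et: "E (ang x) = E t" by (rule periodic2pi_cong[OF E])
    have "vorticity u x = (- \<alpha> * cos (ang x) * h2 (ang x) - sin (ang x) * h2' (ang x)) - (- \<alpha> * sin (ang x) * h1 (ang x) + cos (ang x) * h1' (ang x))"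
      unfolding vorticity_def u1 u2 pd[OF xD] polar_def x1 by simp
    also have "\<dots> = - sin (ang x) * E (ang x)"
      unfolding h1_def h2_def h1'_def h2'_def F2_def
      by (rule polar_flow_identities(5)[OF sin_cos_squared_add3 RE])
    finally have "vorticity u x = - sin t * E t" by (simp only: cs Et)
    then show ?thesis using t xD unfolding rotational_on_def by (intro bexI[of _ x]) auto
  qed
  have "homogeneous_boussinesq k D \<alpha> u p \<rho>"
    unfolding homogeneous_boussinesq_def using Ck eqs hom sym rota bern by blast
  then show ?thesis by blast
qed

lemma periodic_DERIV:
  assumes "periodic2pi f" and f: "\<And>t. (f has_real_derivative f' t) (at t)"
  shows "periodic2pi f'"
proof
  fix t
  have "((\<lambda>t. f (t + 2 * pi)) has_real_derivative f' (t + 2 * pi)) (at t)"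
    using f[of "t + 2 * pi"] by (simp add: DERIV_shift)
  then have "(f has_real_derivative f' (t + 2 * pi)) (at t)" using assms(1) by simp
  then show "f' (t + 2 * pi) = f' t" using DERIV_unique[OF _ f] by blast
qed

lemma homogeneous_solution_exists:
  fixes \<alpha> :: real
  assumes \<alpha>: "\<alpha> > 1 \<or> \<alpha> < - 2"
    and D: "open D" "- {0} \<subseteq> D" "0 \<in> D \<Longrightarrow> - \<alpha> > k"
    and k: "k = Suc 0 \<or> (k = Suc (Suc 0) \<and> \<alpha> > 1)"
  shows "\<exists>u p \<rho>. homogeneous_boussinesq k D \<alpha> u p \<rho>"
proof -
  define b q where "b = \<bar>1 - \<alpha>\<bar>" and "q = (\<alpha> + 2) / (\<alpha> - 1)"
  have b: "b > 0" and q: "q > 0" using \<alpha> by (auto simp: b_def q_def zero_less_divide_iff)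
  have q1: "q > 1" if "\<alpha> > 1" using that by (simp add: q_def)
  have b2: "b\<^sup>2 = (1 - \<alpha>)\<^sup>2" by (simp add: b_def)
  obtain f f' E C where f: "\<And>x. (f has_real_derivative f' x) (at x)"
    and f': "\<And>x. (f' has_real_derivative (- b\<^sup>2 * f x - sin x * E x)) (at x)"
    and Ec: "continuous_on UNIV E"
    and sym: "\<And>x. f (- x) = - f x" "\<And>x. E (- x) = E x"
    and per: "\<And>x. f (x + 2 * pi) = f x" "\<And>x. E (x + 2 * pi) = E x"
    and bd: "\<And>x. \<bar>E x\<bar> \<le> C * \<bar>f x\<bar> powr q"
    and loc: "\<And>x. f x \<noteq> 0 \<Longrightarrow> \<exists>\<kappa>. \<forall>\<^sub>F y in nhds x. E y = \<kappa> * \<bar>f y\<bar> powr q"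
    and rot: "\<exists>x. sin x * E x \<noteq> 0"
    by (rule angular_profile[OF b q]) blast
  define R where "R = (\<lambda>x. E x * f x / (q + 1))"
  have f'c: "continuous_on UNIV f'"
    using f' by (intro continuous_at_imp_continuous_on) (auto intro: DERIV_isCont)
  note pr = profile_DERIV[OF f f'c Ec bd loc q]
  have dR: "(R has_real_derivative E x * f' x) (at x)" for x unfolding R_def by (rule pr(1))
  have perf: "periodic2pi f" and perE: "periodic2pi E" using per by auto
  have perf': "periodic2pi f'" by (rule periodic_DERIV[OF perf f])
  have perR: "periodic2pi R" using per by (simp add: R_def)
  \<comment> \<open>Bootstrap: the profile equation gains one derivative for f', and R' = E f' gains
    one for the density. It runs once from continuity of \<open>E\<close>, and a second time when q
    > 1 makes \<open>E\<close> continuously differentiable.\<close>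
  have step: "Ck_per (Suc j) f' \<and> Ck_per (Suc j) f \<and> Ck_per (Suc j) R" if E: "Ck_per j E" and fj: "Ck_per j f" for j
  proof -
    have 1: "Ck_per (Suc j) f'"
      by (rule Ck_per_SucI[OF perf' f']) (intro Ck_per_diff Ck_per_mult Ck_per_const Ck_per_sin E fj)
    note 2 = Ck_per_mono[OF 1]
    show ?thesis
      using 1 Ck_per_SucI[OF perf f 2] Ck_per_SucI[OF perR dR Ck_per_mult[OF E 2]] by blast
  qed
  have fc: "continuous_on UNIV f"
    using f by (intro continuous_at_imp_continuous_on) (auto intro: DERIV_isCont)
  have E0: "Ck_per 0 E" and f0: "Ck_per 0 f" using perE Ec perf fc by auto
  note s1 = step[OF E0 f0]
  have smooth: "Ck_per k f' \<and> Ck_per k f \<and> Ck_per k R"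
    using k
  proof
    assume "k = Suc (Suc 0) \<and> \<alpha> > 1"
    then have "q > 1" "k = Suc (Suc 0)" using q1 by auto
    have "continuous_on UNIV (\<lambda>x. q * E x * f' x / f x)"
      by (rule pr(3)[OF _ \<open>q > 1\<close>])
    then have "Ck_per 0 (\<lambda>x. q * E x * f' x / f x)"
      using per perf' by simp
    moreover have "(E has_real_derivative q * E x * f' x / f x) (at x)" for x
      by (rule pr(2)[OF _ \<open>q > 1\<close>])
    ultimately have "Ck_per (Suc 0) E" by (intro Ck_per_SucI[OF perE])
    then show ?thesis using step s1 \<open>k = Suc (Suc 0)\<close> by blast
  qed (use s1 in blast)
  show ?thesis
  proof (rule homogeneous_boussinesqI[OF D(1,2) _ D(3) f _ dR])
    show "(f' has_real_derivative - (1 - \<alpha>)\<^sup>2 * f t - sin t * E t) (at t)" for t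
      using f'[of t] by (simp add: b2)
    \<comment> \<open>This is where the value of q comes from: R = E f / (q + 1) must also satisfy
      (2 \<alpha> + 1) R = (\<alpha> - 1) E f.\<close>
    have q': "q + 1 = (2 * \<alpha> + 1) / (\<alpha> - 1)" using \<alpha> by (auto simp: q_def field_simps)
    have "2 * \<alpha> + 1 \<noteq> 0" "\<alpha> - 1 \<noteq> 0" using \<alpha> by auto
    then show "(2 * \<alpha> + 1) * R t = (\<alpha> - 1) * (E t * f t)" for t
      unfolding R_def q' by (simp add: field_simps)
    show "R (- t) = - R t" for t by (simp add: R_def sym)
  qed (use smooth sym rot perE k in auto)
qed

subsection \<open>Nonexistence\<close>

text \<open>The equation says that y |V|^\<gamma> is constant between zeros of \<open>V\<close>. If
  V b is nonzero, going left from \<open>b\<close> reaches a last zero of \<open>V\<close>, which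
  exists because V 0 = 0; there boundedness of y and \<gamma> > 0 force the constant to be 0. The
  assumptions on \<open>y\<close> start to the right of 0 so that W / sin is admissible.\<close>

lemma vanishing_of_weighted_invariant:
  fixes V y V' y' :: "real \<Rightarrow> real"
  assumes \<gamma>: "\<gamma> > 0" and b: "b > 0"
    and V: "\<And>t. (V has_real_derivative V' t) (at t)" and V0: "V 0 = 0"
    and y: "\<And>t. t \<in> {0<..b} \<Longrightarrow> (y has_real_derivative y' t) (at t)"
    and eq: "\<And>t. t \<in> {0<..b} \<Longrightarrow> y' t * V t = - \<gamma> * V' t * y t"
    and bd: "\<And>t. t \<in> {0<..b} \<Longrightarrow> \<bar>y t\<bar> \<le> B"
  shows "y b * V b = 0"
proof (rule ccontr)
  assume nz: "y b * V b \<noteq> 0"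
  have Vc: "continuous_on S V" for S
    using DERIV_isCont[OF V] by (simp add: continuous_at_imp_continuous_on)
  define Z where "Z = {t \<in> {0..b}. V t = 0}"
  have "compact Z"
    unfolding Z_def using continuous_closed_preimage_constant[OF Vc closed_atLeastAtMost, of 0 b 0]
    by (auto simp: compact_eq_bounded_closed intro: bounded_subset[of "{0..b}"])
  moreover have "0 \<in> Z" using V0 b by (simp add: Z_def)
  ultimately obtain s where s: "s \<in> Z" "\<And>t. t \<in> Z \<Longrightarrow> t \<le> s"
    using compact_attains_sup[of Z] by blast
  have sb: "0 \<le> s" "s < b" "V s = 0" using s(1) nz by (auto simp: Z_def less_le)
  have Vnz: "V t \<noteq> 0" if "s < t" "t \<le> b" for t
    using s(2)[of t] that sb by (auto simp: Z_def)
  define Q where "Q t = y t * \<bar>V t\<bar> powr \<gamma>" for t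
  have dQ: "(Q has_real_derivative 0) (at t)" if t: "s < t" "t \<le> b" for t
  proof -
    have t': "t \<in> {0<..b}" using t sb by auto
    have "(Q has_real_derivative (y' t * \<bar>V t\<bar> powr \<gamma> + (\<gamma> * \<bar>V t\<bar> powr \<gamma> / V t * V' t) * y t)) (at t)"
      unfolding Q_def[abs_def] by (intro DERIV_mult y[OF t'] DERIV_abs_powr V Vnz t)
    also have "y' t * \<bar>V t\<bar> powr \<gamma> + (\<gamma> * \<bar>V t\<bar> powr \<gamma> / V t * V' t) * y t =
        \<bar>V t\<bar> powr \<gamma> / V t * (y' t * V t + \<gamma> * V' t * y t)"
      using Vnz[OF t] by (simp add: field_simps)
    also have "\<dots> = 0" using eq[OF t'] by simp
    finally show ?thesis .
  qed
  have Qc: "Q t = Q b" if "s < t" "t < b" for t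
    by (rule sym, rule DERIV_isconst2[of t b]) (use that in \<open>auto intro!: dQ DERIV_isCont continuous_at_imp_continuous_on\<close>)
  have "((\<lambda>t. B * \<bar>V t\<bar> powr \<gamma>) \<longlongrightarrow> B * 0 powr \<gamma>) (at_right s)"
  proof (intro tendsto_mult tendsto_const tendsto_powr')
    show "((\<lambda>t. \<bar>V t\<bar>) \<longlongrightarrow> 0) (at_right s)"
      using tendsto_mono[OF at_le isContD[OF DERIV_isCont[OF V, of s]], of "{s<..}"] sb(3)
      by (intro tendsto_rabs_zero) auto
  qed (use \<gamma> in auto)
  then have lim: "((\<lambda>t. B * \<bar>V t\<bar> powr \<gamma>) \<longlongrightarrow> 0) (at_right s)" using \<gamma> by simp
  have "\<bar>Q b\<bar> \<le> 0"
  proof (rule tendsto_lowerbound[OF lim])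
    show "\<forall>\<^sub>F t in at_right s. \<bar>Q b\<bar> \<le> B * \<bar>V t\<bar> powr \<gamma>"
    proof (rule eventually_at_rightI[OF _ sb(2)])
      fix t assume t: "t \<in> {s<..<b}"
      then have "\<bar>Q b\<bar> = \<bar>Q t\<bar>" using Qc[of t] by simp
      also have "\<dots> = \<bar>y t\<bar> * \<bar>V t\<bar> powr \<gamma>" by (simp add: Q_def abs_mult)
      also have "\<dots> \<le> B * \<bar>V t\<bar> powr \<gamma>" using bd[of t] t sb by (intro mult_right_mono) auto
      finally show "\<bar>Q b\<bar> \<le> B * \<bar>V t\<bar> powr \<gamma>" .
    qed
  qed simp
  then show False using nz by (simp add: Q_def)
qed

section \<open>The angular system and the vanishing of its vorticity\<close>

locale circle_flow =
  fixes \<alpha> :: real and U V R W R' :: "real \<Rightarrow> real"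
  assumes dV: "\<And>t. (V has_real_derivative (\<alpha> - 1) * U t) (at t)"
    and dU: "\<And>t. (U has_real_derivative (1 - \<alpha>) * V t - W t) (at t)"
    and dR: "\<And>t. (R has_real_derivative R' t) (at t)"
    and WV: "\<And>t. W t * V t = (2 * \<alpha> + 1) * (sin t * R t)"
    and WU: "\<And>t. W t * U t = sin t * R' t"
    and W_cont: "\<And>t. isCont W t"
    and V0: "V 0 = 0"
begin

lemma R_bounded: obtains B where "\<And>t. t \<in> {0<..pi} \<Longrightarrow> \<bar>R t\<bar> \<le> B"
proof -
  have "bounded (R ` {0..pi})"
    using DERIV_isCont[OF dR]
    by (intro compact_imp_bounded compact_continuous_image continuous_at_imp_continuous_on) auto
  then obtain B where "\<And>t. t \<in> {0..pi} \<Longrightarrow> \<bar>R t\<bar> \<le> B" unfolding bounded_iff by fastforce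
  then show thesis using that[of B] by auto
qed

text \<open>Where W is nonzero, V vanishes nearby; then U = V' / (\<alpha> - 1) vanishes nearby as
  well, and W = (1 - \<alpha>) V - U' = 0.\<close>

lemma W_zero_if_WV_zero:
  assumes "\<alpha> \<noteq> 1" "open S" "\<And>t. t \<in> S \<Longrightarrow> W t * V t = 0" "t \<in> S"
  shows "W t = 0"
proof (rule ccontr)
  assume "W t \<noteq> 0"
  then have "\<forall>\<^sub>F s in nhds t. W s \<noteq> 0"
    using W_cont[of t] by (intro tendsto_imp_eventually_ne[of W "W t"]) (auto simp: isCont_def tendsto_nhds_iff)
  moreover have "\<forall>\<^sub>F s in nhds t. s \<in> S" using assms by (intro eventually_nhds_in_open)
  ultimately have "\<forall>\<^sub>F s in nhds t. V s = 0"
    by eventually_elim (use assms(3) in force)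
  then have V: "\<forall>\<^sub>F s in nhds t. \<forall>\<^sub>F r in nhds s. V r = 0" by (simp add: eventually_eventually)
  have "\<forall>\<^sub>F s in nhds t. U s = 0"
    using V
  proof eventually_elim
    case (elim s)
    have "(V has_real_derivative 0) (at s)"
      by (subst DERIV_cong_ev[OF refl elim refl]) simp
    then show "U s = 0" using DERIV_unique[OF dV] assms(1) by fastforce
  qed
  then have "(U has_real_derivative 0) (at t)"
    by (subst DERIV_cong_ev[OF refl _ refl]) auto
  then have "(1 - \<alpha>) * V t - W t = 0" using DERIV_unique[OF dU] by fastforce
  then show False using eventually_nhds_x_imp_x[OF V] eventually_nhds_x_imp_x \<open>W t \<noteq> 0\<close> by fastforce
qed

lemma sin_pos: "t \<in> {0<..<pi} \<Longrightarrow> sin t > 0"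
  by (intro sin_gt_zero) auto

text \<open>For -1/2 < \<alpha> < 1 the invariant is R |V|^((2 \<alpha> + 1) / (1 - \<alpha>)), with
  positive exponent and bounded R. The two end values, where this exponent is 0 or undefined, are
  treated directly.\<close>

lemma irrotational_C1:
  assumes \<alpha>: "- 1 / 2 \<le> \<alpha>" "\<alpha> \<le> 1" and t: "t \<in> {0<..<pi}"
  shows "W t = 0"
proof (cases "\<alpha> = 1")
  case True
  \<comment> \<open>For \<alpha> = 1 the angular velocity is constant, hence 0. Then R = 0 and R' =
    0 on (0, pi), so W U = 0; where W is nonzero this gives U = 0 nearby and W = - U' = 0.\<close>
  have "V t = V 0" for t
    using DERIV_isconst_all[of V] dV True by simp
  then have V: "V t = 0" for t using V0 by simp
  show ?thesis
  proof (rule ccontr)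
    assume Wt: "W t \<noteq> 0"
    have R0: "R s = 0" if "s \<in> {0<..<pi}" for s
      using WV[of s] V[of s] True sin_pos[OF that] by simp
    have R'0: "R' s = 0" if "s \<in> {0<..<pi}" for s
    proof -
      have "\<forall>\<^sub>F r in nhds s. R r = 0"
        using eventually_nhds_in_open[OF open_greaterThanLessThan that] by eventually_elim (rule R0)
      then have "(R has_real_derivative 0) (at s)" by (subst DERIV_cong_ev[OF refl _ refl]) auto
      then show ?thesis using DERIV_unique[OF dR] by blast
    qed
    have "\<forall>\<^sub>F s in nhds t. W s \<noteq> 0"
      using W_cont[of t] Wt by (intro tendsto_imp_eventually_ne[of W "W t"]) (auto simp: isCont_def tendsto_nhds_iff)
    moreover have "\<forall>\<^sub>F s in nhds t. s \<in> {0<..<pi}" using t by (intro eventually_nhds_in_open) auto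
    ultimately have "\<forall>\<^sub>F s in nhds t. U s = 0"
    proof eventually_elim
      case (elim s)
      then show ?case using WU[of s] R'0[of s] by simp
    qed
    then have "(U has_real_derivative 0) (at t)" by (subst DERIV_cong_ev[OF refl _ refl]) auto
    then have "(1 - \<alpha>) * V t - W t = 0" using DERIV_unique[OF dU] by fastforce
    then show False using Wt V by simp
  qed
next
  case False
  show ?thesis
  proof (rule W_zero_if_WV_zero[OF False open_greaterThanLessThan _ t])
    fix s assume s: "s \<in> {0<..<pi}"
    show "W s * V s = 0"
    proof (cases "2 * \<alpha> + 1 = 0")
      case True
      then show ?thesis by (simp add: WV)
    next
      case nz: False
      obtain B where B: "\<And>t. t \<in> {0<..pi} \<Longrightarrow> \<bar>R t\<bar> \<le> B" using R_bounded by blast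
      have "R s * V s = 0"
      proof (rule vanishing_of_weighted_invariant[where \<gamma> = "(2 * \<alpha> + 1) / (1 - \<alpha>)" and B = B, OF _ _ dV V0 dR])
        fix r assume r: "r \<in> {0<..s}"
        have "sin r > 0" using r s by (intro sin_pos) auto
        moreover have "sin r * (R' r * V r) = sin r * ((2 * \<alpha> + 1) * U r * R r)"
          using WU[of r] WV[of r] by (metis (no_types, opaque_lifting) mult.assoc mult.commute)
        ultimately have "R' r * V r = (2 * \<alpha> + 1) * U r * R r" by simp
        then show "R' r * V r = - ((2 * \<alpha> + 1) / (1 - \<alpha>)) * ((\<alpha> - 1) * U r) * R r"
          using False by (simp add: field_simps)
      qed (use nz \<alpha> False s B in auto)
      then show ?thesis using WV[of s] by (auto simp: mult_ac)
    qed
  qed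
qed

end

locale circle_flow_C1_vorticity = circle_flow +
  fixes W' :: "real \<Rightarrow> real"
  assumes dW: "\<And>t. (W has_real_derivative W' t) (at t)"
begin

definition \<kappa> where "\<kappa> t = W t / sin t"

lemma \<kappa>_deriv:
  assumes "t \<in> {0<..<pi}"
  shows "(\<kappa> has_real_derivative (W' t * sin t - W t * cos t) / (sin t * sin t)) (at t)"
  unfolding \<kappa>_def[abs_def] using sin_pos[OF assms]
  by (auto intro!: derivative_eq_intros dW)

text \<open>On (0, pi) the system reads \<kappa> V = (2 \<alpha> + 1) R and \<kappa> U = R'.
  Differentiating the first relation and inserting the second eliminates the density.\<close>

lemma \<kappa>_eq:
  assumes t: "t \<in> {0<..<pi}"
  shows "(W' t * sin t - W t * cos t) / (sin t * sin t) * V t = (\<alpha> + 2) * U t * \<kappa> t"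
proof -
  let ?k' = "(W' t * sin t - W t * cos t) / (sin t * sin t)"
  have \<kappa>V: "\<kappa> s * V s = (2 * \<alpha> + 1) * R s" and \<kappa>U: "\<kappa> s * U s = R' s" if "s \<in> {0<..<pi}" for s
    using WV[of s] WU[of s] sin_pos[OF that] by (simp_all add: \<kappa>_def field_simps)
  have "((\<lambda>s. \<kappa> s * V s) has_real_derivative ?k' * V t + (\<alpha> - 1) * U t * \<kappa> t) (at t)"
    by (intro DERIV_mult \<kappa>_deriv t dV)
  moreover have "((\<lambda>s. \<kappa> s * V s) has_real_derivative (2 * \<alpha> + 1) * R' t) (at t)"
  proof -
    have "\<forall>\<^sub>F s in nhds t. \<kappa> s * V s = (2 * \<alpha> + 1) * R s"
      using eventually_nhds_in_open[OF open_greaterThanLessThan t] by eventually_elim (rule \<kappa>V)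
    then show ?thesis
      by (subst DERIV_cong_ev[OF refl _ refl]) (auto intro!: DERIV_cmult dR)
  qed
  ultimately have "?k' * V t + (\<alpha> - 1) * U t * \<kappa> t = (2 * \<alpha> + 1) * R' t"
    by (rule DERIV_unique)
  then show ?thesis using \<kappa>U[OF t] by (simp add: algebra_simps)
qed

text \<open>The invariant is \<kappa> |V|^((\<alpha> + 2) / (1 - \<alpha>)). The boundedness of
  \<kappa> near 0, which the argument requires, comes from W 0 = 0 and differentiability of
  W.\<close>

lemma irrotational_C2:
  assumes \<alpha>: "- 2 < \<alpha>" "\<alpha> < 1" and W0: "W 0 = 0" and t: "t \<in> {0<..<pi}"
  shows "W t = 0"
proof (rule W_zero_if_WV_zero[OF _ open_greaterThanLessThan _ t])
  show "\<alpha> \<noteq> 1" using \<alpha> by simp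
  fix s assume s: "s \<in> {0<..<pi}"
  have "((\<lambda>t. ((W t - W 0) / (t - 0)) / ((sin t - sin 0) / (t - 0))) \<longlongrightarrow> W' 0 / cos 0) (at 0)"
    by (intro tendsto_divide)
       (use dW[of 0] DERIV_sin[of 0] in \<open>simp_all add: has_field_derivative_iff\<close>)
  then have lim: "(\<kappa> \<longlongrightarrow> W' 0) (at 0)"
    by (intro Lim_transform_eventually[of _ "W' 0" _ \<kappa>]) (auto simp: eventually_at_filter \<kappa>_def W0)
  \<comment> \<open>Division by 0 gives \<kappa> the value 0 at t = 0; it is replaced by the limit
    W' 0 to obtain a continuous function on [0, s].\<close>
  define \<kappa>0 where "\<kappa>0 t = (if t = 0 then W' 0 else \<kappa> t)" for t
  have "isCont \<kappa>0 r" if "r \<in> {0..s}" for r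
  proof (cases "r = 0")
    case True
    have "(\<kappa>0 \<longlongrightarrow> W' 0) (at 0)"
      using lim by (rule Lim_transform_eventually) (simp add: eventually_at_filter \<kappa>0_def)
    then show ?thesis using True by (simp add: isCont_def \<kappa>0_def)
  next
    case False
    have "isCont \<kappa> r" using False that s by (intro DERIV_isCont[OF \<kappa>_deriv]) auto
    moreover have "\<forall>\<^sub>F x in nhds r. \<kappa>0 x = \<kappa> x"
      using t1_space_nhds[OF False] by eventually_elim (simp add: \<kappa>0_def)
    ultimately show ?thesis by (simp only: isCont_cong)
  qed
  then have "bounded (\<kappa>0 ` {0..s})"
    by (intro compact_imp_bounded compact_continuous_image continuous_at_imp_continuous_on) auto
  then obtain B where B: "\<And>r. r \<in> {0..s} \<Longrightarrow> \<bar>\<kappa>0 r\<bar> \<le> B" unfolding bounded_iff by fastforce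
  have "\<kappa> s * V s = 0"
  proof (rule vanishing_of_weighted_invariant[where \<gamma> = "(\<alpha> + 2) / (1 - \<alpha>)" and B = B, OF _ _ dV V0 \<kappa>_deriv])
    fix r assume r: "r \<in> {0<..s}"
    then have r': "r \<in> {0<..<pi}" using s by auto
    show "(W' r * sin r - W r * cos r) / (sin r * sin r) * V r = - ((\<alpha> + 2) / (1 - \<alpha>)) * ((\<alpha> - 1) * U r) * \<kappa> r"
      unfolding \<kappa>_eq[OF r'] using \<alpha> by (simp add: field_simps)
    show "\<bar>\<kappa> r\<bar> \<le> B" using B[of r] r by (simp add: \<kappa>0_def)
  qed (use \<alpha> s in auto)
  then show "W s * V s = 0" using sin_pos[OF s] by (simp add: \<kappa>_def)
qed

text \<open>For \<alpha> = -2 the equation is \<kappa>' V = 0, which says nothing directly where V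
  vanishes. If \<kappa>' were nonzero at a point, it would be so nearby by continuity; then V, hence
  W, would vanish there, and with it \<kappa>'. So \<kappa> is constant on (0, pi), with limit
  0.\<close>

lemma irrotational_critical:
  assumes \<alpha>: "\<alpha> = - 2" and W'_cont: "\<And>t. isCont W' t" and lim: "(\<kappa> \<longlongrightarrow> 0) (at_right 0)" and t: "t \<in> {0<..<pi}"
  shows "W t = 0"
proof -
  define k' where "k' t = (W' t * sin t - W t * cos t) / (sin t * sin t)" for t
  have k0: "(\<kappa> has_real_derivative 0) (at s)" if s: "s \<in> {0<..<pi}" for s
  proof -
    have "k' s = 0"
    proof (rule ccontr)
      assume "k' s \<noteq> 0"
      moreover have "isCont k' s"
        unfolding k'_def[abs_def] using sin_pos[OF s] by (intro continuous_intros W'_cont W_cont) auto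
      ultimately have "\<forall>\<^sub>F r in nhds s. k' r \<noteq> 0"
        by (intro tendsto_imp_eventually_ne[of k' "k' s"]) (auto simp: isCont_def tendsto_nhds_iff)
      moreover have "\<forall>\<^sub>F r in nhds s. r \<in> {0<..<pi}" using s by (intro eventually_nhds_in_open) auto
      ultimately have "\<forall>\<^sub>F r in nhds s. k' r \<noteq> 0 \<and> r \<in> {0<..<pi}" by (rule eventually_conj)
      then obtain S where S: "open S" "s \<in> S" "\<And>r. r \<in> S \<Longrightarrow> k' r \<noteq> 0 \<and> r \<in> {0<..<pi}"
        unfolding eventually_nhds by blast
      have W0: "W r = 0" if "r \<in> S" for r
      proof (rule W_zero_if_WV_zero[OF _ S(1) _ that])
        show "W r * V r = 0" if "r \<in> S" for r
          using \<kappa>_eq[of r] S(3)[OF that] \<alpha> by (simp add: k'_def)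
      qed (use \<alpha> in simp)
      have "\<forall>\<^sub>F r in nhds s. W r = 0"
        using eventually_nhds_in_open[OF S(1,2)] by eventually_elim (rule W0)
      then have "(W has_real_derivative 0) (at s)" by (subst DERIV_cong_ev[OF refl _ refl]) auto
      then have "W' s = 0" using DERIV_unique[OF dW] by blast
      then show False using \<open>k' s \<noteq> 0\<close> W0[OF S(2)] by (simp add: k'_def)
    qed
    then show ?thesis using \<kappa>_deriv[OF s, folded k'_def] by simp
  qed
  have const: "\<kappa> s = \<kappa> t" if s: "s \<in> {0<..<t}" for s
    by (rule sym, rule DERIV_isconst2[of s t]) (use s t in \<open>auto intro!: k0 DERIV_isCont[OF k0] continuous_at_imp_continuous_on\<close>)
  have "(\<kappa> \<longlongrightarrow> \<kappa> t) (at_right 0)"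
    by (rule tendsto_eventually, rule eventually_at_rightI[of 0 t]) (use const t in auto)
  then have "\<kappa> t = 0" using lim tendsto_unique trivial_limit_at_right_real by blast
  then show ?thesis using sin_pos[OF t] by (simp add: \<kappa>_def)
qed

end

section \<open>Restriction of a planar flow to the unit circle\<close>

definition circ :: "real \<Rightarrow> real^2" where
  "circ t = vector [cos t, sin t]"

lemma circ_nth [simp]: "circ t $ 1 = cos t" "circ t $ 2 = sin t"
  by (simp_all add: circ_def)

lemma norm_circ [simp]: "norm (circ t) = 1"
  by (simp add: norm_vec_def L2_set_def sum_2)

lemma circ_nonzero [simp]: "circ t \<noteq> 0"
  using norm_circ[of t] by (metis norm_zero zero_neq_one)

lemma has_derivative_partial_deriv:
  fixes F :: "real^2 \<Rightarrow> real"
  assumes "F differentiable (at x)"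
  shows "(F has_derivative (\<lambda>d. d $ 1 * partial_deriv 1 F x + d $ 2 * partial_deriv 2 F x)) (at x)"
proof -
  interpret linear "frechet_derivative F (at x)"
    using linear_frechet_derivative[OF assms] .
  have "frechet_derivative F (at x) d = d $ 1 * partial_deriv 1 F x + d $ 2 * partial_deriv 2 F x" for d
  proof -
    have "d = d $ 1 *\<^sub>R axis 1 1 + d $ 2 *\<^sub>R axis 2 1"
      by (simp add: vec_eq_iff forall_2 axis_def)
    then have "frechet_derivative F (at x) d = frechet_derivative F (at x) (d $ 1 *\<^sub>R axis 1 1 + d $ 2 *\<^sub>R axis 2 1)"
      by simp
    also have "\<dots> = d $ 1 * partial_deriv 1 F x + d $ 2 * partial_deriv 2 F x"
      by (simp add: add scale partial_deriv_def)
    finally show ?thesis .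
  qed
  then show ?thesis using assms unfolding frechet_derivative_works by presburger
qed

lemma circ_has_derivative: "(circ has_derivative (\<lambda>h. h *\<^sub>R vector [- sin t, cos t])) (at t)"
proof -
  have e: "circ = (\<lambda>t. cos t *\<^sub>R axis 1 1 + sin t *\<^sub>R axis 2 1)"
    by (simp add: fun_eq_iff vec_eq_iff forall_2 axis_def)
  have "(cos has_derivative (\<lambda>h. - sin t * h)) (at t)" "(sin has_derivative (\<lambda>h. cos t * h)) (at t)"
    by (rule DERIV_cos[unfolded has_field_derivative_def] DERIV_sin[unfolded has_field_derivative_def])+
  then have "(circ has_derivative (\<lambda>h. (- sin t * h) *\<^sub>R axis 1 1 + (cos t * h) *\<^sub>R axis 2 1)) (at t)"
    unfolding e by (intro has_derivative_add has_derivative_scaleR_left)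
  then show ?thesis
    by (rule has_derivative_eq_rhs) (simp add: fun_eq_iff vec_eq_iff forall_2 axis_def)
qed

lemma isCont_circ: "isCont circ t"
  by (rule has_derivative_continuous[OF circ_has_derivative])

lemma DERIV_along_circle:
  fixes F :: "real^2 \<Rightarrow> real"
  assumes "F differentiable (at (circ t))"
  shows "((\<lambda>t. F (circ t)) has_real_derivative
      (- sin t * partial_deriv 1 F (circ t) + cos t * partial_deriv 2 F (circ t))) (at t)"
  unfolding has_field_derivative_def
  by (rule has_derivative_eq_rhs[OF has_derivative_compose[OF circ_has_derivative has_derivative_partial_deriv[OF assms]]])
     (simp add: fun_eq_iff algebra_simps)

lemma euler_identity:
  fixes F :: "real^2 \<Rightarrow> real"
  assumes F: "F differentiable (at x)" and hom: "\<And>s. s > 0 \<Longrightarrow> F (s *\<^sub>R x) = s powr m * F x"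
  shows "x $ 1 * partial_deriv 1 F x + x $ 2 * partial_deriv 2 F x = m * F x"
proof -
  have sx: "((\<lambda>s. s *\<^sub>R x) has_derivative (\<lambda>h. h *\<^sub>R x)) (at 1)"
    by (auto intro!: derivative_eq_intros)
  have "(F has_derivative (\<lambda>d. d $ 1 * partial_deriv 1 F x + d $ 2 * partial_deriv 2 F x)) (at (1 *\<^sub>R x))"
    using has_derivative_partial_deriv[OF F] by simp
  from has_derivative_compose[OF sx this]
  have "((\<lambda>s. F (s *\<^sub>R x)) has_derivative (\<lambda>h. (h *\<^sub>R x) $ 1 * partial_deriv 1 F x + (h *\<^sub>R x) $ 2 * partial_deriv 2 F x)) (at 1)" .
  then have 1: "((\<lambda>s. F (s *\<^sub>R x)) has_real_derivative x $ 1 * partial_deriv 1 F x + x $ 2 * partial_deriv 2 F x) (at 1)"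
    unfolding has_field_derivative_def by (rule has_derivative_eq_rhs) (simp add: fun_eq_iff algebra_simps)
  have "((\<lambda>s. s powr m * F x) has_real_derivative m * F x) (at 1)"
    by (auto intro!: derivative_eq_intros)
  moreover have "\<forall>\<^sub>F s in nhds (1::real). F (s *\<^sub>R x) = s powr m * F x"
    using eventually_nhds_in_open[of "{0<..}" "1::real"] by (auto elim!: eventually_mono simp: hom)
  ultimately have "((\<lambda>s. F (s *\<^sub>R x)) has_real_derivative m * F x) (at 1)"
    by (subst DERIV_cong_ev[OF refl _ refl]) auto
  with 1 show ?thesis by (rule DERIV_unique)
qed

text \<open>Chain rule for a dilation; it carries the vanishing of the vorticity from the unit
  circle to the punctured plane.\<close>

lemma partial_deriv_homogeneous:
  fixes F :: "real^2 \<Rightarrow> real"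
  assumes "s > 0" "x \<noteq> 0" and F: "\<And>y. y \<noteq> 0 \<Longrightarrow> F differentiable (at y)"
    and hom: "\<And>y. y \<noteq> 0 \<Longrightarrow> F (s *\<^sub>R y) = c * F y"
  shows "s * partial_deriv i F (s *\<^sub>R x) = c * partial_deriv i F x"
proof -
  have sx: "s *\<^sub>R x \<noteq> 0" using assms by auto
  note d = F[OF sx, unfolded frechet_derivative_works] F[OF assms(2), unfolded frechet_derivative_works]
  have "((\<lambda>y. s *\<^sub>R y) has_derivative (\<lambda>h. s *\<^sub>R h)) (at x)"
    by (auto intro!: derivative_eq_intros)
  from has_derivative_compose[OF this d(1)]
  have 1: "((\<lambda>y. F (s *\<^sub>R y)) has_derivative (\<lambda>h. frechet_derivative F (at (s *\<^sub>R x)) (s *\<^sub>R h))) (at x)" .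
  have 2: "((\<lambda>y. F (s *\<^sub>R y)) has_derivative (\<lambda>h. c * frechet_derivative F (at x) h)) (at x)"
    by (rule has_derivative_transform_within_open[OF has_derivative_mult_right[OF d(2)], where s = "- {0}"])
       (use assms(2) hom in auto)
  have "frechet_derivative F (at (s *\<^sub>R x)) (s *\<^sub>R axis i 1) = c * frechet_derivative F (at x) (axis i 1)"
    using has_derivative_unique[OF 1 2] by meson
  then show ?thesis
    using linear_scale[OF linear_frechet_derivative[OF F[OF sx]]] by (simp add: partial_deriv_def)
qed

lemma partial_deriv_component:
  fixes u :: "real^2 \<Rightarrow> real^2"
  assumes "u differentiable (at x)"
  shows "(\<lambda>y. u y $ j) differentiable (at x)" "partial_deriv i (\<lambda>y. u y $ j) x = partial_deriv i u x $ j"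
proof -
  have *: "((\<lambda>y. u y $ j) has_derivative (\<lambda>d. frechet_derivative u (at x) d $ j)) (at x)"
    using assms unfolding frechet_derivative_works by (rule bounded_linear.has_derivative[OF bounded_linear_vec_nth])
  then show "(\<lambda>y. u y $ j) differentiable (at x)" by (auto simp: differentiable_def)
  show "partial_deriv i (\<lambda>y. u y $ j) x = partial_deriv i u x $ j"
    unfolding partial_deriv_eqI[OF *] by (simp add: partial_deriv_def)
qed

lemma Ck_on_mono: "Ck_on (Suc k) D f \<Longrightarrow> Ck_on k D f"
proof (induction k arbitrary: f)
  case 0
  then show ?case
    by (simp add: continuous_at_imp_continuous_on differentiable_imp_continuous_within)
next
  case (Suc k)
  have "Ck_on (Suc k) D (partial_deriv i f)" for i
    using Suc.prems Ck_on.simps(2)[of "Suc k" D f] by blast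
  then have "Ck_on k D (partial_deriv i f)" for i by (rule Suc.IH)
  moreover have "\<forall>x\<in>D. f differentiable (at x)"
    using Suc.prems Ck_on.simps(2)[of "Suc k" D f] by blast
  ultimately show ?case by simp
qed

lemma homogeneous_boussinesq_C1:
  assumes "homogeneous_boussinesq (Suc (Suc k)) D \<alpha> u p \<rho>"
  shows "homogeneous_boussinesq (Suc k) D \<alpha> u p \<rho>"
  using assms Ck_on_mono[of "Suc k" D u] Ck_on_mono[of "Suc k" D p] Ck_on_mono[of "Suc k" D \<rho>]
  unfolding homogeneous_boussinesq_def by blast

text \<open>The convection term is the gradient of |u|^2 / 2 plus the vorticity times the rotated
  velocity. Subtracting the gradient of the constant Bernoulli function from the momentum equation
  leaves only x_2 times the density gradient on the other side.\<close>

lemma vorticity_equations: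
  assumes bo: "boussinesq_on (- {0}) u p \<rho>" and bern: "\<forall>x\<in>- {0}. bernoulli u p \<rho> x = c"
    and du: "u differentiable (at x)" and dp: "p differentiable (at x)" and dr: "\<rho> differentiable (at x)"
    and x: "x \<noteq> 0"
  shows "vorticity u x * u x $ 2 = - (x $ 2 * partial_deriv 1 \<rho> x)"
    and "vorticity u x * u x $ 1 = x $ 2 * partial_deriv 2 \<rho> x"
    and "partial_deriv 1 (\<lambda>y. u y $ 1) x + partial_deriv 2 (\<lambda>y. u y $ 2) x = 0"
proof -
  note pc = partial_deriv_component[OF du]
  have B1: "((\<lambda>y. p y + 1 / 2 * (u y $ 1 * u y $ 1 + u y $ 2 * u y $ 2) + y $ 2 * \<rho> y) has_derivative (\<lambda>d.
     frechet_derivative p (at x) d + (u x $ 1 * frechet_derivative (\<lambda>y. u y $ 1) (at x) d + u x $ 2 * frechet_derivative (\<lambda>y. u y $ 2) (at x) d)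
      + (x $ 2 * frechet_derivative \<rho> (at x) d + d $ 2 * \<rho> x))) (at x)"
  proof -
    have n: "((\<lambda>y::real^2. y $ 2) has_derivative (\<lambda>d. d $ 2)) (at x)"
      by (rule bounded_linear_imp_has_derivative[OF bounded_linear_vec_nth])
    note D = dp[unfolded frechet_derivative_works] dr[unfolded frechet_derivative_works] pc(1)[unfolded frechet_derivative_works]
    note E = has_derivative_add[OF has_derivative_add[OF D(1) has_derivative_mult_right[OF has_derivative_add[OF
        has_derivative_mult[OF D(3) D(3)] has_derivative_mult[OF D(3) D(3)]], of "1 / 2"]] has_derivative_mult[OF n D(2)]]
    show ?thesis
      by (rule has_derivative_eq_rhs[OF E]) (simp add: fun_eq_iff)
  qed
  have B2: "((\<lambda>y. p y + 1 / 2 * (u y $ 1 * u y $ 1 + u y $ 2 * u y $ 2) + y $ 2 * \<rho> y) has_derivative (\<lambda>_. 0)) (at x)"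
  proof (rule has_derivative_transform_within_open[OF has_derivative_const, of "- {0}" x c])
    fix y :: "real^2" assume "y \<in> - {0}"
    then have "bernoulli u p \<rho> y = c" using bern by blast
    then show "c = p y + 1 / 2 * (u y $ 1 * u y $ 1 + u y $ 2 * u y $ 2) + y $ 2 * \<rho> y"
      by (simp add: bernoulli_def norm_vec_def L2_set_def sum_2 power2_eq_square)
  qed (use x in auto)
  have "frechet_derivative p (at x) d + (u x $ 1 * frechet_derivative (\<lambda>y. u y $ 1) (at x) d + u x $ 2 * frechet_derivative (\<lambda>y. u y $ 2) (at x) d)
      + (x $ 2 * frechet_derivative \<rho> (at x) d + d $ 2 * \<rho> x) = 0" for d
    using fun_cong[OF has_derivative_unique[OF B1 B2], of d] .
  from this[of "axis 1 1"] this[of "axis 2 1"]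
  have g: "partial_deriv 1 p x + (u x $ 1 * partial_deriv 1 (\<lambda>y. u y $ 1) x + u x $ 2 * partial_deriv 1 (\<lambda>y. u y $ 2) x) + x $ 2 * partial_deriv 1 \<rho> x = 0"
    "partial_deriv 2 p x + (u x $ 1 * partial_deriv 2 (\<lambda>y. u y $ 1) x + u x $ 2 * partial_deriv 2 (\<lambda>y. u y $ 2) x) + (x $ 2 * partial_deriv 2 \<rho> x + \<rho> x) = 0"
    by (simp_all add: partial_deriv_def axis_def)
  have m: "(\<Sum>i\<in>UNIV. u x $ i *\<^sub>R partial_deriv i u x) + (\<chi> i. partial_deriv i p x) = - (\<rho> x *\<^sub>R axis 2 1)"
    and d: "(\<Sum>i\<in>UNIV. partial_deriv i (\<lambda>y. u y $ i) x) = 0"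
    using bo x unfolding boussinesq_on_def by auto
  have m1: "u x $ 1 * partial_deriv 1 (\<lambda>y. u y $ 1) x + u x $ 2 * partial_deriv 2 (\<lambda>y. u y $ 1) x + partial_deriv 1 p x = 0"
    and m2: "u x $ 1 * partial_deriv 1 (\<lambda>y. u y $ 2) x + u x $ 2 * partial_deriv 2 (\<lambda>y. u y $ 2) x + partial_deriv 2 p x = - \<rho> x"
    using m by (simp_all add: vec_eq_iff forall_2 sum_2 axis_def pc(2))
  show "vorticity u x * u x $ 2 = - (x $ 2 * partial_deriv 1 \<rho> x)" "vorticity u x * u x $ 1 = x $ 2 * partial_deriv 2 \<rho> x"
    using g m1 m2 unfolding vorticity_def by (simp_all add: algebra_simps)
  show "partial_deriv 1 (\<lambda>y. u y $ 1) x + partial_deriv 2 (\<lambda>y. u y $ 2) x = 0"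
    using d by (simp add: sum_2)
qed

locale homogeneous_flow =
  fixes \<alpha> :: real and u :: "real^2 \<Rightarrow> real^2" and p \<rho> :: "real^2 \<Rightarrow> real"
  assumes sol: "homogeneous_boussinesq (Suc 0) (- {0}) \<alpha> u p \<rho>"
begin

lemma diff: "x \<noteq> 0 \<Longrightarrow> u differentiable (at x)" "x \<noteq> 0 \<Longrightarrow> p differentiable (at x)" "x \<noteq> 0 \<Longrightarrow> \<rho> differentiable (at x)"
  using sol unfolding homogeneous_boussinesq_def by auto

lemma vorticity_components:
  "x \<noteq> 0 \<Longrightarrow> vorticity u x = partial_deriv 1 u x $ 2 - partial_deriv 2 u x $ 1"
  by (simp add: vorticity_def partial_deriv_component(2)[OF diff(1)])

lemma homogeneity:
  assumes "s > 0" "x \<noteq> 0"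
  shows "u (s *\<^sub>R x) $ i = s powr (- \<alpha>) * u x $ i" "\<rho> (s *\<^sub>R x) = s powr (- 2 * \<alpha> - 1) * \<rho> x"
proof -
  have "s *\<^sub>R x \<noteq> 0" using assms by auto
  moreover have "(s *\<^sub>R x) /\<^sub>R norm (s *\<^sub>R x) = x /\<^sub>R norm x" using assms by simp
  ultimately have "u (s *\<^sub>R x) = norm (s *\<^sub>R x) powr (- \<alpha>) *\<^sub>R u (x /\<^sub>R norm x)"
    "u x = norm x powr (- \<alpha>) *\<^sub>R u (x /\<^sub>R norm x)"
    "\<rho> (s *\<^sub>R x) = norm (s *\<^sub>R x) powr (- 2 * \<alpha> - 1) * \<rho> (x /\<^sub>R norm x)"
    "\<rho> x = norm x powr (- 2 * \<alpha> - 1) * \<rho> (x /\<^sub>R norm x)"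
    using sol assms(2) unfolding homogeneous_boussinesq_def homogeneous_sol_def by metis+
  moreover have "norm (s *\<^sub>R x) powr m = s powr m * norm x powr m" for m
    using assms by (simp add: powr_mult)
  ultimately show "u (s *\<^sub>R x) $ i = s powr (- \<alpha>) * u x $ i" "\<rho> (s *\<^sub>R x) = s powr (- 2 * \<alpha> - 1) * \<rho> x"
    by (metis mult.assoc vector_scaleR_component real_scaleR_def)+
qed

definition U where "U t = cos t * u (circ t) $ 1 + sin t * u (circ t) $ 2"
definition V where "V t = - sin t * u (circ t) $ 1 + cos t * u (circ t) $ 2"
definition R where "R t = \<rho> (circ t)"
definition W where "W t = vorticity u (circ t)"
definition R' where "R' t = - sin t * partial_deriv 1 \<rho> (circ t) + cos t * partial_deriv 2 \<rho> (circ t)"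

lemma reflect_circ: "reflect2 (circ t) = circ (- t)"
  by (simp add: reflect2_def circ_def)

lemma symmetry: "u (circ (- t)) $ 1 = u (circ t) $ 1" "u (circ (- t)) $ 2 = - (u (circ t) $ 2)"
proof -
  have "u (circ t) $ 1 = u (circ (- t)) $ 1 \<and> u (circ t) $ 2 = - (u (circ (- t)) $ 2)"
    using sol unfolding homogeneous_boussinesq_def x2_symmetric_on_def
    by (metis ComplI circ_nonzero empty_iff insert_iff reflect_circ)
  then show "u (circ (- t)) $ 1 = u (circ t) $ 1" "u (circ (- t)) $ 2 = - (u (circ t) $ 2)" by auto
qed

lemma vorticity_continuous: "continuous_on (- {0}) (vorticity u)"
proof -
  have "continuous_on (- {0}) (\<lambda>x. partial_deriv 1 u x $ 2 - partial_deriv 2 u x $ 1)"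
    using sol unfolding homogeneous_boussinesq_def by (intro continuous_intros) auto
  then show ?thesis
    by (rule continuous_on_eq) (simp add: vorticity_components)
qed

text \<open>Homogeneity fixes the radial derivatives by Euler's identity, and incompressibility
  fixes the trace of the velocity gradient, so the tangential derivatives of U and V reduce to U, V
  and W. Projecting the vorticity equations gives W V from the radial and W U from the tangential
  derivative of the density.\<close>

sublocale circle_flow \<alpha> U V R W R'
proof
  fix t
  let ?x = "circ t"
  define a b c d where "a = partial_deriv 1 (\<lambda>y. u y $ 1) ?x" and "b = partial_deriv 2 (\<lambda>y. u y $ 1) ?x"
    and "c = partial_deriv 1 (\<lambda>y. u y $ 2) ?x" and "d = partial_deriv 2 (\<lambda>y. u y $ 2) ?x"
  obtain k where bo: "boussinesq_on (- {0}) u p \<rho>" and k: "\<forall>x\<in>- {0}. bernoulli u p \<rho> x = k"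
    using sol unfolding homogeneous_boussinesq_def by blast
  note eqs = vorticity_equations[OF bo k diff[OF circ_nonzero] circ_nonzero, of t, folded a_def b_def c_def d_def]
  note pc = partial_deriv_component(1)[OF diff(1)[OF circ_nonzero]]
  note du1 = DERIV_along_circle[OF pc, of 1 t, folded a_def b_def] and du2 = DERIV_along_circle[OF pc, of 2 t, folded c_def d_def]
  have eu: "cos t * a + sin t * b = - \<alpha> * u ?x $ 1" "cos t * c + sin t * d = - \<alpha> * u ?x $ 2"
    using euler_identity[OF pc homogeneity(1)[OF _ circ_nonzero], of t 1] euler_identity[OF pc homogeneity(1)[OF _ circ_nonzero], of t 2]
    by (simp_all add: a_def b_def c_def d_def)
  have er: "cos t * partial_deriv 1 \<rho> ?x + sin t * partial_deriv 2 \<rho> ?x = (- 2 * \<alpha> - 1) * \<rho> ?x"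
    using euler_identity[OF diff(3)[OF circ_nonzero] homogeneity(2)[OF _ circ_nonzero], of t] by simp
  have cs: "cos t * cos t + sin t * sin t = 1" by (rule sin_cos_squared_add3)
  have W: "W t = c - b" by (simp add: W_def vorticity_def b_def c_def)
  show "(R has_real_derivative R' t) (at t)"
    unfolding R_def[abs_def] R'_def by (rule DERIV_along_circle[OF diff(3)[OF circ_nonzero]])
  have "(V has_real_derivative - U t + (- sin t * (- sin t * a + cos t * b) + cos t * (- sin t * c + cos t * d))) (at t)"
    unfolding V_def[abs_def] U_def
    by (auto intro!: derivative_eq_intros du1 du2 simp: algebra_simps)
  also have "- sin t * (- sin t * a + cos t * b) + cos t * (- sin t * c + cos t * d) =
      (a + d) * (cos t * cos t + sin t * sin t) - cos t * (cos t * a + sin t * b) - sin t * (cos t * c + sin t * d)"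
    by (simp add: algebra_simps del: sin_cos_squared_add3)
  also have "\<dots> = \<alpha> * U t"
    unfolding eu eqs(3) by (simp add: U_def algebra_simps)
  finally show "(V has_real_derivative (\<alpha> - 1) * U t) (at t)" by (simp add: algebra_simps)
  have "(U has_real_derivative V t + (cos t * (- sin t * a + cos t * b) + sin t * (- sin t * c + cos t * d))) (at t)"
    unfolding U_def[abs_def] V_def
    by (auto intro!: derivative_eq_intros du1 du2 simp: algebra_simps)
  also have "cos t * (- sin t * a + cos t * b) + sin t * (- sin t * c + cos t * d) =
      - (c - b) * (cos t * cos t + sin t * sin t) - sin t * (cos t * a + sin t * b) + cos t * (cos t * c + sin t * d)"
    by (simp add: algebra_simps del: sin_cos_squared_add3)
  also have "\<dots> = - W t - \<alpha> * V t"
    unfolding eu cs W by (simp add: V_def algebra_simps)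
  finally show "(U has_real_derivative (1 - \<alpha>) * V t - W t) (at t)" by (simp add: algebra_simps)
  have e1: "W t * u ?x $ 2 = - (sin t * partial_deriv 1 \<rho> ?x)" and e2: "W t * u ?x $ 1 = sin t * partial_deriv 2 \<rho> ?x"
    using eqs(1,2) by (simp_all add: W_def)
  have "W t * V t = - sin t * (W t * u ?x $ 1) + cos t * (W t * u ?x $ 2)"
    by (simp add: V_def algebra_simps)
  also have "\<dots> = - sin t * (cos t * partial_deriv 1 \<rho> ?x + sin t * partial_deriv 2 \<rho> ?x)"
    unfolding e1 e2 by (simp add: algebra_simps)
  finally show "W t * V t = (2 * \<alpha> + 1) * (sin t * R t)"
    unfolding er by (simp add: R_def algebra_simps)
  have "W t * U t = cos t * (W t * u ?x $ 1) + sin t * (W t * u ?x $ 2)"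
    by (simp add: U_def algebra_simps)
  then show "W t * U t = sin t * R' t"
    unfolding e1 e2 by (simp add: R'_def algebra_simps)
  show "isCont W t"
    unfolding W_def[abs_def]
    by (rule isCont_o2[OF isCont_circ]) (use vorticity_continuous in \<open>simp add: continuous_on_eq_continuous_at open_Compl\<close>)
next
  show "V 0 = 0" using symmetry(2)[of 0] by (simp add: V_def)
qed

lemma U_even: "U (- t) = U t" and V_odd: "V (- t) = - V t"
  using symmetry[of t] by (simp_all add: U_def V_def)

text \<open>U is even, so its derivative (1 - \<alpha>) V - W is odd, and V is odd.\<close>

lemma W_odd: "W (- t) = - W t"
proof -
  have "((\<lambda>t. U (- t)) has_real_derivative - ((1 - \<alpha>) * V (- t) - W (- t))) (at t)"
    using DERIV_chain2[OF dU DERIV_minus[OF DERIV_ident], of t UNIV] by simp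
  then have "(U has_real_derivative - ((1 - \<alpha>) * V (- t) - W (- t))) (at t)" by (simp add: U_even)
  from DERIV_unique[OF this dU] show ?thesis by (simp add: V_odd algebra_simps)
qed

text \<open>Oddness and periodicity give W = 0 at 0 and pi, oddness extends W = 0 to the lower half
  circle, and homogeneity extends it to the punctured plane, against the assumption of
  rotation.\<close>

lemma rotational_contradiction:
  assumes "\<And>t. t \<in> {0<..<pi} \<Longrightarrow> W t = 0"
  shows False
proof -
  have W0: "W 0 = 0" using W_odd[of 0] by simp
  have Wpi: "W pi = 0"
  proof -
    have "circ (- pi) = circ pi" by (simp add: circ_def)
    then have "W (- pi) = W pi" by (simp add: W_def)
    then show ?thesis using W_odd[of pi] by simp
  qed
  have Wpos: "W t = 0" if "0 \<le> t" "t \<le> pi" for t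
    using assms[of t] W0 Wpi that by (cases "t = 0 \<or> t = pi") auto
  have Wall: "W t = 0" if "\<bar>t\<bar> \<le> pi" for t
    using Wpos[of t] Wpos[of "- t"] W_odd[of t] that by (cases "t \<ge> 0") auto
  have circle: "vorticity u x = 0" if "norm x = 1" for x
  proof -
    have "(x $ 1)\<^sup>2 + \<bar>x $ 2\<bar>\<^sup>2 = 1"
      using that by (simp add: norm_vec_def L2_set_def sum_2)
    then obtain t where t: "0 \<le> t" "t \<le> pi" "x $ 1 = cos t" "\<bar>x $ 2\<bar> = sin t"
      using sincos_total_pi[OF abs_ge_zero] by metis
    then have "x = circ t \<or> x = circ (- t)" by (auto simp: vec_eq_iff forall_2 abs_if split: if_splits)
    then show ?thesis using Wall[of t] Wall[of "- t"] t by (auto simp: W_def)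
  qed
  have all: "vorticity u x = 0" if x: "x \<noteq> 0" for x
  proof -
    let ?y = "x /\<^sub>R norm x"
    have y: "?y \<noteq> 0" and n: "norm x > 0" and xy: "norm x *\<^sub>R ?y = x" using x by auto
    note ph = partial_deriv_homogeneous[OF n y partial_deriv_component(1)[OF diff(1)] homogeneity(1)[OF n], unfolded xy]
    have "norm x * vorticity u x = norm x powr (- \<alpha>) * vorticity u ?y"
      using ph[of 2 1] ph[of 1 2] by (simp add: vorticity_def algebra_simps)
    also have "vorticity u ?y = 0" by (rule circle) (use x in simp)
    finally show ?thesis using x by simp
  qed
  then show False
    using sol unfolding homogeneous_boussinesq_def rotational_on_def by auto
qed

end

lemma isCont_comp_circ:
  "continuous_on (- {0}) F \<Longrightarrow> isCont (\<lambda>t. F (circ t)) t"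
  by (rule isCont_o2[OF isCont_circ]) (simp add: continuous_on_eq_continuous_at open_Compl)

locale homogeneous_flow_C2 = homogeneous_flow +
  assumes C2: "Ck_on (Suc (Suc 0)) (- {0}) u"
begin

lemma vorticity_C1:
  assumes x: "x \<noteq> 0"
  shows "vorticity u differentiable (at x)"
    and "partial_deriv i (vorticity u) x =
      partial_deriv i (partial_deriv 1 u) x $ 2 - partial_deriv i (partial_deriv 2 u) x $ 1"
proof -
  have "partial_deriv j u differentiable (at x)" for j using C2 x by simp
  note d = this[unfolded frechet_derivative_works, THEN bounded_linear.has_derivative[OF bounded_linear_vec_nth]]
  have 1: "(vorticity u has_derivative (\<lambda>v. frechet_derivative (partial_deriv 1 u) (at x) v $ 2 -
      frechet_derivative (partial_deriv 2 u) (at x) v $ 1)) (at x)"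
    by (rule has_derivative_transform_within_open[OF has_derivative_diff[OF d d], where s = "- {0}"])
       (use x in \<open>auto simp: vorticity_components\<close>)
  then show "vorticity u differentiable (at x)" by (auto simp: differentiable_def)
  show "partial_deriv i (vorticity u) x =
      partial_deriv i (partial_deriv 1 u) x $ 2 - partial_deriv i (partial_deriv 2 u) x $ 1"
    unfolding partial_deriv_eqI[OF 1] by (simp add: partial_deriv_def)
qed

definition W' where
  "W' t = - sin t * partial_deriv 1 (vorticity u) (circ t) + cos t * partial_deriv 2 (vorticity u) (circ t)"

sublocale circle_flow_C1_vorticity \<alpha> U V R W R' W'
proof
  show "(W has_real_derivative W' t) (at t)" for t
    unfolding W_def[abs_def] W'_def by (rule DERIV_along_circle[OF vorticity_C1(1)[OF circ_nonzero]])
qed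

lemma isCont_W': "isCont W' t"
proof -
  have "continuous_on (- {0}) (partial_deriv i (partial_deriv j u))" for i j
    using C2 by simp
  then show ?thesis
    unfolding W'_def[abs_def] vorticity_C1(2)[OF circ_nonzero]
    by (intro continuous_intros isCont_comp_circ[of "partial_deriv _ (partial_deriv _ u)"]) auto
qed

text \<open>Along the circle the extended quotient tends to its value at (1, 0), a point of the axis
  where it vanishes by assumption.\<close>

lemma \<kappa>_tendsto_zero:
  assumes "vorticity_quotient_vanishes u"
  shows "(\<kappa> \<longlongrightarrow> 0) (at_right 0)"
proof -
  obtain g where g: "continuous_on (- {0}) g" "\<And>x. x $ 2 \<noteq> 0 \<Longrightarrow> g x = vorticity u x / x $ 2"
      "\<And>x. x \<noteq> 0 \<Longrightarrow> x $ 2 = 0 \<Longrightarrow> g x = 0"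
    using assms unfolding vorticity_quotient_vanishes_def by blast
  have "((\<lambda>t. g (circ t)) \<longlongrightarrow> g (circ 0)) (at_right 0)"
    using isCont_comp_circ[OF g(1), of 0] unfolding isCont_def by (rule tendsto_mono[OF at_le, rotated]) simp
  then have "((\<lambda>t. g (circ t)) \<longlongrightarrow> 0) (at_right 0)" by (simp add: g(3))
  then show ?thesis
  proof (rule Lim_transform_eventually)
    show "\<forall>\<^sub>F t in at_right 0. g (circ t) = \<kappa> t"
    proof (rule eventually_at_rightI[of 0 pi])
      fix t assume "t \<in> {0<..<pi}"
      then have "sin t > 0" by (rule sin_pos)
      then show "g (circ t) = \<kappa> t" by (simp add: g(2) \<kappa>_def W_def)
    qed simp
  qed
qed

end

lemma homogeneous_flow_C2I:
  assumes "homogeneous_boussinesq (Suc (Suc 0)) (- {0}) \<alpha> u p \<rho>"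
  shows "homogeneous_flow_C2 \<alpha> u p \<rho>"
proof
  show "homogeneous_boussinesq (Suc 0) (- {0}) \<alpha> u p \<rho>"
    by (rule homogeneous_boussinesq_C1[OF assms])
  show "Ck_on (Suc (Suc 0)) (- {0}) u"
    using assms unfolding homogeneous_boussinesq_def by blast
qed

lemma no_C1_solution:
  assumes "- 1 / 2 \<le> \<alpha>" "\<alpha> \<le> 1"
  shows "\<not> homogeneous_boussinesq 1 (- {0}) \<alpha> u p \<rho>"
proof
  assume "homogeneous_boussinesq 1 (- {0}) \<alpha> u p \<rho>"
  then interpret homogeneous_flow \<alpha> u p \<rho> by unfold_locales simp
  show False by (rule rotational_contradiction) (rule irrotational_C1[OF assms])
qed

lemma no_C2_solution:
  assumes "- 2 < \<alpha>" "\<alpha> < - 1 / 2"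
  shows "\<not> homogeneous_boussinesq 2 (- {0}) \<alpha> u p \<rho>"
proof
  assume "homogeneous_boussinesq 2 (- {0}) \<alpha> u p \<rho>"
  then interpret homogeneous_flow_C2 \<alpha> u p \<rho>
    unfolding numeral_2_eq_2 by (rule homogeneous_flow_C2I)
  show False
    by (rule rotational_contradiction, rule irrotational_C2) (use assms W_odd[of 0] in auto)
qed

lemma no_C2_solution_critical:
  assumes "vorticity_quotient_vanishes u"
  shows "\<not> homogeneous_boussinesq 2 (- {0}) (- 2) u p \<rho>"
proof
  assume "homogeneous_boussinesq 2 (- {0}) (- 2) u p \<rho>"
  then interpret homogeneous_flow_C2 "- 2" u p \<rho>
    unfolding numeral_2_eq_2 by (rule homogeneous_flow_C2I)
  show False
    by (rule rotational_contradiction, rule irrotational_critical[OF refl isCont_W' \<kappa>_tendsto_zero[OF assms]])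
qed

theorem theorem1p7:
  shows "(\<forall>\<alpha>::real. - 1 / 2 \<le> \<alpha> \<and> \<alpha> \<le> 1 \<longrightarrow>
           \<not> (\<exists>u p \<rho>. homogeneous_boussinesq 1 (- {0}) \<alpha> u p \<rho>))
       \<and> (\<forall>\<alpha>::real. - 2 < \<alpha> \<and> \<alpha> < - 1 / 2 \<longrightarrow>
           \<not> (\<exists>u p \<rho>. homogeneous_boussinesq 2 (- {0}) \<alpha> u p \<rho>))
       \<and> \<not> (\<exists>u p \<rho>. homogeneous_boussinesq 2 (- {0}) (- 2) u p \<rho>
             \<and> vorticity_quotient_vanishes u)
       \<and> (\<forall>\<alpha>::real. \<alpha> > 1 \<longrightarrow>
           (\<exists>u p \<rho>. homogeneous_boussinesq 2 (- {0}) \<alpha> u p \<rho>))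
       \<and> (\<forall>\<alpha>::real. \<alpha> < - 2 \<longrightarrow>
           (\<exists>u p \<rho>. homogeneous_boussinesq 1 UNIV \<alpha> u p \<rho>))"
proof (intro conjI allI impI)
  show "\<nexists>u p \<rho>. homogeneous_boussinesq 1 (- {0}) \<alpha> u p \<rho>" if "- 1 / 2 \<le> \<alpha> \<and> \<alpha> \<le> 1" for \<alpha>
    using no_C1_solution that by blast
  show "\<nexists>u p \<rho>. homogeneous_boussinesq 2 (- {0}) \<alpha> u p \<rho>" if "- 2 < \<alpha> \<and> \<alpha> < - 1 / 2" for \<alpha>
    using no_C2_solution that by blast
  show "\<nexists>u p \<rho>. homogeneous_boussinesq 2 (- {0}) (- 2) u p \<rho> \<and> vorticity_quotient_vanishes u"
    using no_C2_solution_critical by blast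
  show "\<exists>u p \<rho>. homogeneous_boussinesq 2 (- {0}) \<alpha> u p \<rho>" if "\<alpha> > 1" for \<alpha> :: real
    using that by (intro homogeneous_solution_exists) auto
  show "\<exists>u p \<rho>. homogeneous_boussinesq 1 UNIV \<alpha> u p \<rho>" if "\<alpha> < - 2" for \<alpha> :: real
    using that by (intro homogeneous_solution_exists) auto
qed

end
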